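(* Let $K\in\{-1,0,1\}$, $c_1,c_2\in\mathbb{R}$, and let $v\in C^2(\overline{\mathbb{R}^2_+}\setminus\{0\})$ solve $$\Delta v+2Ke^v=0\text{ in }\mathbb{R}^2_+=\{(s,t):t>0\},\qquad \frac{\partial v}{\partial t}=c_1e^{v/2}\text{ on }\{t=0,s>0\},\qquad \frac{\partial v}{\partial t}=c_2e^{v/2}\text{ on }\{t=0,s<0\},$$ with $\int_{\mathbb{R}^2_+}e^v<\infty$. Then $v$ is a canonical solution.
   Context: Identify $\mathbb{R}^2\equiv\mathbb{C}$, $z=s+it$. On the closed upper half-plane minus $0$, $\log z=\ln|z|+i\arg z$ with $\arg z\in[0,\pi]$, $z^\gamma=e^{\gamma\log z}$. A canonical solution is a function of one of the forms: (a) $v_1=\log\dfrac{4\lambda^2\gamma^2|z|^{2(\gamma-1)}}{(K\lambda^2+|z^\gamma-z_0|^2)^2}$ with $\gamma,\lambda>0$, $z_0\in\mathbb{C}$ such that $K\lambda^2+|z^\gamma-z_0|^2\neq0$ for all $z$ in the closed upper half-plane; (b) $v_2=\log\dfrac{4\lambda^2}{|z|^2(K\lambda^2+|\log z-z_0|^2)^2}$ with $\lambda>0$, $z_0\in\mathbb{C}$ such that $K\lambda^2+|\log z-z_0|^2\neq0$ for all $z\neq0$ in the closed upper half-plane. *)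

theory Defs
  imports "HOL-Analysis.Analysis"
begin

definition closed_half_plane_punct :: "complex set" where
  "closed_half_plane_punct = {z. 0 \<le> Im z \<and> z \<noteq> 0}"

definition open_half_plane :: "complex set" where
  "open_half_plane = {z. 0 < Im z}"

definition C2_partials ::
  "complex set \<Rightarrow> (complex \<Rightarrow> real) \<Rightarrow> (complex \<Rightarrow> real) \<Rightarrow> (complex \<Rightarrow> real)
   \<Rightarrow> (complex \<Rightarrow> real) \<Rightarrow> (complex \<Rightarrow> real) \<Rightarrow> (complex \<Rightarrow> real) \<Rightarrow> (complex \<Rightarrow> real) \<Rightarrow> bool"
where
  "C2_partials S v vs vt vss vst vts vtt \<longleftrightarrow>
     (\<forall>z\<in>S. (v has_derivative (\<lambda>h. vs z * Re h + vt z * Im h)) (at z within S)) \<and>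
     (\<forall>z\<in>S. (vs has_derivative (\<lambda>h. vss z * Re h + vst z * Im h)) (at z within S)) \<and>
     (\<forall>z\<in>S. (vt has_derivative (\<lambda>h. vts z * Re h + vtt z * Im h)) (at z within S)) \<and>
     continuous_on S vss \<and> continuous_on S vst \<and> continuous_on S vts \<and> continuous_on S vtt"

text \<open>Complex logarithm with arg in [0,pi] on the closed upper half-plane minus 0:
  this is exactly Isabelle's principal branch Ln (Arg in (-pi,pi]).
  z^gamma = exp(gamma log z) for z \<noteq> 0, i.e. z powr gamma (which is 0 at z = 0).\<close>

definition canonical_v1 :: "real \<Rightarrow> real \<Rightarrow> real \<Rightarrow> complex \<Rightarrow> complex \<Rightarrow> real" where
  "canonical_v1 K gam lam z0 z =
     ln (4 * lam^2 * gam^2 * cmod z powr (2 * (gam - 1)) /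
         (K * lam^2 + (cmod (z powr (complex_of_real gam) - z0))^2)^2)"

definition canonical_v2 :: "real \<Rightarrow> real \<Rightarrow> complex \<Rightarrow> complex \<Rightarrow> real" where
  "canonical_v2 K lam z0 z =
     ln (4 * lam^2 / ((cmod z)^2 * (K * lam^2 + (cmod (Ln z - z0))^2)^2))"

definition canonical_solution :: "real \<Rightarrow> (complex \<Rightarrow> real) \<Rightarrow> bool" where
  "canonical_solution K v \<longleftrightarrow>
     (\<exists>gam lam z0. gam > 0 \<and> lam > 0 \<and>
        (\<forall>z. 0 \<le> Im z \<longrightarrow> K * lam^2 + (cmod (z powr (complex_of_real gam) - z0))^2 \<noteq> 0) \<and>
        (\<forall>z\<in>closed_half_plane_punct. v z = canonical_v1 K gam lam z0 z))
   \<or> (\<exists>lam z0. lam > 0 \<and>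
        (\<forall>z\<in>closed_half_plane_punct. K * lam^2 + (cmod (Ln z - z0))^2 \<noteq> 0) \<and>
        (\<forall>z\<in>closed_half_plane_punct. v z = canonical_v2 K lam z0 z))"

end

theory Submission
  imports Defs
begin

text \<open>
  In the logarithmic coordinate \<open>w\<close>, with \<open>z = exp w\<close>, the function \<open>V = v + 2 ln \<bar>z\<bar>\<close> solves the
  same problem on the strip \<open>0 \<le> Im w \<le> pi\<close>. Since the total area is finite, small area near \<open>0\<close> and
  near infinity forces \<open>V\<close> to tend to \<open>- \<infinity>\<close> at both ends, by point picking and a mean value
  inequality valid up to the boundary. The means of \<open>V\<close> over vertical cross sections have bounded
  second derivative, so \<open>V\<close> and its local energy grow at most polynomially. The Schwarzian
  \<open>q = V\<^sub>w\<^sub>w - V\<^sub>w\<^sup>2 / 2\<close> is holomorphic and, by the boundary condition, real on both boundary lines.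
  Hence the real part of the integral of \<open>q exp (- n w)\<close> over a cross section does not depend on
  the section, and polynomial growth makes it vanish for every integer \<open>n \<noteq> 0\<close>: \<open>q\<close> is a real
  constant. Then \<open>U = exp (- V / 2)\<close> satisfies \<open>U\<^sub>w\<^sub>w = - q U / 2\<close>, so it splits as a sum of a function
  of \<open>x\<close> and a function of \<open>y\<close>, which solve linear equations with constant coefficients. Because \<open>U\<close>
  tends to infinity at both ends, only the canonical solutions remain.
\<close>

section \<open>Twice differentiable functions of two real variables\<close>

text \<open>Only C^2 regularity up to the boundary is available, so the Schwarzian is merely
  continuous and its Cauchy-Riemann equations cannot be written down pointwise. They are used in
  integrated form: integration by parts in \<open>y\<close> removes the second derivatives of
  \<open>V\<close> from a moment, and the moment can then be differentiated in \<open>x\<close>. For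
  the same reason elliptic regularity is replaced by an elementary mean value inequality with a
  polynomial kernel. The boundary constants have arbitrary sign, so this inequality accepts
  one-sided bounds on the Laplacian and on the normal derivative; they enter as error terms of order
  \<open>r\<^sup>2\<close> and \<open>r\<close>, which become harmless on small discs. The
  contradiction with a nonzero moment comes from the integral of \<open>V\<^sup>2\<close> over a
  cross section. Its second derivative in \<open>x\<close> is twice the energy up to a bounded
  error, so an exponentially growing energy would force exponential growth of
  \<open>V\<close>.\<close>

lemma has_derivative_horizontal:
  assumes "(f has_derivative (\<lambda>h. a * Re h + b * Im h)) (at (Complex x y) within S)"
    and "\<And>x'. x' \<in> X \<Longrightarrow> Complex x' y \<in> S"
  shows "((\<lambda>x. f (Complex x y)) has_real_derivative a) (at x within X)"
proof -
  have g: "((\<lambda>x. Complex x y) has_derivative (\<lambda>h. Complex h 0)) (at x within X)"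
    by (auto simp: Complex_eq intro!: derivative_eq_intros)
  have "(f has_derivative (\<lambda>h. a * Re h + b * Im h)) (at (Complex x y) within (\<lambda>x. Complex x y) ` X)"
    by (rule has_derivative_subset[OF assms(1)]) (use assms(2) in auto)
  from diff_chain_within[OF g this] show ?thesis
    unfolding has_field_derivative_def by (simp add: o_def)
qed

lemma has_derivative_vertical:
  assumes "(f has_derivative (\<lambda>h. a * Re h + b * Im h)) (at (Complex x y) within S)"
    and "\<And>y'. y' \<in> Y \<Longrightarrow> Complex x y' \<in> S"
  shows "((\<lambda>y. f (Complex x y)) has_real_derivative b) (at y within Y)"
proof -
  have g: "((\<lambda>y. Complex x y) has_derivative (\<lambda>h. Complex 0 h)) (at y within Y)"
    by (auto simp: Complex_eq intro!: derivative_eq_intros)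
  have "(f has_derivative (\<lambda>h. a * Re h + b * Im h)) (at (Complex x y) within (\<lambda>y. Complex x y) ` Y)"
    by (rule has_derivative_subset[OF assms(1)]) (use assms(2) in auto)
  from diff_chain_within[OF g this] show ?thesis
    unfolding has_field_derivative_def by (simp add: o_def)
qed

lemma C2_partials_deriv_x:
  assumes "C2_partials S f fx fy fxx fxy fyx fyy"
    and "Complex x y \<in> S" and "\<And>x'. x' \<in> X \<Longrightarrow> Complex x' y \<in> S"
  shows "((\<lambda>x. f (Complex x y)) has_real_derivative fx (Complex x y)) (at x within X)"
    and "((\<lambda>x. fx (Complex x y)) has_real_derivative fxx (Complex x y)) (at x within X)"
    and "((\<lambda>x. fy (Complex x y)) has_real_derivative fyx (Complex x y)) (at x within X)"
  using assms unfolding C2_partials_def by (blast intro: has_derivative_horizontal)+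

lemma C2_partials_deriv_y:
  assumes "C2_partials S f fx fy fxx fxy fyx fyy"
    and "Complex x y \<in> S" and "\<And>y'. y' \<in> Y \<Longrightarrow> Complex x y' \<in> S"
  shows "((\<lambda>y. f (Complex x y)) has_real_derivative fy (Complex x y)) (at y within Y)"
    and "((\<lambda>y. fx (Complex x y)) has_real_derivative fxy (Complex x y)) (at y within Y)"
    and "((\<lambda>y. fy (Complex x y)) has_real_derivative fyy (Complex x y)) (at y within Y)"
  using assms unfolding C2_partials_def by (blast intro: has_derivative_vertical)+

lemma C2_partials_continuous:
  assumes "C2_partials S f fx fy fxx fxy fyx fyy"
  shows "continuous_on S f" "continuous_on S fx" "continuous_on S fy"
    "continuous_on S fxx" "continuous_on S fxy" "continuous_on S fyx" "continuous_on S fyy"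
  using assms unfolding C2_partials_def
  by (auto intro!: has_derivative_continuous_on)

text \<open>One chain rule serves three purposes: \<open>exp (v z)\<close>, the tents built from
  \<open>cutoff\<close>, and \<open>C0 - V\<close>.\<close>

lemma C2_partials_compose:
  assumes C2: "C2_partials S f fx fy fxx fxy fyx fyy"
    and \<phi>: "\<And>t. (\<phi> has_real_derivative \<phi>' t) (at t)" "\<And>t. (\<phi>' has_real_derivative \<phi>'' t) (at t)"
    and cont: "continuous_on UNIV \<phi>''"
  shows "C2_partials S (\<lambda>z. \<phi> (f z)) (\<lambda>z. \<phi>' (f z) * fx z) (\<lambda>z. \<phi>' (f z) * fy z)
     (\<lambda>z. \<phi>'' (f z) * fx z ^ 2 + \<phi>' (f z) * fxx z) (\<lambda>z. \<phi>'' (f z) * fx z * fy z + \<phi>' (f z) * fxy z)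
     (\<lambda>z. \<phi>'' (f z) * fx z * fy z + \<phi>' (f z) * fyx z) (\<lambda>z. \<phi>'' (f z) * fy z ^ 2 + \<phi>' (f z) * fyy z)"
proof -
  note c = C2_partials_continuous[OF C2]
  have c'': "continuous_on S (\<lambda>z. \<phi>'' (f z))"
    by (rule continuous_on_compose2[OF cont c(1)]) auto
  have c': "continuous_on S (\<lambda>z. \<phi>' (f z))"
    by (rule continuous_on_compose2[OF _ c(1), of UNIV])
       (auto intro!: continuous_at_imp_continuous_on DERIV_isCont \<phi>)
  have f: "(f has_derivative (\<lambda>h. fx z * Re h + fy z * Im h)) (at z within S)"
    "(fx has_derivative (\<lambda>h. fxx z * Re h + fxy z * Im h)) (at z within S)"
    "(fy has_derivative (\<lambda>h. fyx z * Re h + fyy z * Im h)) (at z within S)" if "z \<in> S" for z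
    using C2 that unfolding C2_partials_def by auto
  have d: "((\<lambda>z. \<phi> (f z)) has_derivative (\<lambda>h. (fx z * Re h + fy z * Im h) * \<phi>' (f z))) (at z within S)"
    and d': "((\<lambda>z. \<phi>' (f z)) has_derivative (\<lambda>h. (fx z * Re h + fy z * Im h) * \<phi>'' (f z))) (at z within S)"
    if "z \<in> S" for z
    using DERIV_compose_FDERIV[OF \<phi>(1) f(1)[OF that]] DERIV_compose_FDERIV[OF \<phi>(2) f(1)[OF that]] by auto
  show ?thesis
    unfolding C2_partials_def
  proof (intro conjI ballI)
    fix z assume z: "z \<in> S"
    show "((\<lambda>z. \<phi> (f z)) has_derivative (\<lambda>h. \<phi>' (f z) * fx z * Re h + \<phi>' (f z) * fy z * Im h)) (at z within S)"
      by (rule has_derivative_eq_rhs[OF d[OF z]]) (auto simp: algebra_simps)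
    show "((\<lambda>z. \<phi>' (f z) * fx z) has_derivative
          (\<lambda>h. (\<phi>'' (f z) * (fx z)\<^sup>2 + \<phi>' (f z) * fxx z) * Re h + (\<phi>'' (f z) * fx z * fy z + \<phi>' (f z) * fxy z) * Im h))
          (at z within S)"
      by (rule has_derivative_eq_rhs[OF has_derivative_mult[OF d'[OF z] f(2)[OF z]]])
         (auto simp: algebra_simps power2_eq_square)
    show "((\<lambda>z. \<phi>' (f z) * fy z) has_derivative
          (\<lambda>h. (\<phi>'' (f z) * fx z * fy z + \<phi>' (f z) * fyx z) * Re h + (\<phi>'' (f z) * (fy z)\<^sup>2 + \<phi>' (f z) * fyy z) * Im h))
          (at z within S)"
      by (rule has_derivative_eq_rhs[OF has_derivative_mult[OF d'[OF z] f(3)[OF z]]])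
         (auto simp: algebra_simps power2_eq_square)
  qed (intro continuous_intros c c' c'')+
qed

lemma continuous_on_slice:
  assumes "continuous_on S f" "\<And>x y. x \<in> {a..b} \<Longrightarrow> y \<in> {c..d} \<Longrightarrow> Complex x y \<in> S"
  shows "continuous_on (cbox (a, c) (b, d)) (\<lambda>(x, y). f (Complex x y))"
    and "continuous_on ({a..b} \<times> {c..d}) (\<lambda>(x, y). f (Complex x y))"
proof -
  show "continuous_on ({a..b} \<times> {c..d}) (\<lambda>(x, y). f (Complex x y))"
    unfolding case_prod_beta
    by (rule continuous_on_compose2[OF assms(1)])
       (auto simp: Complex_eq intro!: continuous_intros assms(2)[unfolded Complex_eq])
  then show "continuous_on (cbox (a, c) (b, d)) (\<lambda>(x, y). f (Complex x y))"
    by (simp add: cbox_Pair_eq)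
qed

text \<open>Differentiate \<open>f x y = f x c + integral {c..y} (fy x)\<close> in \<open>x\<close>, then in \<open>y\<close>.\<close>

lemma C2_partials_symmetric:
  assumes C2: "C2_partials S f fx fy fxx fxy fyx fyy"
    and R: "\<And>x y. x \<in> {a..b} \<Longrightarrow> y \<in> {c..d} \<Longrightarrow> Complex x y \<in> S"
    and ab: "a < b" "c < d" and xy: "x \<in> {a..b}" "y \<in> {c..d}"
  shows "fxy (Complex x y) = fyx (Complex x y)"
proof -
  note cont = C2_partials_continuous[OF C2]
  have csub: "continuous_on {c..y} (\<lambda>y. g (Complex x y))" if "continuous_on S g" "x \<in> {a..b}" "y \<in> {c..d}" for g x y
    by (rule continuous_on_compose2[OF that(1)])
       (use that R in \<open>auto simp: Complex_eq intro!: continuous_intros R[unfolded Complex_eq]\<close>)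
  have 1: "f (Complex x y) - f (Complex x c) = integral {c..y} (\<lambda>t. fy (Complex x t))"
    if "x \<in> {a..b}" "y \<in> {c..d}" for x y
  proof -
    have "((\<lambda>t. fy (Complex x t)) has_integral f (Complex x y) - f (Complex x c)) {c..y}"
      by (rule fundamental_theorem_of_calculus)
         (use that R in \<open>auto simp flip: has_real_derivative_iff_has_vector_derivative
            intro!: C2_partials_deriv_y(1)[OF C2]\<close>)
    then show ?thesis by (simp add: integral_unique)
  qed
  have 2: "fx (Complex x y) - fx (Complex x c) = integral {c..y} (\<lambda>t. fyx (Complex x t))"
    if xy: "x \<in> {a..b}" "y \<in> {c..d}" for x y
  proof -
    have "((\<lambda>x. integral (cbox c y) (\<lambda>t. fy (Complex x t))) has_field_derivative
        integral (cbox c y) (\<lambda>t. fyx (Complex x t))) (at x within {a..b})"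
    proof (rule leibniz_rule_field_derivative)
      show "continuous_on ({a..b} \<times> cbox c y) (\<lambda>(x, t). fyx (Complex x t))"
        using continuous_on_slice(2)[OF cont(6), of a b c y] R xy by auto
    qed (use xy R in \<open>auto intro!: C2_partials_deriv_x(3)[OF C2] integrable_continuous_interval csub cont\<close>)
    moreover have "((\<lambda>x. integral (cbox c y) (\<lambda>t. fy (Complex x t))) has_field_derivative
        fx (Complex x y) - fx (Complex x c)) (at x within {a..b})"
    proof (rule has_field_derivative_transform_within[where d = 1 and f = "\<lambda>x. f (Complex x y) - f (Complex x c)"])
      show "((\<lambda>x. f (Complex x y) - f (Complex x c)) has_real_derivative
          fx (Complex x y) - fx (Complex x c)) (at x within {a..b})"
        using xy R by (intro derivative_intros C2_partials_deriv_x(1)[OF C2]) auto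
    qed (use xy 1 in auto)
    ultimately show ?thesis
      using vector_derivative_unique_within[of x "{a..b}"] ab xy
      by (auto simp: has_real_derivative_iff_has_vector_derivative trivial_limit_within islimpt_Icc)
  qed
  have "((\<lambda>y. integral {c..y} (\<lambda>t. fyx (Complex x t))) has_vector_derivative fyx (Complex x y)) (at y within {c..d})"
    using xy(2) by (rule integral_has_vector_derivative[OF csub[OF cont(6)], rotated 2]) (use xy ab in auto)
  moreover have "((\<lambda>y. integral {c..y} (\<lambda>t. fyx (Complex x t))) has_vector_derivative fxy (Complex x y)) (at y within {c..d})"
    unfolding has_real_derivative_iff_has_vector_derivative[symmetric]
  proof (rule has_field_derivative_transform_within[where d = 1 and f = "\<lambda>y. fx (Complex x y) - fx (Complex x c)"])
    show "((\<lambda>y. fx (Complex x y) - fx (Complex x c)) has_real_derivative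
          fxy (Complex x y)) (at y within {c..d})"
      using xy R by (auto intro!: derivative_eq_intros C2_partials_deriv_y(2)[OF C2])
  qed (use xy 2 in auto)
  ultimately show ?thesis
    using vector_derivative_unique_within[of y "{c..d}"] ab xy
    by (auto simp: trivial_limit_within islimpt_Icc)
qed

section \<open>A mean value inequality with Neumann data\<close>

text \<open>An exponent of at least two makes the truncated power differentiable also at the kink.
  Two applications show that the fourth power, from which the tents are made, is of class
  C^2.\<close>

lemma DERIV_max_0_power:
  "((\<lambda>u::real. max 0 u ^ (k + 2)) has_real_derivative real (k + 2) * max 0 u ^ (k + 1)) (at u)"
proof (cases u "0 :: real" rule: linorder_cases)
  case less
  have "((\<lambda>u::real. 0) has_real_derivative 0) (at u)" by simp
  then have "((\<lambda>u::real. max 0 u ^ (k + 2)) has_real_derivative 0) (at u)"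
    by (rule has_field_derivative_transform_within_open[where S = "{..<0}"]) (use less in auto)
  then show ?thesis using less by simp
next
  case greater
  have "((\<lambda>u::real. u ^ (k + 2)) has_real_derivative real (k + 2) * u ^ (k + 1)) (at u)"
    using DERIV_pow[of "k + 2" u] by simp
  then have "((\<lambda>u::real. max 0 u ^ (k + 2)) has_real_derivative real (k + 2) * u ^ (k + 1)) (at u)"
    by (rule has_field_derivative_transform_within_open[where S = "{0<..}"]) (use greater in auto)
  then show ?thesis using greater by (simp add: max_absorb2)
next
  case equal
  have "(\<lambda>h::real. max 0 h ^ (k + 2) / h) \<midarrow>0\<rightarrow> 0"
  proof (rule Lim_null_comparison)
    show "\<forall>\<^sub>F h::real in at 0. norm (max 0 h ^ (k + 2) / h) \<le> \<bar>h\<bar> ^ (k + 1)"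
      by (rule always_eventually) (auto simp: max_def power_abs intro!: mult_nonpos_nonneg)
    show "((\<lambda>h::real. \<bar>h\<bar> ^ (k + 1)) \<longlongrightarrow> 0) (at 0)"
      by (rule tendsto_eq_intros refl)+ simp
  qed
  then show ?thesis
    using equal by (simp add: DERIV_def)
qed

text \<open>Kept in a general Euclidean space because it is applied both to a rectangle and to its
  bottom edge.\<close>

lemma integral_le_support:
  fixes F :: "'a::euclidean_space \<Rightarrow> real"
  assumes int: "F integrable_on cbox a b" and M: "0 \<le> M"
    and le: "\<And>z. z \<in> cbox a b \<Longrightarrow> z \<in> cbox u v \<Longrightarrow> F z \<le> M"
    and out: "\<And>z. z \<in> cbox a b \<Longrightarrow> z \<notin> cbox u v \<Longrightarrow> F z \<le> 0"
  shows "integral (cbox a b) F \<le> M * measure lborel (cbox u v)"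
proof -
  obtain p q where pq: "cbox a b \<inter> cbox u v = cbox p q"
    using Int_interval by blast
  have i: "((\<lambda>z. if z \<in> cbox u v then M else 0) has_integral M * measure lborel (cbox p q)) (cbox a b)"
    using has_integral_const_real has_integral_const[of M p q]
    by (subst has_integral_restrict_Int) (simp add: Int_commute pq[symmetric] mult.commute)
  have "integral (cbox a b) F \<le> M * measure lborel (cbox p q)"
    by (rule has_integral_le[OF integrable_integral[OF int] i]) (use le out in auto)
  also have "\<dots> \<le> M * measure lborel (cbox u v)"
    using pq M by (intro mult_left_mono content_subset) auto
  finally show ?thesis .
qed

lemma green_interval:
  fixes f T :: "real \<Rightarrow> real"
  assumes "a \<le> b"
    and "\<And>x. x \<in> {a..b} \<Longrightarrow> (f has_real_derivative f' x) (at x within {a..b})"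
    and "\<And>x. x \<in> {a..b} \<Longrightarrow> (f' has_real_derivative f'' x) (at x within {a..b})"
    and "\<And>x. x \<in> {a..b} \<Longrightarrow> (T has_real_derivative T' x) (at x within {a..b})"
    and "\<And>x. x \<in> {a..b} \<Longrightarrow> (T' has_real_derivative T'' x) (at x within {a..b})"
  shows "integral {a..b} (\<lambda>x. f x * T'' x - T x * f'' x) = f b * T' b - T b * f' b - (f a * T' a - T a * f' a)"
proof (rule integral_unique, rule fundamental_theorem_of_calculus)
  show "((\<lambda>x. f x * T' x - T x * f' x) has_vector_derivative f x * T'' x - T x * f'' x) (at x within {a..b})"
    if "x \<in> {a..b}" for x
    unfolding has_real_derivative_iff_has_vector_derivative[symmetric]
    by (auto intro!: derivative_eq_intros assms that)
qed fact

text \<open>Green's second identity, one variable at a time. \<open>T\<close> is meant to be a tent: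
  it vanishes together with its normal derivative on the two sides and the top, and its normal
  derivative vanishes at the bottom, so only the Neumann data of \<open>f\<close> survive.\<close>

lemma green_rectangle:
  assumes f: "C2_partials S f fx fy fxx fxy fyx fyy"
    and T: "C2_partials S T Tx Ty Txx Txy Tyx Tyy"
    and R: "\<And>x y. x \<in> {a..b} \<Longrightarrow> y \<in> {c..d} \<Longrightarrow> Complex x y \<in> S"
    and ab: "a \<le> b" "c \<le> d"
    and zx: "\<And>y x. y \<in> {c..d} \<Longrightarrow> x = a \<or> x = b \<Longrightarrow> T (Complex x y) = 0 \<and> Tx (Complex x y) = 0"
    and zd: "\<And>x. x \<in> {a..b} \<Longrightarrow> T (Complex x d) = 0 \<and> Ty (Complex x d) = 0"
    and zc: "\<And>x. x \<in> {a..b} \<Longrightarrow> Ty (Complex x c) = 0"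
  defines "H \<equiv> \<lambda>z. f z * (Txx z + Tyy z) - T z * (fxx z + fyy z)"
  shows "integral (cbox (a, c) (b, d)) (\<lambda>(x, y). H (Complex x y)) =
    integral {a..b} (\<lambda>x. T (Complex x c) * fy (Complex x c))"
proof -
  note cf = C2_partials_continuous[OF f] and cT = C2_partials_continuous[OF T]
  define F G where "F = (\<lambda>z. f z * Txx z - T z * fxx z)" and "G = (\<lambda>z. f z * Tyy z - T z * fyy z)"
  have cF: "continuous_on S F" and cG: "continuous_on S G"
    unfolding F_def G_def by (intro continuous_intros cf cT)+
  have cF': "continuous_on (cbox (a, c) (b, d)) (\<lambda>(x, y). F (Complex x y))"
    and cG': "continuous_on (cbox (a, c) (b, d)) (\<lambda>(x, y). G (Complex x y))"
    using continuous_on_slice(1)[OF cF R] continuous_on_slice(1)[OF cG R] by blast+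
  have "(\<lambda>(x, y). H (Complex x y)) = (\<lambda>z. (\<lambda>(x, y). F (Complex x y)) z + (\<lambda>(x, y). G (Complex x y)) z)"
    by (auto simp: H_def F_def G_def algebra_simps)
  then have "integral (cbox (a, c) (b, d)) (\<lambda>(x, y). H (Complex x y)) =
      integral (cbox (a, c) (b, d)) (\<lambda>(x, y). F (Complex x y)) + integral (cbox (a, c) (b, d)) (\<lambda>(x, y). G (Complex x y))"
    using cF' cG' by (simp add: Henstock_Kurzweil_Integration.integral_add integrable_continuous)
  also have "integral (cbox (a, c) (b, d)) (\<lambda>(x, y). F (Complex x y)) =
      integral {c..d} (\<lambda>y. integral {a..b} (\<lambda>x. F (Complex x y)))"
    using integral_prod_continuous[OF cF'] integral_swap_continuous[OF cF'] by simp
  also have "\<dots> = integral {c..d} (\<lambda>y. 0)"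
  proof (rule integral_cong)
    fix y assume y: "y \<in> {c..d}"
    have "integral {a..b} (\<lambda>x. F (Complex x y)) =
       f (Complex b y) * Tx (Complex b y) - T (Complex b y) * fx (Complex b y)
        - (f (Complex a y) * Tx (Complex a y) - T (Complex a y) * fx (Complex a y))"
      unfolding F_def
      by (rule green_interval) (use y R ab in \<open>auto intro!: C2_partials_deriv_x[OF f] C2_partials_deriv_x[OF T]\<close>)
    then show "integral {a..b} (\<lambda>x. F (Complex x y)) = 0"
      using zx[OF y] by simp
  qed
  also have "integral (cbox (a, c) (b, d)) (\<lambda>(x, y). G (Complex x y)) =
      integral {a..b} (\<lambda>x. integral {c..d} (\<lambda>y. G (Complex x y)))"
    using integral_prod_continuous[OF cG'] by simp
  also have "\<dots> = integral {a..b} (\<lambda>x. T (Complex x c) * fy (Complex x c))"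
  proof (rule integral_cong)
    fix x assume x: "x \<in> {a..b}"
    have "integral {c..d} (\<lambda>y. G (Complex x y)) =
       f (Complex x d) * Ty (Complex x d) - T (Complex x d) * fy (Complex x d)
        - (f (Complex x c) * Ty (Complex x c) - T (Complex x c) * fy (Complex x c))"
      unfolding G_def
      by (rule green_interval) (use x R ab in \<open>auto intro!: C2_partials_deriv_y[OF f] C2_partials_deriv_y[OF T]\<close>)
    then show "integral {c..d} (\<lambda>y. G (Complex x y)) = T (Complex x c) * fy (Complex x c)"
      using zd[OF x] zc[OF x] by simp
  qed
  finally show ?thesis by simp
qed

lemma C2_partials_add:
  assumes "C2_partials S f fx fy fxx fxy fyx fyy" "C2_partials S g gx gy gxx gxy gyx gyy"
  shows "C2_partials S (\<lambda>z. f z + g z) (\<lambda>z. fx z + gx z) (\<lambda>z. fy z + gy z) (\<lambda>z. fxx z + gxx z)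
    (\<lambda>z. fxy z + gxy z) (\<lambda>z. fyx z + gyx z) (\<lambda>z. fyy z + gyy z)"
proof -
  have *: "((\<lambda>z. p z + q z) has_derivative (\<lambda>h. (a + a') * Re h + (b + b') * Im h)) (at z within S)"
    if "(p has_derivative (\<lambda>h. a * Re h + b * Im h)) (at z within S)"
      "(q has_derivative (\<lambda>h. a' * Re h + b' * Im h)) (at z within S)" for p q :: "complex \<Rightarrow> real" and a a' b b' z
    by (rule has_derivative_eq_rhs[OF has_derivative_add[OF that]]) (auto simp: algebra_simps)
  show ?thesis
    using assms unfolding C2_partials_def by (auto intro!: * continuous_intros)
qed

lemma C2_partials_const: "C2_partials S (\<lambda>z. k) (\<lambda>z. 0) (\<lambda>z. 0) (\<lambda>z. 0) (\<lambda>z. 0) (\<lambda>z. 0) (\<lambda>z. 0)"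
  by (auto simp: C2_partials_def)

section \<open>Tents and reflected kernels\<close>

definition sqdist :: "real \<Rightarrow> real \<Rightarrow> complex \<Rightarrow> real" where
  "sqdist s t z = (Re z - s)\<^sup>2 + (Im z - t)\<^sup>2"

lemma C2_partials_sqdist:
  "C2_partials S (sqdist s t) (\<lambda>z. 2 * (Re z - s)) (\<lambda>z. 2 * (Im z - t)) (\<lambda>z. 2) (\<lambda>z. 0) (\<lambda>z. 0) (\<lambda>z. 2)"
  unfolding C2_partials_def sqdist_def
  by (auto intro!: derivative_eq_intros bounded_linear_imp_has_derivative bounded_linear_Re bounded_linear_Im
      has_derivative_Re has_derivative_Im simp: algebra_simps)

text \<open>\<open>\<sigma>\<close> stands for the inverse square of a radius and \<open>d\<close>
  for a squared distance: composed with \<open>sqdist s t\<close> this is a paraboloid cap over the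
  disc of radius \<open>1 / sqrt \<sigma>\<close>. Squared distances keep square roots out of all
  derivatives.\<close>

definition cutoff :: "real \<Rightarrow> real \<Rightarrow> real" where
  "cutoff \<sigma> d = max 0 (1 - \<sigma> * d)"

lemma DERIV_cutoff_power:
  "((\<lambda>d. cutoff \<sigma> d ^ (k + 2)) has_real_derivative - \<sigma> * real (k + 2) * cutoff \<sigma> d ^ (k + 1)) (at d within X)"
  "((\<lambda>\<sigma>. cutoff \<sigma> d ^ (k + 2)) has_real_derivative - d * real (k + 2) * cutoff \<sigma> d ^ (k + 1)) (at \<sigma> within Y)"
proof -
  have 1: "((\<lambda>d. 1 - \<sigma> * d) has_real_derivative - \<sigma>) (at d within X)"
    and 2: "((\<lambda>\<sigma>. 1 - \<sigma> * d) has_real_derivative - d) (at \<sigma> within Y)"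
    by (auto intro!: derivative_eq_intros)
  show "((\<lambda>d. cutoff \<sigma> d ^ (k + 2)) has_real_derivative - \<sigma> * real (k + 2) * cutoff \<sigma> d ^ (k + 1)) (at d within X)"
    unfolding cutoff_def using DERIV_chain[OF DERIV_max_0_power 1] by (simp add: o_def mult_ac)
  show "((\<lambda>\<sigma>. cutoff \<sigma> d ^ (k + 2)) has_real_derivative - d * real (k + 2) * cutoff \<sigma> d ^ (k + 1)) (at \<sigma> within Y)"
    unfolding cutoff_def using DERIV_chain[OF DERIV_max_0_power 2] by (simp add: o_def mult_ac)
qed

lemma cutoff_bounds: "0 \<le> cutoff \<sigma> d" "0 \<le> \<sigma> \<Longrightarrow> 0 \<le> d \<Longrightarrow> cutoff \<sigma> d \<le> 1"
  by (auto simp: cutoff_def)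

lemma cutoff_eq_0: "1 \<le> \<sigma> * d \<Longrightarrow> cutoff \<sigma> d = 0"
  by (auto simp: cutoff_def)

lemma continuous_on_cutoff [continuous_intros]:
  fixes f g :: "'a::topological_space \<Rightarrow> real"
  shows "continuous_on A f \<Longrightarrow> continuous_on A g \<Longrightarrow> continuous_on A (\<lambda>x. cutoff (f x) (g x))"
  unfolding cutoff_def by (intro continuous_intros)

lemma C2_partials_cutoff:
  "C2_partials S (\<lambda>z. cutoff \<sigma> (sqdist s t z) ^ 4)
     (\<lambda>z. - 4 * \<sigma> * cutoff \<sigma> (sqdist s t z) ^ 3 * (2 * (Re z - s)))
     (\<lambda>z. - 4 * \<sigma> * cutoff \<sigma> (sqdist s t z) ^ 3 * (2 * (Im z - t)))
     (\<lambda>z. 12 * \<sigma>\<^sup>2 * cutoff \<sigma> (sqdist s t z) ^ 2 * (2 * (Re z - s))\<^sup>2 + - 4 * \<sigma> * cutoff \<sigma> (sqdist s t z) ^ 3 * 2)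
     (\<lambda>z. 12 * \<sigma>\<^sup>2 * cutoff \<sigma> (sqdist s t z) ^ 2 * (2 * (Re z - s)) * (2 * (Im z - t)) + - 4 * \<sigma> * cutoff \<sigma> (sqdist s t z) ^ 3 * 0)
     (\<lambda>z. 12 * \<sigma>\<^sup>2 * cutoff \<sigma> (sqdist s t z) ^ 2 * (2 * (Re z - s)) * (2 * (Im z - t)) + - 4 * \<sigma> * cutoff \<sigma> (sqdist s t z) ^ 3 * 0)
     (\<lambda>z. 12 * \<sigma>\<^sup>2 * cutoff \<sigma> (sqdist s t z) ^ 2 * (2 * (Im z - t))\<^sup>2 + - 4 * \<sigma> * cutoff \<sigma> (sqdist s t z) ^ 3 * 2)"
proof (rule C2_partials_compose[OF C2_partials_sqdist])
  fix d :: real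
  show "((\<lambda>d. cutoff \<sigma> d ^ 4) has_real_derivative - 4 * \<sigma> * cutoff \<sigma> d ^ 3) (at d)"
    using DERIV_cutoff_power(1)[of \<sigma> 2 d] by (simp add: mult_ac)
  show "((\<lambda>d. - 4 * \<sigma> * cutoff \<sigma> d ^ 3) has_real_derivative 12 * \<sigma>\<^sup>2 * cutoff \<sigma> d ^ 2) (at d)"
    using DERIV_cmult[OF DERIV_cutoff_power(1)[of \<sigma> 1 d], of "-4 * \<sigma>"]
    by (simp add: mult_ac numeral_eq_Suc)
qed (intro continuous_intros)

text \<open>Over the whole plane the first term has a mass independent of \<open>\<sigma>\<close>,
  so for large \<open>\<sigma>\<close> it is an approximate identity up to a constant factor. The
  second term is its mirror image in the line \<open>Im z = c\<close>.\<close>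

definition reflected_kernel :: "real \<Rightarrow> real \<Rightarrow> real \<Rightarrow> real \<Rightarrow> complex \<Rightarrow> real" where
  "reflected_kernel s t c \<sigma> z = \<sigma> * cutoff \<sigma> (sqdist s t z) ^ 3 + \<sigma> * cutoff \<sigma> (sqdist s (2 * c - t) z) ^ 3"

text \<open>Taken over pairs of reals, where iterated integrals are at hand;
  \<open>has_integral_box_complex\<close> moves it to the complex plane.\<close>

definition box_integral :: "real \<Rightarrow> real \<Rightarrow> real \<Rightarrow> real \<Rightarrow> (complex \<Rightarrow> real) \<Rightarrow> real" where
  "box_integral a b c d F = integral (cbox (a, c) (b, d)) (\<lambda>(x, y). F (Complex x y))"

lemma integrable_box:
  fixes F :: "complex \<Rightarrow> real"
  assumes "continuous_on S F" "\<And>x y. x \<in> {a..b} \<Longrightarrow> y \<in> {c..d} \<Longrightarrow> Complex x y \<in> S"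
  shows "(\<lambda>(x, y). F (Complex x y)) integrable_on cbox (a, c) (b, d :: real)"
  by (rule integrable_continuous, rule continuous_on_slice(1)[OF assms])

lemma continuous_on_sqdist [continuous_intros]: "continuous_on S (sqdist s t)"
  unfolding sqdist_def by (intro continuous_intros)

lemma sqdist_nonneg [simp]: "0 \<le> sqdist s t z"
  by (simp add: sqdist_def)

lemma box_integral_le_support:
  assumes F: "continuous_on S F" and R: "\<And>x y. x \<in> {a..b} \<Longrightarrow> y \<in> {c..d} \<Longrightarrow> Complex x y \<in> S"
    and "0 \<le> M" "0 \<le> \<rho>"
    and le: "\<And>x y. x \<in> {a..b} \<Longrightarrow> y \<in> {c..d} \<Longrightarrow> \<bar>x - s\<bar> \<le> \<rho> \<Longrightarrow> \<bar>y - t\<bar> \<le> \<rho> \<Longrightarrow> F (Complex x y) \<le> M"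
    and out: "\<And>x y. x \<in> {a..b} \<Longrightarrow> y \<in> {c..d} \<Longrightarrow> \<not> (\<bar>x - s\<bar> \<le> \<rho> \<and> \<bar>y - t\<bar> \<le> \<rho>) \<Longrightarrow> F (Complex x y) \<le> 0"
  shows "box_integral a b c d F \<le> M * (4 * \<rho>\<^sup>2)"
proof -
  have "box_integral a b c d F \<le> M * measure lborel (cbox (s - \<rho>, t - \<rho>) (s + \<rho>, t + \<rho>))"
    unfolding box_integral_def
  proof (rule integral_le_support[OF integrable_box[OF F R] \<open>0 \<le> M\<close>])
    fix z :: "real \<times> real" assume z: "z \<in> cbox (a, c) (b, d)"
    have i: "z \<in> cbox (s - \<rho>, t - \<rho>) (s + \<rho>, t + \<rho>) \<longleftrightarrow> \<bar>fst z - s\<bar> \<le> \<rho> \<and> \<bar>snd z - t\<bar> \<le> \<rho>"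
      by (cases z) (auto simp: cbox_Pair_eq)
    from z have z': "fst z \<in> {a..b}" "snd z \<in> {c..d}"
      by (auto simp: cbox_Pair_eq)
    show "(case z of (x, y) \<Rightarrow> F (Complex x y)) \<le> M" if "z \<in> cbox (s - \<rho>, t - \<rho>) (s + \<rho>, t + \<rho>)"
      using le[OF z'] that unfolding i by (simp add: case_prod_beta)
    show "(case z of (x, y) \<Rightarrow> F (Complex x y)) \<le> 0" if "z \<notin> cbox (s - \<rho>, t - \<rho>) (s + \<rho>, t + \<rho>)"
      using out[OF z'] that unfolding i by (simp add: case_prod_beta)
  qed auto
  also have "measure lborel (cbox (s - \<rho>, t - \<rho>) (s + \<rho>, t + \<rho>)) = 4 * \<rho>\<^sup>2"
    using \<open>0 \<le> \<rho>\<close> by (subst content_Pair) (simp add: power2_eq_square)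
  finally show ?thesis .
qed

lemma sqdist_support:
  assumes "0 < \<sigma>" and "\<not> (\<bar>x - s\<bar> \<le> 1 / sqrt \<sigma> \<and> \<bar>y - t\<bar> \<le> 1 / sqrt \<sigma>)"
  shows "1 \<le> \<sigma> * sqdist s t (Complex x y)"
proof -
  have sq: "1 / \<sigma> \<le> u\<^sup>2" if "\<not> \<bar>u\<bar> \<le> 1 / sqrt \<sigma>" for u
  proof -
    have "(1 / sqrt \<sigma>)\<^sup>2 \<le> \<bar>u\<bar>\<^sup>2"
      using that assms(1) by (intro power_mono) auto
    then show ?thesis using assms(1) by (simp add: power_divide)
  qed
  have "1 / \<sigma> \<le> (x - s)\<^sup>2 + (y - t)\<^sup>2"
    using sq[of "x - s"] sq[of "y - t"] assms(2) zero_le_power2[of "x - s"] zero_le_power2[of "y - t"]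
    by linarith
  then show ?thesis using assms(1) by (simp add: sqdist_def field_simps)
qed

text \<open>Ensures that above the line the reflected term vanishes wherever the original one does,
  so one support estimate covers both.\<close>

lemma sqdist_image_ge:
  assumes "c \<le> t" "c \<le> Im z"
  shows "sqdist s t z \<le> sqdist s (2 * c - t) z"
proof -
  have "(Im z - (2 * c - t))\<^sup>2 - (Im z - t)\<^sup>2 = 4 * ((Im z - c) * (t - c))"
    by (simp add: power2_eq_square algebra_simps)
  moreover have "0 \<le> (Im z - c) * (t - c)"
    using assms by simp
  ultimately show ?thesis
    unfolding sqdist_def by linarith
qed

text \<open>
  Up to the factor \<open>- 1 / (16 * \<sigma>)\<close>, the \<open>\<sigma>\<close>-derivative of the kernel is the Laplacian of
  the tent \<open>cutoff ^ 4\<close>; the image point makes the normal derivative of the tent vanish on the edge.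
\<close>

lemma kernel_mean_mono:
  assumes f: "C2_partials S f fx fy fxx fxy fyx fyy"
    and R: "\<And>x y. x \<in> {s - r..s + r} \<Longrightarrow> y \<in> {c..t + r} \<Longrightarrow> Complex x y \<in> S"
    and r: "0 < r" and c: "c \<le> t" and C: "0 \<le> C1" "0 \<le> C2"
    and lap: "\<And>x y. x \<in> {s - r..s + r} \<Longrightarrow> y \<in> {c..t + r} \<Longrightarrow> - C1 \<le> fxx (Complex x y) + fyy (Complex x y)"
    and edge: "\<And>x. x \<in> {s - r..s + r} \<Longrightarrow> t - r < c \<Longrightarrow> - C2 \<le> fy (Complex x c)"
    and \<sigma>: "1 / r\<^sup>2 \<le> \<sigma>1" "\<sigma>1 \<le> \<sigma>2"
  defines "A \<equiv> \<lambda>\<sigma>. box_integral (s - r) (s + r) c (t + r) (\<lambda>z. f z * reflected_kernel s t c \<sigma> z)"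
  shows "A \<sigma>2 + C1 / (2 * \<sigma>2) + C2 / (2 * sqrt \<sigma>2) \<le> A \<sigma>1 + C1 / (2 * \<sigma>1) + C2 / (2 * sqrt \<sigma>1)"
proof -
  let ?a = "s - r" and ?b = "s + r" and ?d = "t + r"
  note cf = C2_partials_continuous[OF f]
  define D D' where "D = sqdist s t" and "D' = sqdist s (2 * c - t)"
  have cD: "continuous_on X D" "continuous_on X D'" for X
    unfolding D_def D'_def by (intro continuous_intros)+
  have D0: "0 \<le> D z" "0 \<le> D' z" for z by (auto simp: D_def D'_def)
  define g where "g = (\<lambda>\<sigma> d. cutoff \<sigma> d ^ 3 - 3 * \<sigma> * d * cutoff \<sigma> d ^ 2)"
  have dker: "((\<lambda>\<sigma>. f z * reflected_kernel s t c \<sigma> z) has_real_derivative f z * (g \<sigma> (D z) + g \<sigma> (D' z))) (at \<sigma> within Y)"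
    for z \<sigma> Y
  proof -
    have "((\<lambda>\<sigma>. \<sigma> * cutoff \<sigma> d ^ 3) has_real_derivative g \<sigma> d) (at \<sigma> within Y)" for d
    proof -
      have "((\<lambda>\<sigma>. cutoff \<sigma> d ^ 3) has_real_derivative - d * 3 * cutoff \<sigma> d ^ 2) (at \<sigma> within Y)"
        using DERIV_cutoff_power(2)[where k = 1] by (simp add: numeral_eq_Suc)
      from DERIV_mult[OF DERIV_ident this] show ?thesis
        by (simp add: g_def algebra_simps)
    qed
    from DERIV_cmult[OF DERIV_add[OF this this]] show ?thesis
      unfolding reflected_kernel_def D_def D'_def .
  qed
  have pos: "0 < \<sigma>" if "\<sigma> \<in> {1 / r\<^sup>2..}" for \<sigma>
    using that r by (auto intro: less_le_trans[of 0 "1 / r\<^sup>2"])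
  define A' where "A' = (\<lambda>\<sigma>. box_integral ?a ?b c ?d (\<lambda>z. f z * (g \<sigma> (D z) + g \<sigma> (D' z))))"
  have dA: "(A has_real_derivative A' \<sigma>) (at \<sigma>)" for \<sigma>
  proof -
    have c1: "continuous_on S (\<lambda>z. f z * reflected_kernel s t c \<sigma> z)" for \<sigma>
      unfolding reflected_kernel_def by (intro continuous_intros cf)
    have c2: "continuous_on (UNIV \<times> cbox (?a, c) (?b, ?d))
      (\<lambda>(\<sigma>, z). f (Complex (fst z) (snd z)) * (g \<sigma> (D (Complex (fst z) (snd z))) + g \<sigma> (D' (Complex (fst z) (snd z)))))"
      unfolding g_def case_prod_beta D_def D'_def sqdist_def
      by (intro continuous_intros continuous_on_compose2[OF cf(1)])
         (auto simp: Complex_eq cbox_Pair_eq intro!: continuous_intros R[unfolded Complex_eq])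
    show ?thesis
      unfolding A_def A'_def box_integral_def case_prod_beta
      by (rule leibniz_rule_field_derivative[OF _ _ c2])
         (use integrable_box[OF c1 R, unfolded case_prod_beta] dker in auto)
  qed
  \<comment> \<open>The tent is at most 2 and lives in a square of area \<open>4 / \<sigma>\<close>
    whose trace on the bottom edge has length at most \<open>2 / sqrt \<sigma>\<close>. Multiplying
    by \<open>C1\<close> and \<open>C2\<close> and dividing by \<open>16 * \<sigma>\<close> gives
    the two terms.\<close>
  have dA_le: "A' \<sigma> \<le> C1 / (2 * \<sigma>\<^sup>2) + C2 / (4 * \<sigma> * sqrt \<sigma>)" if \<sigma>: "\<sigma> \<in> {1 / r\<^sup>2..}" for \<sigma>
  proof -
    have s0: "0 < \<sigma>" using pos[OF \<sigma>] .
    have s1: "1 \<le> \<sigma> * u" if "r\<^sup>2 \<le> u" for u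
    proof -
      have "1 \<le> \<sigma> * r\<^sup>2" using \<sigma> r by (simp add: divide_le_eq)
      also have "\<dots> \<le> \<sigma> * u" using that s0 by simp
      finally show ?thesis .
    qed
    define T where "T = (\<lambda>z. cutoff \<sigma> (D z) ^ 4 + cutoff \<sigma> (D' z) ^ 4)"
    define Lap where "Lap = (\<lambda>z. fxx z + fyy z)"
    have cT: "continuous_on X T" for X
      unfolding T_def by (intro continuous_intros cD)
    have T02: "0 \<le> T z \<and> T z \<le> 2" for z
    proof -
      have "0 \<le> cutoff \<sigma> d ^ 4 \<and> cutoff \<sigma> d ^ 4 \<le> 1" if "0 \<le> d" for d
        using cutoff_bounds[of \<sigma> d] s0 that by (auto intro!: power_le_one)
      from this[OF D0(1), of z] this[OF D0(2), of z] show ?thesis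
        unfolding T_def by auto
    qed
    note TT = C2_partials_add[OF C2_partials_cutoff[of S \<sigma> s t] C2_partials_cutoff[of S \<sigma> s "2 * c - t"], folded D_def D'_def]
    \<comment> \<open>The dimension enters here: each of the two second derivatives contributes
      \<open>- 8 * \<sigma> * cutoff ^ 3\<close>, and exactly this total matches the prefactor
      \<open>\<sigma>\<close> of the kernel.\<close>
    have lapT: "12 * \<sigma>\<^sup>2 * (cutoff \<sigma> (sqdist s p z))\<^sup>2 * (2 * (Re z - s))\<^sup>2 + - 4 * \<sigma> * cutoff \<sigma> (sqdist s p z) ^ 3 * 2
       + (12 * \<sigma>\<^sup>2 * (cutoff \<sigma> (sqdist s p z))\<^sup>2 * (2 * (Im z - p))\<^sup>2 + - 4 * \<sigma> * cutoff \<sigma> (sqdist s p z) ^ 3 * 2)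
       = - 16 * \<sigma> * g \<sigma> (sqdist s p z)" for p z
      unfolding g_def sqdist_def by (simp add: algebra_simps power2_eq_square power3_eq_cube)
    have bx: "r\<^sup>2 \<le> (x - s)\<^sup>2" if "x = ?a \<or> x = ?b" for x
      using that by auto
    have bD: "r\<^sup>2 \<le> D (Complex x y) \<and> r\<^sup>2 \<le> D' (Complex x y)" if "x = ?a \<or> x = ?b" for x y
      using bx[OF that] unfolding D_def D'_def sqdist_def by (auto intro: add_increasing2)
    have bE: "r\<^sup>2 \<le> D (Complex x ?d) \<and> r\<^sup>2 \<le> D' (Complex x ?d)" for x
    proof -
      have "r\<^sup>2 \<le> (?d - (2 * c - t))\<^sup>2"
        using c r by (intro power_mono) auto
      then show ?thesis unfolding D_def D'_def sqdist_def by (auto intro: add_increasing)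
    qed
    let ?Txx = "\<lambda>z. 12 * \<sigma>\<^sup>2 * (cutoff \<sigma> (D z))\<^sup>2 * (2 * (Re z - s))\<^sup>2 + - 4 * \<sigma> * cutoff \<sigma> (D z) ^ 3 * 2 +
         (12 * \<sigma>\<^sup>2 * (cutoff \<sigma> (D' z))\<^sup>2 * (2 * (Re z - s))\<^sup>2 + - 4 * \<sigma> * cutoff \<sigma> (D' z) ^ 3 * 2)"
    let ?Tyy = "\<lambda>z. 12 * \<sigma>\<^sup>2 * (cutoff \<sigma> (D z))\<^sup>2 * (2 * (Im z - t))\<^sup>2 + - 4 * \<sigma> * cutoff \<sigma> (D z) ^ 3 * 2 +
         (12 * \<sigma>\<^sup>2 * (cutoff \<sigma> (D' z))\<^sup>2 * (2 * (Im z - (2 * c - t)))\<^sup>2 + - 4 * \<sigma> * cutoff \<sigma> (D' z) ^ 3 * 2)"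
    have "integral (cbox (?a, c) (?b, ?d)) (\<lambda>(x, y). (\<lambda>z. f z * (?Txx z + ?Tyy z)
         - (cutoff \<sigma> (D z) ^ 4 + cutoff \<sigma> (D' z) ^ 4) * (fxx z + fyy z)) (Complex x y))
      = integral {?a..?b} (\<lambda>x. (cutoff \<sigma> (D (Complex x c)) ^ 4 + cutoff \<sigma> (D' (Complex x c)) ^ 4) * fy (Complex x c))"
    proof (rule green_rectangle[OF f TT R])
      fix x y
      show "cutoff \<sigma> (D (Complex x y)) ^ 4 + cutoff \<sigma> (D' (Complex x y)) ^ 4 = 0 \<and>
         - 4 * \<sigma> * cutoff \<sigma> (D (Complex x y)) ^ 3 * (2 * (Re (Complex x y) - s)) +
         - 4 * \<sigma> * cutoff \<sigma> (D' (Complex x y)) ^ 3 * (2 * (Re (Complex x y) - s)) = 0" if "x = ?a \<or> x = ?b"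
        using bD[OF that, of y] s1 by (simp add: cutoff_eq_0)
      show "cutoff \<sigma> (D (Complex x ?d)) ^ 4 + cutoff \<sigma> (D' (Complex x ?d)) ^ 4 = 0 \<and>
         - 4 * \<sigma> * cutoff \<sigma> (D (Complex x ?d)) ^ 3 * (2 * (Im (Complex x ?d) - t)) +
         - 4 * \<sigma> * cutoff \<sigma> (D' (Complex x ?d)) ^ 3 * (2 * (Im (Complex x ?d) - (2 * c - t))) = 0"
        using bE[of x] s1 by (simp add: cutoff_eq_0)
      have "D' (Complex x c) = D (Complex x c)"
        unfolding D_def D'_def sqdist_def by (simp add: power2_commute)
      then show "- 4 * \<sigma> * cutoff \<sigma> (D (Complex x c)) ^ 3 * (2 * (Im (Complex x c) - t)) +
         - 4 * \<sigma> * cutoff \<sigma> (D' (Complex x c)) ^ 3 * (2 * (Im (Complex x c) - (2 * c - t))) = 0"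
        by (simp add: algebra_simps)
    qed (use r c in auto)
    also have "(\<lambda>z. f z * (?Txx z + ?Tyy z)
         - (cutoff \<sigma> (D z) ^ 4 + cutoff \<sigma> (D' z) ^ 4) * (fxx z + fyy z))
       = (\<lambda>z. - 16 * \<sigma> * (f z * (g \<sigma> (D z) + g \<sigma> (D' z))) - T z * Lap z)"
    proof
      fix z
      show "f z * (?Txx z + ?Tyy z)
         - (cutoff \<sigma> (D z) ^ 4 + cutoff \<sigma> (D' z) ^ 4) * (fxx z + fyy z)
       = - 16 * \<sigma> * (f z * (g \<sigma> (D z) + g \<sigma> (D' z))) - T z * Lap z"
        using arg_cong2[OF lapT[of t z] lapT[of "2 * c - t" z], of "\<lambda>u v. f z * (u + v)"]
        unfolding T_def Lap_def D_def[symmetric] D'_def[symmetric] by (simp add: algebra_simps)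
    qed
    also have "(\<lambda>x. (cutoff \<sigma> (D (Complex x c)) ^ 4 + cutoff \<sigma> (D' (Complex x c)) ^ 4) * fy (Complex x c))
       = (\<lambda>x. T (Complex x c) * fy (Complex x c))"
      unfolding T_def ..
    finally have "box_integral ?a ?b c ?d (\<lambda>z. - 16 * \<sigma> * (f z * (g \<sigma> (D z) + g \<sigma> (D' z))) - T z * Lap z)
       = integral {?a..?b} (\<lambda>x. T (Complex x c) * fy (Complex x c))"
      by (simp add: box_integral_def)
    moreover have "box_integral ?a ?b c ?d (\<lambda>z. - 16 * \<sigma> * (f z * (g \<sigma> (D z) + g \<sigma> (D' z))) - T z * Lap z)
       = - 16 * \<sigma> * A' \<sigma> + box_integral ?a ?b c ?d (\<lambda>z. - (T z * Lap z))"
    proof -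
      have i1: "(\<lambda>(x, y). (\<lambda>z. f z * (g \<sigma> (D z) + g \<sigma> (D' z))) (Complex x y)) integrable_on cbox (?a, c) (?b, ?d)"
        by (rule integrable_box[OF _ R]) (auto simp: g_def intro!: continuous_intros cf cD)
      have i2: "(\<lambda>(x, y). (\<lambda>z. - (T z * Lap z)) (Complex x y)) integrable_on cbox (?a, c) (?b, ?d)"
        by (rule integrable_box[OF _ R]) (auto simp: Lap_def intro!: continuous_intros cf cT)
      from integral_unique[OF has_integral_add[OF has_integral_mult_right[OF integrable_integral[OF i1], of "- 16 * \<sigma>"]
            integrable_integral[OF i2]]]
      show ?thesis
        unfolding A'_def box_integral_def case_prod_beta by simp
    qed
    moreover have "box_integral ?a ?b c ?d (\<lambda>z. - (T z * Lap z)) \<le> (2 * C1) * (4 * (1 / sqrt \<sigma>)\<^sup>2)"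
    proof (rule box_integral_le_support[OF _ R])
      show "continuous_on S (\<lambda>z. - (T z * Lap z))"
        unfolding Lap_def by (intro continuous_intros cT cf)
      fix x y assume xy: "x \<in> {?a..?b}" "y \<in> {c..?d}"
      have T2: "0 \<le> T (Complex x y)" "T (Complex x y) \<le> 2"
        using T02 by auto
      have "T (Complex x y) * - Lap (Complex x y) \<le> T (Complex x y) * C1"
        using lap[OF xy] T2(1) by (intro mult_left_mono) (auto simp: Lap_def)
      also have "\<dots> \<le> 2 * C1" using T2 C by (intro mult_right_mono) auto
      finally show "- (T (Complex x y) * Lap (Complex x y)) \<le> 2 * C1" by simp
      show "- (T (Complex x y) * Lap (Complex x y)) \<le> 0"
        if "\<not> (\<bar>x - s\<bar> \<le> 1 / sqrt \<sigma> \<and> \<bar>y - t\<bar> \<le> 1 / sqrt \<sigma>)"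
      proof -
        have *: "1 \<le> \<sigma> * D (Complex x y)" unfolding D_def by (rule sqdist_support[OF s0 that])
        also have "\<dots> \<le> \<sigma> * D' (Complex x y)"
          unfolding D_def D'_def using s0 c xy by (intro mult_left_mono sqdist_image_ge) auto
        finally show ?thesis using * by (simp add: T_def cutoff_eq_0)
      qed
    qed (use C s0 in auto)
    moreover have "integral {?a..?b} (\<lambda>x. - (T (Complex x c) * fy (Complex x c)))
       \<le> (2 * C2) * measure lborel (cbox (s - 1 / sqrt \<sigma>) (s + 1 / sqrt \<sigma>))"
      unfolding cbox_interval[symmetric]
    proof (rule integral_le_support)
      have "continuous_on {?a..?b} (\<lambda>x. F (Complex x c))" if "continuous_on S F" for F :: "complex \<Rightarrow> real"
        by (rule continuous_on_compose2[OF that])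
           (use R c r in \<open>auto simp: Complex_eq intro!: continuous_intros R[unfolded Complex_eq]\<close>)
      then show "(\<lambda>x. - (T (Complex x c) * fy (Complex x c))) integrable_on cbox ?a ?b"
        by (auto intro!: integrable_continuous_interval continuous_intros cT cf)
      fix x assume x: "x \<in> cbox ?a ?b"
      have T2: "0 \<le> T (Complex x c)" "T (Complex x c) \<le> 2"
        using T02 by auto
      have T0: "T (Complex x c) = 0" if "1 \<le> \<sigma> * D (Complex x c)"
      proof -
        have "D' (Complex x c) = D (Complex x c)"
          unfolding D_def D'_def sqdist_def by (simp add: power2_commute)
        with that show ?thesis by (simp add: T_def cutoff_eq_0)
      qed
      show "- (T (Complex x c) * fy (Complex x c)) \<le> 2 * C2"
      \<comment> \<open>If \<open>c \<le> t - r\<close>, the tent, supported in a disc of radius at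
        most \<open>r\<close>, vanishes on the bottom edge, and the edge bound is not called
        upon.\<close>
      proof (cases "t - r < c")
        case True
        have "T (Complex x c) * - fy (Complex x c) \<le> T (Complex x c) * C2"
          using edge[OF _ True, of x] x T2(1) by (intro mult_left_mono) auto
        also have "\<dots> \<le> 2 * C2" using T2 C by (intro mult_right_mono) auto
        finally show ?thesis by simp
      next
        case False
        have "r\<^sup>2 \<le> (t - c)\<^sup>2" using False r by (intro power_mono) auto
        also have "\<dots> \<le> D (Complex x c)" unfolding D_def sqdist_def by (simp add: power2_commute)
        finally show ?thesis using T0[OF s1] C by simp
      qed
      show "- (T (Complex x c) * fy (Complex x c)) \<le> 0" if "x \<notin> cbox (s - 1 / sqrt \<sigma>) (s + 1 / sqrt \<sigma>)"
      proof -
        have "\<not> \<bar>x - s\<bar> \<le> 1 / sqrt \<sigma>" using that by auto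
        then have "1 \<le> \<sigma> * D (Complex x c)"
          unfolding D_def by (intro sqdist_support[OF s0]) blast
        then show ?thesis by (simp add: T0)
      qed
    qed (use C in auto)
    ultimately have "16 * \<sigma> * A' \<sigma> \<le> 8 * C1 / \<sigma> + 4 * C2 / sqrt \<sigma>"
      using s0 by (simp add: power_divide)
    then show ?thesis
      using s0 by (simp add: field_simps power2_eq_square)
  qed
  \<comment> \<open>The added terms have the negative of the bound in \<open>dA_le\<close> as
    derivative, which makes the sum monotone.\<close>
  define \<Psi> where "\<Psi> = (\<lambda>\<sigma>. A \<sigma> + C1 / (2 * \<sigma>) + C2 / (2 * sqrt \<sigma>))"
  have "\<Psi> \<sigma>2 \<le> \<Psi> \<sigma>1"
  proof (rule DERIV_nonpos_imp_nonincreasing[OF \<sigma>(2)])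
    fix \<sigma> assume "\<sigma>1 \<le> \<sigma>" "\<sigma> \<le> \<sigma>2"
    then have \<sigma>': "\<sigma> \<in> {1 / r\<^sup>2..}" using \<sigma> by auto
    have "(\<Psi> has_real_derivative A' \<sigma> - C1 / (2 * \<sigma>\<^sup>2) - C2 / (4 * \<sigma> * sqrt \<sigma>)) (at \<sigma>)"
      unfolding \<Psi>_def using pos[OF \<sigma>']
      by (auto intro!: derivative_eq_intros dA simp: field_simps power2_eq_square)
    then show "\<exists>y. (\<Psi> has_real_derivative y) (at \<sigma>) \<and> y \<le> 0"
      using dA_le[OF \<sigma>'] by (intro exI conjI) auto
  qed
  then show ?thesis by (simp add: \<Psi>_def)
qed

lemma box_integral_mono:
  assumes "continuous_on S F" "continuous_on S G"
    and R: "\<And>x y. x \<in> {a..b} \<Longrightarrow> y \<in> {c..d} \<Longrightarrow> Complex x y \<in> S"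
    and "\<And>x y. x \<in> {a..b} \<Longrightarrow> y \<in> {c..d} \<Longrightarrow> F (Complex x y) \<le> G (Complex x y)"
  shows "box_integral a b c d F \<le> box_integral a b c d G"
  unfolding box_integral_def
  by (rule integral_le) (use integrable_box[OF assms(1) R] integrable_box[OF assms(2) R] assms(4)
      in \<open>auto simp: cbox_Pair_eq\<close>)

lemma box_integral_cmult: "box_integral a b c d (\<lambda>z. k * F z) = k * box_integral a b c d F"
  unfolding box_integral_def case_prod_beta by simp

lemma box_integral_diff:
  assumes F: "continuous_on S F" and G: "continuous_on S G"
    and R: "\<And>x y. x \<in> {a..b} \<Longrightarrow> y \<in> {c..d} \<Longrightarrow> Complex x y \<in> S"
  shows "box_integral a b c d (\<lambda>z. F z - G z) = box_integral a b c d F - box_integral a b c d G"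
proof -
  have i: "(\<lambda>(x, y). F (Complex x y)) integrable_on cbox (a, c) (b, d)"
    "(\<lambda>(x, y). G (Complex x y)) integrable_on cbox (a, c) (b, d)"
    using R by (auto intro: integrable_box[OF F] integrable_box[OF G])
  show ?thesis
    using integral_unique[OF has_integral_diff[OF integrable_integral[OF i(1)] integrable_integral[OF i(2)]]]
    unfolding box_integral_def case_prod_beta by simp
qed

lemma reflected_kernel_bounds:
  assumes "0 \<le> \<sigma>"
  shows "0 \<le> reflected_kernel s t c \<sigma> z" "reflected_kernel s t c \<sigma> z \<le> 2 * \<sigma>"
proof -
  have *: "0 \<le> \<sigma> * cutoff \<sigma> (sqdist s p z) ^ 3 \<and> \<sigma> * cutoff \<sigma> (sqdist s p z) ^ 3 \<le> \<sigma>" for p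
    using cutoff_bounds[of \<sigma> "sqdist s p z"] assms
    by (auto intro!: mult_left_le power_le_one)
  show "0 \<le> reflected_kernel s t c \<sigma> z" "reflected_kernel s t c \<sigma> z \<le> 2 * \<sigma>"
    using *[of t] *[of "2 * c - t"] by (auto simp: reflected_kernel_def)
qed

lemma reflected_kernel_support:
  assumes "0 < \<sigma>" "c \<le> t" "c \<le> y" and "\<not> (\<bar>x - s\<bar> \<le> 1 / sqrt \<sigma> \<and> \<bar>y - t\<bar> \<le> 1 / sqrt \<sigma>)"
  shows "reflected_kernel s t c \<sigma> (Complex x y) = 0"
proof -
  have *: "1 \<le> \<sigma> * sqdist s t (Complex x y)" by (rule sqdist_support[OF assms(1,4)])
  also have "\<dots> \<le> \<sigma> * sqdist s (2 * c - t) (Complex x y)"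
    using assms by (intro mult_left_mono sqdist_image_ge) auto
  finally show ?thesis using * by (simp add: reflected_kernel_def cutoff_eq_0)
qed

lemma continuous_on_reflected_kernel [continuous_intros]: "continuous_on S (reflected_kernel s t c \<sigma>)"
  unfolding reflected_kernel_def by (intro continuous_intros)

text \<open>A crude lower bound replaces the exact mass. On the largest disc the kernel is at least
  \<open>1 / (8 * r\<^sup>2)\<close> on a rectangle of area \<open>r\<^sup>2 / 2\<close> above the
  centre; shrinking the disc does not lose mass, by \<open>kernel_mean_mono\<close> for the constant
  function \<open>- 1\<close>.\<close>

lemma reflected_kernel_mass:
  assumes r: "0 < r" and c: "c \<le> t" and \<sigma>: "1 / r\<^sup>2 \<le> \<sigma>"
  shows "1 / 16 \<le> box_integral (s - r) (s + r) c (t + r) (reflected_kernel s t c \<sigma>)"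
proof -
  let ?N = "\<lambda>\<sigma>. box_integral (s - r) (s + r) c (t + r) (reflected_kernel s t c \<sigma>)"
  let ?Q = "cbox (s - r / 2, t) (s + r / 2, t + r / 2)"
  have i: "(\<lambda>(x, y). reflected_kernel s t c (1 / r\<^sup>2) (Complex x y)) integrable_on cbox (p, q) (p', q')" for p p' q q' :: real
    by (rule integrable_box[of UNIV]) (auto intro!: continuous_intros)
  have "1 / (8 * r\<^sup>2) * measure lborel ?Q = integral ?Q (\<lambda>z. 1 / (8 * r\<^sup>2))"
    by (simp del: content_Pair)
  also have "\<dots> \<le> integral ?Q (\<lambda>(x, y). reflected_kernel s t c (1 / r\<^sup>2) (Complex x y))"
  proof (rule integral_le[OF _ i])
    fix z assume z: "z \<in> ?Q"
    obtain x y where xy: "z = (x, y)" by (metis surj_pair)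
    have "(x, y) \<in> cbox (s - r / 2) (s + r / 2) \<times> cbox t (t + r / 2)"
      using z unfolding xy by (simp only: cbox_Pair_eq)
    then have "s - r / 2 \<le> x \<and> x \<le> s + r / 2 \<and> t \<le> y \<and> y \<le> t + r / 2"
      by (simp only: mem_Sigma_iff cbox_interval atLeastAtMost_iff)
    then have "\<bar>x - s\<bar> \<le> \<bar>r / 2\<bar>" "\<bar>y - t\<bar> \<le> \<bar>r / 2\<bar>"
      using r by linarith+
    then have "(x - s)\<^sup>2 \<le> (r / 2)\<^sup>2" "(y - t)\<^sup>2 \<le> (r / 2)\<^sup>2"
      unfolding abs_le_square_iff .
    then have "sqdist s t (Complex x y) \<le> r\<^sup>2 / 2"
      by (simp add: sqdist_def power_divide)
    then have "1 / r\<^sup>2 * sqdist s t (Complex x y) \<le> 1 / r\<^sup>2 * (r\<^sup>2 / 2)"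
      by (rule mult_left_mono) (rule zero_le_divide_1_iff[THEN iffD2], rule zero_le_power2)
    also have "\<dots> = 1 / 2" using r by simp
    finally have "1 / 2 \<le> 1 - 1 / r\<^sup>2 * sqdist s t (Complex x y)" by linarith
    then have "1 / 2 \<le> cutoff (1 / r\<^sup>2) (sqdist s t (Complex x y))"
      unfolding cutoff_def by linarith
    then have "(1 / 2) ^ 3 \<le> cutoff (1 / r\<^sup>2) (sqdist s t (Complex x y)) ^ 3"
      by (rule power_mono) simp
    then have "1 / r\<^sup>2 * (1 / 8) \<le> 1 / r\<^sup>2 * cutoff (1 / r\<^sup>2) (sqdist s t (Complex x y)) ^ 3"
      by (intro mult_left_mono) (auto simp: power_divide)
    moreover have "0 \<le> 1 / r\<^sup>2 * cutoff (1 / r\<^sup>2) (sqdist s (2 * c - t) (Complex x y)) ^ 3"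
      by (simp add: cutoff_bounds)
    ultimately show "1 / (8 * r\<^sup>2) \<le> (case z of (x, y) \<Rightarrow> reflected_kernel s t c (1 / r\<^sup>2) (Complex x y))"
      by (simp add: xy reflected_kernel_def)
  qed auto
  also have "\<dots> \<le> ?N (1 / r\<^sup>2)"
    unfolding box_integral_def
  proof (rule integral_subset_le[OF _ i i])
    show "?Q \<subseteq> cbox (s - r, c) (s + r, t + r)" using r c by (auto simp: cbox_Pair_eq)
  qed (use reflected_kernel_bounds(1) in auto)
  also have "measure lborel ?Q = r\<^sup>2 / 2"
    using r by (subst content_Pair) (simp add: power2_eq_square)
  finally have "1 / 16 \<le> ?N (1 / r\<^sup>2)" using r by simp
  moreover have "- ?N \<sigma> \<le> - ?N (1 / r\<^sup>2)"
  proof -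
    have "box_integral (s - r) (s + r) c (t + r) (\<lambda>z. - 1 * reflected_kernel s t c \<sigma> z) + 0 / (2 * \<sigma>) + 0 / (2 * sqrt \<sigma>)
      \<le> box_integral (s - r) (s + r) c (t + r) (\<lambda>z. - 1 * reflected_kernel s t c (1 / r\<^sup>2) z)
        + 0 / (2 * (1 / r\<^sup>2)) + 0 / (2 * sqrt (1 / r\<^sup>2))"
      by (rule kernel_mean_mono[OF C2_partials_const[of UNIV "- 1"] _ r c _ _ _ _ _ \<sigma>]) auto
    then show ?thesis unfolding box_integral_cmult by linarith
  qed
  ultimately show ?thesis by linarith
qed

text \<open>Kernel means plus error terms decrease in \<open>\<sigma>\<close>. For large
  \<open>\<sigma>\<close> continuity makes them at least about \<open>f / 16\<close> at the centre,
  by the mass bound; at \<open>\<sigma> = 1 / r\<^sup>2\<close> the kernel is at most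
  \<open>2 / r\<^sup>2\<close>. This is the origin of the constants 16 and 2.\<close>

theorem mean_value_inequality:
  assumes f: "C2_partials S f fx fy fxx fxy fyx fyy"
    and R: "\<And>x y. x \<in> {s - r..s + r} \<Longrightarrow> y \<in> {c..t + r} \<Longrightarrow> Complex x y \<in> S"
    and r: "0 < r" and c: "c \<le> t" and C: "0 \<le> C1" "0 \<le> C2"
    and nonneg: "\<And>x y. x \<in> {s - r..s + r} \<Longrightarrow> y \<in> {c..t + r} \<Longrightarrow> 0 \<le> f (Complex x y)"
    and lap: "\<And>x y. x \<in> {s - r..s + r} \<Longrightarrow> y \<in> {c..t + r} \<Longrightarrow> - C1 \<le> fxx (Complex x y) + fyy (Complex x y)"
    and edge: "\<And>x. x \<in> {s - r..s + r} \<Longrightarrow> t - r < c \<Longrightarrow> - C2 \<le> fy (Complex x c)"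
  shows "f (Complex s t) \<le> 16 * (2 / r\<^sup>2 * box_integral (s - r) (s + r) c (t + r) f + C1 * r\<^sup>2 / 2 + C2 * r / 2)"
proof -
  let ?I = "box_integral (s - r) (s + r) c (t + r)"
  let ?k = "reflected_kernel s t c"
  note cf = C2_partials_continuous(1)[OF f]
  define p where "p = Complex s t"
  have p: "p \<in> S" unfolding p_def using r c by (intro R) auto
  have p0: "0 \<le> f p" unfolding p_def using r c by (intro nonneg) auto
  define B where "B = 2 / r\<^sup>2 * ?I f + C1 * r\<^sup>2 / 2 + C2 * r / 2"
  have lim: "f p / 16 \<le> B + 8 * \<epsilon>" if \<epsilon>: "0 < \<epsilon>" for \<epsilon>
  proof -
    obtain \<delta> where \<delta>: "0 < \<delta>" "\<And>z. z \<in> S \<Longrightarrow> dist z p < \<delta> \<Longrightarrow> dist (f z) (f p) < \<epsilon>"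
      using cf p \<epsilon> unfolding continuous_on_iff by metis
    \<comment> \<open>Large enough that the supporting square, of half side
      \<open>1 / sqrt \<sigma> \<le> \<delta> / 4\<close>, lies in the
      \<open>\<delta>\<close>-neighbourhood of \<open>p\<close>.\<close>
    define \<sigma> where "\<sigma> = max (1 / r\<^sup>2) (16 / \<delta>\<^sup>2)"
    have \<sigma>: "0 < \<sigma>" "1 / r\<^sup>2 \<le> \<sigma>" using r by (auto simp: \<sigma>_def less_max_iff_disj)
    have "sqrt (16 / \<delta>\<^sup>2) \<le> sqrt \<sigma>" by (intro real_sqrt_le_mono) (simp add: \<sigma>_def)
    then have "4 / \<delta> \<le> sqrt \<sigma>" using \<delta> by (simp add: real_sqrt_divide)
    then have \<rho>: "1 / sqrt \<sigma> \<le> \<delta> / 4"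
      using \<delta> \<sigma> by (simp add: field_simps)
    have "?I (\<lambda>z. (f p - f z) * ?k \<sigma> z) \<le> (\<epsilon> * (2 * \<sigma>)) * (4 * (1 / sqrt \<sigma>)\<^sup>2)"
    proof (rule box_integral_le_support[OF _ R])
      show "continuous_on S (\<lambda>z. (f p - f z) * ?k \<sigma> z)"
        by (intro continuous_intros cf)
      fix x y assume xy: "x \<in> {s - r..s + r}" "y \<in> {c..t + r}"
      show "(f p - f (Complex x y)) * ?k \<sigma> (Complex x y) \<le> \<epsilon> * (2 * \<sigma>)"
        if "\<bar>x - s\<bar> \<le> 1 / sqrt \<sigma>" "\<bar>y - t\<bar> \<le> 1 / sqrt \<sigma>"
      proof -
        have "dist (Complex x y) p \<le> \<bar>x - s\<bar> + \<bar>y - t\<bar>"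
          using cmod_le[of "Complex x y - p"] by (simp add: p_def dist_norm)
        also have "\<dots> < \<delta>" using that \<rho> \<delta>(1) by linarith
        finally have "f p - f (Complex x y) \<le> \<epsilon>"
          using \<delta>(2)[OF R[OF xy]] by (auto simp: dist_real_def)
        then show ?thesis
          using reflected_kernel_bounds[of \<sigma>] \<sigma> \<epsilon> by (intro mult_mono) auto
      qed
      show "(f p - f (Complex x y)) * ?k \<sigma> (Complex x y) \<le> 0"
        if "\<not> (\<bar>x - s\<bar> \<le> 1 / sqrt \<sigma> \<and> \<bar>y - t\<bar> \<le> 1 / sqrt \<sigma>)"
        using reflected_kernel_support[OF \<sigma>(1) c _ that] xy by simp
    qed (use \<sigma> \<epsilon> in auto)
    also have "(\<epsilon> * (2 * \<sigma>)) * (4 * (1 / sqrt \<sigma>)\<^sup>2) = 8 * \<epsilon>"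
      using \<sigma> by (simp add: power_divide)
    also have "?I (\<lambda>z. (f p - f z) * ?k \<sigma> z) = f p * ?I (?k \<sigma>) - ?I (\<lambda>z. f z * ?k \<sigma> z)"
    proof -
      have "?I (\<lambda>z. f p * ?k \<sigma> z - f z * ?k \<sigma> z) = ?I (\<lambda>z. f p * ?k \<sigma> z) - ?I (\<lambda>z. f z * ?k \<sigma> z)"
        by (rule box_integral_diff[OF _ _ R]) (intro continuous_intros cf)+
      then show ?thesis by (simp add: box_integral_cmult left_diff_distrib)
    qed
    finally have 1: "f p * ?I (?k \<sigma>) \<le> ?I (\<lambda>z. f z * ?k \<sigma> z) + 8 * \<epsilon>" by simp
    have "?I (\<lambda>z. f z * ?k \<sigma> z) + C1 / (2 * \<sigma>) + C2 / (2 * sqrt \<sigma>)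
       \<le> ?I (\<lambda>z. f z * ?k (1 / r\<^sup>2) z) + C1 / (2 * (1 / r\<^sup>2)) + C2 / (2 * sqrt (1 / r\<^sup>2))"
      by (rule kernel_mean_mono[OF f R r c C lap edge _ \<sigma>(2)]) auto
    moreover have "0 \<le> C1 / (2 * \<sigma>)" "0 \<le> C2 / (2 * sqrt \<sigma>)" using C \<sigma> by auto
    moreover have "C1 / (2 * (1 / r\<^sup>2)) = C1 * r\<^sup>2 / 2" "C2 / (2 * sqrt (1 / r\<^sup>2)) = C2 * r / 2"
      using r by (auto simp: real_sqrt_divide)
    moreover have "?I (\<lambda>z. f z * ?k (1 / r\<^sup>2) z) \<le> 2 / r\<^sup>2 * ?I f"
    proof -
      have "?I (\<lambda>z. f z * ?k (1 / r\<^sup>2) z) \<le> ?I (\<lambda>z. 2 / r\<^sup>2 * f z)"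
      proof (rule box_integral_mono[OF _ _ R])
        fix x y assume xy: "x \<in> {s - r..s + r}" "y \<in> {c..t + r}"
        show "f (Complex x y) * ?k (1 / r\<^sup>2) (Complex x y) \<le> 2 / r\<^sup>2 * f (Complex x y)"
          using mult_left_mono[OF reflected_kernel_bounds(2)[of "1 / r\<^sup>2"] nonneg[OF xy]] by (simp add: mult_ac)
      qed (intro continuous_intros cf)+
      then show ?thesis by (simp only: box_integral_cmult)
    qed
    ultimately have "?I (\<lambda>z. f z * ?k \<sigma> z) \<le> B" unfolding B_def by linarith
    moreover have "f p * (1 / 16) \<le> f p * ?I (?k \<sigma>)"
      by (intro mult_left_mono reflected_kernel_mass r c \<sigma> p0)
    ultimately show ?thesis using 1 by simp
  qed
  have "f p / 16 \<le> B"
  proof (rule field_le_epsilon)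
    fix e :: real assume "0 < e"
    with lim[of "e / 8"] show "f p / 16 \<le> B + e" by simp
  qed
  then have "f p \<le> 16 * B" by simp
  then show ?thesis unfolding B_def p_def .
qed

section \<open>Decay from finite area\<close>

lemma cbox_complex_image:
  "(\<lambda>z. (Re z, Im z)) ` cbox u v = cbox (Re u, Im u) (Re v, Im v)"
  "(\<lambda>(x, y). Complex x y) ` cbox p q = cbox (Complex (fst p) (snd p)) (Complex (fst q) (snd q))"
proof -
  have "(x, y) \<in> (\<lambda>z. (Re z, Im z)) ` cbox u v" if "(x, y) \<in> cbox (Re u, Im u) (Re v, Im v)" for x y
    using that by (intro image_eqI[of _ _ "Complex x y"]) (auto simp: in_cbox_complex_iff cbox_Pair_eq)
  then show "(\<lambda>z. (Re z, Im z)) ` cbox u v = cbox (Re u, Im u) (Re v, Im v)"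
    by (auto simp: in_cbox_complex_iff cbox_Pair_eq)
  have "z \<in> (\<lambda>(x, y). Complex x y) ` cbox p q" if "z \<in> cbox (Complex (fst p) (snd p)) (Complex (fst q) (snd q))" for z
    using that by (intro image_eqI[of _ _ "(Re z, Im z)"]; cases p; cases q) (auto simp: in_cbox_complex_iff cbox_Pair_eq)
  then show "(\<lambda>(x, y). Complex x y) ` cbox p q = cbox (Complex (fst p) (snd p)) (Complex (fst q) (snd q))"
    by (cases p; cases q) (auto simp: in_cbox_complex_iff cbox_Pair_eq)
qed

lemma measure_lborel_cbox_complex:
  "measure lborel (cbox u v) = measure lborel (cbox (Re u, Im u) (Re v, Im v))" for u v :: complex
proof -
  have "measure lborel (cbox u v) = measure lborel (cbox (Re u) (Re v)) * measure lborel (cbox (Im u) (Im v))"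
    by (auto simp: content_cbox_if Basis_complex_def in_cbox_complex_iff box_eq_empty
        cbox_interval set_eq_iff)
  then show ?thesis by (simp add: content_Pair)
qed

text \<open>Finite area is assumed for subsets of \<open>complex\<close>, while boxes are integrated
  over pairs. The coordinate map preserves content, so \<open>has_integral_twiddle\<close> applies
  with factor one.\<close>

lemma has_integral_box_complex:
  fixes F :: "complex \<Rightarrow> real"
  assumes F: "continuous_on S F" and R: "\<And>x y. x \<in> {a..b} \<Longrightarrow> y \<in> {c..d} \<Longrightarrow> Complex x y \<in> S"
  shows "(F has_integral box_integral a b c d F) (cbox (Complex a c) (Complex b d))"
proof -
  have i: "((\<lambda>(x, y). F (Complex x y)) has_integral box_integral a b c d F) (cbox (a, c) (b, d))"
    unfolding box_integral_def by (rule integrable_integral, rule integrable_box[OF F R])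
  have "((\<lambda>z. (\<lambda>(x, y). F (Complex x y)) ((\<lambda>z. (Re z, Im z)) z)) has_integral (1 / 1) *\<^sub>R box_integral a b c d F)
      ((\<lambda>(x, y). Complex x y) ` cbox (a, c) (b, d))"
  proof (rule has_integral_twiddle[OF _ _ _ _ _ _ _ i])
    show "continuous (at x) (\<lambda>z. (Re z, Im z))" for x
      by (intro continuous_Pair linear_continuous_at bounded_linear_Re bounded_linear_Im)
    show "\<exists>w z. (\<lambda>z. (Re z, Im z)) ` cbox u v = cbox w z" for u v
      using cbox_complex_image(1) by blast
    show "\<exists>w z. (\<lambda>(x, y). Complex x y) ` cbox u v = cbox w z" for u v
      using cbox_complex_image(2) by blast
    show "measure lborel ((\<lambda>z. (Re z, Im z)) ` cbox u v) = 1 * measure lborel (cbox u v)" for u v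
      unfolding cbox_complex_image(1) measure_lborel_cbox_complex by simp
  qed auto
  then show ?thesis by (simp add: cbox_complex_image(2))
qed

text \<open>Dominated convergence with \<open>F\<close> itself as majorant: the modulus of a point
  is positive and finite, so every point eventually leaves \<open>T n\<close>.\<close>

lemma tail_integral_tendsto_0:
  fixes F :: "complex \<Rightarrow> real"
  assumes F: "F integrable_on open_half_plane" and nonneg: "\<And>z. z \<in> open_half_plane \<Longrightarrow> 0 \<le> F z"
  defines "T \<equiv> \<lambda>n::nat. {z \<in> open_half_plane. cmod z < 1 / real (Suc n) \<or> real (Suc n) < cmod z}"
  shows "\<And>n. F integrable_on T n" "(\<lambda>n. integral (T n) F) \<longlonglongrightarrow> 0"
proof -
  have abs: "F absolutely_integrable_on open_half_plane"
    using nonneg F by (rule nonnegative_absolutely_integrable_1[rotated])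
  have op: "open (T n)" for n
  proof -
    have "T n = {z. 0 < Im z} \<inter> ({z. cmod z < 1 / real (Suc n)} \<union> {z. real (Suc n) < cmod z})"
      by (auto simp: T_def open_half_plane_def)
    then show ?thesis
      by (auto intro!: open_Int open_Un open_Collect_less continuous_intros)
  qed
  have sub: "T n \<subseteq> open_half_plane" for n by (auto simp: T_def)
  show int: "F integrable_on T n" for n
    using set_integrable_subset[OF abs _ sub] op absolutely_integrable_on_def by fastforce
  have "(\<lambda>n. integral open_half_plane (\<lambda>z. if z \<in> T n then F z else 0)) \<longlonglongrightarrow> integral open_half_plane (\<lambda>z. 0)"
  proof (rule dominated_convergence[OF _ F])
    show "(\<lambda>z. if z \<in> T n then F z else 0) integrable_on open_half_plane" for n
      using int[of n] sub[of n] by (simp add: integrable_restrict_Int Int_absorb2)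
    show "norm (if z \<in> T n then F z else 0) \<le> F z" if "z \<in> open_half_plane" for n z
      using nonneg[OF that] by auto
    show "(\<lambda>n. if z \<in> T n then F z else 0) \<longlonglongrightarrow> 0" if z: "z \<in> open_half_plane" for z
    proof (rule tendsto_eventually)
      have "0 < cmod z" using z by (auto simp: open_half_plane_def)
      then obtain N M :: nat where N: "cmod z < real N" "inverse (real (Suc M)) < cmod z"
        using reals_Archimedean2 reals_Archimedean by metis
      have "z \<notin> T n" if n: "n \<ge> max N M" for n
      proof -
        have "cmod z < real (Suc n)" using N n by auto
        moreover have "1 / real (Suc n) \<le> inverse (real (Suc M))" using n by (auto simp: field_simps)
        ultimately show ?thesis using N by (auto simp: T_def)
      qed
      then show "\<forall>\<^sub>F n in sequentially. (if z \<in> T n then F z else 0) = 0"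
        unfolding eventually_sequentially by (metis (full_types))
    qed
  qed
  then show "(\<lambda>n. integral (T n) F) \<longlonglongrightarrow> 0"
    using sub by (simp add: integral_restrict_Int Int_absorb2)
qed

text \<open>Boundary points other than 0 are vertical limits of interior points. This carries the
  differential equation, assumed only inside, up to the boundary.\<close>

lemma closed_half_plane_extension:
  assumes h: "continuous_on closed_half_plane_punct h" and 0: "\<And>z. z \<in> open_half_plane \<Longrightarrow> h z = (0 :: real)"
    and z: "z \<in> closed_half_plane_punct"
  shows "h z = 0"
proof -
  define w where "w = (\<lambda>n. z + Complex 0 (inverse (real (Suc n))))"
  have "w \<longlonglongrightarrow> z + Complex 0 0"
    unfolding w_def by (intro tendsto_intros LIMSEQ_inverse_real_of_nat)
  then have lim: "w \<longlonglongrightarrow> z" by (simp add: Complex_eq)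
  have Im: "0 < Im (w n)" for n
    using z by (auto simp: w_def closed_half_plane_punct_def intro!: add_nonneg_pos)
  have cl: "w n \<in> closed_half_plane_punct" "w n \<in> open_half_plane" for n
    using Im[of n] by (auto simp: closed_half_plane_punct_def open_half_plane_def)
  have "(\<lambda>n. h (w n)) \<longlonglongrightarrow> h z"
    using h z cl lim unfolding continuous_on_sequentially by (auto simp: o_def)
  moreover have "(\<lambda>n. h (w n)) = (\<lambda>n. 0)" using 0 cl by auto
  ultimately show ?thesis using LIMSEQ_unique tendsto_const by metis
qed

lemma C2_partials_exp:
  assumes "C2_partials S f fx fy fxx fxy fyx fyy"
  shows "C2_partials S (\<lambda>z. exp (f z)) (\<lambda>z. exp (f z) * fx z) (\<lambda>z. exp (f z) * fy z)
     (\<lambda>z. exp (f z) * fx z ^ 2 + exp (f z) * fxx z) (\<lambda>z. exp (f z) * fx z * fy z + exp (f z) * fxy z)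
     (\<lambda>z. exp (f z) * fx z * fy z + exp (f z) * fyx z) (\<lambda>z. exp (f z) * fy z ^ 2 + exp (f z) * fyy z)"
  by (rule C2_partials_compose[OF assms]) (auto intro!: derivative_eq_intros continuous_intros)

text \<open>
  Point picking: at the maximum of \<open>exp (v / 2)\<close> weighted by the distance to the boundary of the ball,
  the factor \<open>exp (v / 2)\<close> is at most doubled on a ball of comparable radius. There the mean value
  inequality for \<open>exp v\<close> bounds the area from below.
\<close>

lemma area_lower_bound:
  fixes K c0 \<eta> :: real
  assumes C2: "C2_partials closed_half_plane_punct v vs vt vss vst vts vtt"
    and pde: "\<And>z. z \<in> closed_half_plane_punct \<Longrightarrow> vss z + vtt z + 2 * K * exp (v z) = 0"
    and K: "K \<le> 1" and c0: "0 \<le> c0"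
    and bc: "\<And>s. s \<noteq> 0 \<Longrightarrow> - c0 * exp (v (complex_of_real s) / 2) \<le> vt (complex_of_real s)"
    and z0: "z0 \<in> closed_half_plane_punct"
    and big: "2 * \<eta> \<le> cmod z0 * exp (v z0 / 2)"
    and \<eta>: "0 < \<delta>" "4 * \<delta> \<le> \<eta>" "\<delta> \<le> 1" "32 * \<delta> * (16 + 4 * c0) \<le> 1"
  obtains a b c d where "\<And>x y. x \<in> {a..b} \<Longrightarrow> y \<in> {c..d} \<Longrightarrow> Complex x y \<in> closed_half_plane_punct
      \<and> cmod z0 / 2 \<le> cmod (Complex x y) \<and> cmod (Complex x y) \<le> 3 / 2 * cmod z0"
    "\<delta>\<^sup>2 / 64 \<le> box_integral a b c d (\<lambda>z. exp (v z))"
proof -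
  note f = C2_partials_exp[OF C2]
  \<comment> \<open>Half the distance to the origin: the ball stays away from the singularity and is
    comparable in size to \<open>cmod z0\<close>.\<close>
  define d where "d = cmod z0 / 2"
  have d: "0 < d" using z0 by (simp add: d_def closed_half_plane_punct_def)
  define X where "X = cball z0 d \<inter> {z. 0 \<le> Im z}"
  have X: "z \<in> closed_half_plane_punct \<and> d \<le> cmod z \<and> cmod z \<le> 3 * d" if "z \<in> X" for z
  proof -
    have "cmod (z0 - z) \<le> d" using that by (auto simp: X_def dist_norm)
    moreover have "cmod z0 \<le> cmod (z0 - z) + cmod z" "cmod z \<le> cmod (z - z0) + cmod z0"
      using norm_triangle_ineq[of "z0 - z" z] norm_triangle_ineq[of "z - z0" z0] by simp_all
    ultimately have "d \<le> cmod z" "cmod z \<le> 3 * d" by (auto simp: d_def norm_minus_commute)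
    then show ?thesis using that d by (auto simp: X_def closed_half_plane_punct_def)
  qed
  define M where "M = (\<lambda>z. exp (v z / 2) * (d - cmod (z - z0)))"
  have z0X: "z0 \<in> X" using z0 d by (auto simp: X_def closed_half_plane_punct_def)
  have "compact X"
    unfolding X_def by (intro compact_Int_closed closed_Collect_le continuous_intros) auto
  moreover have "continuous_on X M"
    unfolding M_def using X
    by (intro continuous_intros continuous_on_subset[OF C2_partials_continuous(1)[OF C2]]) auto
  ultimately obtain w where w: "w \<in> X" "\<And>z. z \<in> X \<Longrightarrow> M z \<le> M w"
    using continuous_attains_sup[of X M] z0X by blast
  \<comment> \<open>\<open>2 * \<rho>\<close> is the distance from \<open>w\<close> to the bounding
    sphere, so within distance \<open>\<rho>\<close> of \<open>w\<close> the weight has lost at most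
    half of its value; maximality of \<open>M w\<close> then gives the factor 2 in
    \<open>near\<close>.\<close>
  define S \<rho> where "S = exp (v w / 2)" and "\<rho> = (d - cmod (w - z0)) / 2"
  have S: "0 < S" by (simp add: S_def)
  have Mw: "M w = S * (2 * \<rho>)" by (simp add: M_def S_def \<rho>_def)
  have "\<eta> \<le> M z0" using big by (simp add: M_def d_def mult.commute)
  then have S\<rho>: "\<eta> \<le> 2 * (S * \<rho>)" using w(2)[OF z0X] Mw by simp
  then have \<rho>: "0 < \<rho>" using \<eta> S by (smt (verit) mult_nonneg_nonpos)
  have near: "exp (v z / 2) \<le> 2 * S" if z: "0 \<le> Im z" "cmod (z - w) \<le> \<rho>" and "z \<in> X" for z
  proof -
    have "cmod (z - z0) \<le> cmod (z - w) + cmod (w - z0)"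
      using norm_triangle_ineq[of "z - w" "w - z0"] by simp
    then have "\<rho> \<le> d - cmod (z - z0)" using z by (simp add: \<rho>_def)
    then have "exp (v z / 2) * \<rho> \<le> M z" unfolding M_def by (intro mult_left_mono) auto
    also have "\<dots> \<le> (2 * S) * \<rho>" using w(2)[OF \<open>z \<in> X\<close>] Mw by simp
    finally show ?thesis using \<rho> by simp
  qed
  have nearX: "z \<in> X" if z: "0 \<le> Im z" "cmod (z - w) \<le> \<rho>" for z
  proof -
    have "cmod (z - z0) \<le> cmod (z - w) + cmod (w - z0)"
      using norm_triangle_ineq[of "z - w" "w - z0"] by simp
    then have "cmod (z - z0) \<le> d" using z \<rho> by (simp add: \<rho>_def)
    then show ?thesis using z by (simp add: X_def dist_norm norm_minus_commute)
  qed
  \<comment> \<open>The rescaled radius is \<open>S * r = \<delta>\<close>, so \<open>S\<close>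
    drops out of the final inequality after division by \<open>S\<^sup>2\<close>.\<close>
  define r where "r = \<delta> / S"
  have r: "0 < r" using \<eta> S by (simp add: r_def)
  have Sr: "S * r = \<delta>" using S by (simp add: r_def)
  have r\<rho>: "2 * r \<le> \<rho>"
  proof -
    have "S * (2 * r) \<le> S * \<rho>" using Sr S\<rho> \<eta> by linarith
    then show ?thesis using S by simp
  qed
  \<comment> \<open>The box is cut off at the real axis. If \<open>r \<le> Im w\<close>, then
    \<open>c = Im w - r\<close> and no boundary data enter.\<close>
  define c where "c = max 0 (Im w - r)"
  have Imw: "0 \<le> Im w" using w by (simp add: X_def)
  have near': "0 \<le> y \<and> cmod (Complex x y - w) \<le> \<rho>" if "x \<in> {Re w - r..Re w + r}" "y \<in> {c..Im w + r}" for x y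
  proof -
    have "cmod (Complex x y - w) \<le> \<bar>x - Re w\<bar> + \<bar>y - Im w\<bar>"
      using cmod_le[of "Complex x y - w"] by simp
    also have "\<dots> \<le> 2 * r" using that by (auto simp: c_def)
    finally show ?thesis using r\<rho> that by (auto simp: c_def)
  qed
  have R: "Complex x y \<in> X \<and> exp (v (Complex x y) / 2) \<le> 2 * S"
    if "x \<in> {Re w - r..Re w + r}" "y \<in> {c..Im w + r}" for x y
    using near'[OF that] nearX[of "Complex x y"] near[of "Complex x y"] by auto
  have R': "Complex x y \<in> closed_half_plane_punct" if "x \<in> {Re w - r..Re w + r}" "y \<in> {c..Im w + r}" for x y
    using R[OF that] X by blast
  have sq: "exp (v z) = exp (v z / 2) ^ 2" for z by (simp flip: exp_double)
  let ?I = "box_integral (Re w - r) (Re w + r) c (Im w + r) (\<lambda>z. exp (v z))"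
  \<comment> \<open>Near \<open>w\<close> one has \<open>exp v \<le> 4 * S\<^sup>2\<close>. The
    Laplacian of \<open>exp v\<close> is at least \<open>- 2 * K * exp (2 * v)\<close> and its edge
    derivative at least \<open>- c0 * exp (3 * v / 2)\<close>; this yields \<open>32 * S ^ 4\<close>
    and \<open>8 * c0 * S ^ 3\<close>.\<close>
  have "exp (v (Complex (Re w) (Im w))) \<le> 16 * (2 / r\<^sup>2 * ?I + (32 * S ^ 4) * r\<^sup>2 / 2 + (8 * c0 * S ^ 3) * r / 2)"
  proof (rule mean_value_inequality[OF f R' r])
    fix x y assume xy: "x \<in> {Re w - r..Re w + r}" "y \<in> {c..Im w + r}"
    let ?z = "Complex x y"
    have e: "exp (v ?z) \<le> (2 * S)\<^sup>2" unfolding sq using R[OF xy] by (intro power_mono) auto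
    have "vss ?z + vtt ?z = - 2 * K * exp (v ?z)"
      using pde[OF R'[OF xy]] by linarith
    then have "exp (v ?z) * (vss ?z + vtt ?z) = - 2 * (K * exp (v ?z) ^ 2)"
      by (simp add: power2_eq_square)
    moreover have "K * exp (v ?z) ^ 2 \<le> 16 * S ^ 4"
    proof -
      have "K * exp (v ?z) ^ 2 \<le> 1 * exp (v ?z) ^ 2" using K by (intro mult_right_mono) auto
      also have "\<dots> \<le> ((2 * S)\<^sup>2)\<^sup>2" using power_mono[OF e, of 2] by simp
      also have "\<dots> = 16 * S ^ 4" by (simp add: power_mult_distrib)
      finally show ?thesis .
    qed
    ultimately have "- (32 * S ^ 4) \<le> exp (v ?z) * (vss ?z + vtt ?z)" by linarith
    moreover have "0 \<le> exp (v ?z) * (vs ?z)\<^sup>2" "0 \<le> exp (v ?z) * (vt ?z)\<^sup>2" by auto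
    ultimately show "- (32 * S ^ 4) \<le> exp (v ?z) * (vs ?z)\<^sup>2 + exp (v ?z) * vss ?z
        + (exp (v ?z) * (vt ?z)\<^sup>2 + exp (v ?z) * vtt ?z)"
      unfolding distrib_left by linarith
  next
    fix x assume x: "x \<in> {Re w - r..Re w + r}" and "Im w - r < c"
    then have c: "c = 0" by (auto simp: c_def)
    have xc: "c \<in> {c..Im w + r}" using c Imw r by simp
    let ?z = "Complex x c"
    have z: "?z = complex_of_real x" by (simp add: c Complex_eq)
    have "x \<noteq> 0" using R'[OF x xc] c by (auto simp: closed_half_plane_punct_def Complex_eq)
    then have "exp (v ?z) * (- c0 * exp (v ?z / 2)) \<le> exp (v ?z) * vt ?z"
      using bc[of x] unfolding z by (intro mult_left_mono) auto
    have "c0 * exp (v ?z / 2) ^ 3 \<le> c0 * (2 * S) ^ 3"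
      using R[OF x xc] c0 by (intro mult_left_mono power_mono) auto
    then show "- (8 * c0 * S ^ 3) \<le> exp (v ?z) * vt ?z"
    proof -
      have "exp (v ?z) * (- c0 * exp (v ?z / 2)) = - (c0 * exp (v ?z / 2) ^ 3)"
        unfolding sq by (simp add: power2_eq_square power3_eq_cube)
      moreover have "c0 * (2 * S) ^ 3 = 8 * c0 * S ^ 3" by (simp add: power_mult_distrib)
      ultimately show ?thesis
        using \<open>exp (v ?z) * (- c0 * exp (v ?z / 2)) \<le> exp (v ?z) * vt ?z\<close>
          \<open>c0 * exp (v ?z / 2) ^ 3 \<le> c0 * (2 * S) ^ 3\<close> by linarith
    qed
  qed (use S c0 Imw r in \<open>auto simp: c_def\<close>)
  also have "exp (v (Complex (Re w) (Im w))) = S\<^sup>2" by (simp add: S_def sq)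
  finally have main: "S\<^sup>2 \<le> 32 / r\<^sup>2 * ?I + 256 * (S ^ 4 * r\<^sup>2) + 64 * c0 * (S ^ 3 * r)"
    by (simp add: mult_ac)
  have e: "S ^ 4 * r\<^sup>2 = S\<^sup>2 * \<delta>\<^sup>2" "S ^ 3 * r = S\<^sup>2 * \<delta>" "32 / r\<^sup>2 * ?I = S\<^sup>2 * (32 * ?I / \<delta>\<^sup>2)"
    unfolding Sr[symmetric] using S r by (simp_all add: power_mult_distrib eval_nat_numeral)
  have "S\<^sup>2 * 1 \<le> S\<^sup>2 * (32 * ?I / \<delta>\<^sup>2 + 256 * \<delta>\<^sup>2 + 64 * c0 * \<delta>)"
    using main unfolding e by (simp add: algebra_simps)
  then have "1 \<le> 32 * ?I / \<delta>\<^sup>2 + 256 * \<delta>\<^sup>2 + 64 * c0 * \<delta>" using S by simp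
  moreover have "256 * \<delta>\<^sup>2 \<le> 256 * \<delta>" using \<eta> by (simp add: power2_eq_square)
  \<comment> \<open>The last condition on \<open>\<delta>\<close> is designed for this: both error
    terms together use up at most one half.\<close>
  moreover have "256 * \<delta> + 64 * c0 * \<delta> \<le> 1 / 2" using \<eta>(4) by (simp add: algebra_simps)
  ultimately have "1 / 2 \<le> 32 * ?I / \<delta>\<^sup>2" by linarith
  then have "\<delta>\<^sup>2 / 64 \<le> ?I" using \<eta> by (simp add: field_simps)
  moreover have "Complex x y \<in> closed_half_plane_punct \<and> cmod z0 / 2 \<le> cmod (Complex x y) \<and> cmod (Complex x y) \<le> 3 / 2 * cmod z0"
    if "x \<in> {Re w - r..Re w + r}" "y \<in> {c..Im w + r}" for x y
    using X[of "Complex x y"] R[OF that] by (simp add: d_def)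
  ultimately show ?thesis using that by blast
qed


text \<open>\<open>cmod z * exp (v z / 2)\<close> is scale invariant; in the logarithmic coordinate
  it is \<open>exp (V / 2)\<close>. If it reached \<open>\<eta>\<close> at a point too close to 0 or
  too far out, that point would own a box on which the integral of \<open>exp v\<close> is at least
  \<open>\<delta>\<^sup>2 / 64\<close>, inside a tail with a smaller integral.\<close>

theorem finite_area_decay:
  fixes K c0 \<eta> :: real
  assumes C2: "C2_partials closed_half_plane_punct v vs vt vss vst vts vtt"
    and pde: "\<And>z. z \<in> closed_half_plane_punct \<Longrightarrow> vss z + vtt z + 2 * K * exp (v z) = 0"
    and K: "K \<le> 1" and c0: "0 \<le> c0"
    and bc: "\<And>s. s \<noteq> 0 \<Longrightarrow> - c0 * exp (v (complex_of_real s) / 2) \<le> vt (complex_of_real s)"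
    and fin: "(\<lambda>z. exp (v z)) integrable_on open_half_plane"
    and \<eta>: "0 < \<eta>"
  obtains N where "\<And>z. z \<in> closed_half_plane_punct \<Longrightarrow> cmod z < 1 / real N \<or> real N < cmod z \<Longrightarrow>
    cmod z * exp (v z / 2) < \<eta>" "0 < N"
proof -
  define \<delta> where "\<delta> = min (\<eta> / 8) (1 / (32 * (16 + 4 * c0)))"
  have \<delta>: "0 < \<delta>" "4 * \<delta> \<le> \<eta> / 2" "32 * \<delta> * (16 + 4 * c0) \<le> 1"
  proof -
    show "0 < \<delta>" "4 * \<delta> \<le> \<eta> / 2" using \<eta> c0 by (auto simp: \<delta>_def)
    have "\<delta> \<le> 1 / (32 * (16 + 4 * c0))" by (simp add: \<delta>_def)
    then show "32 * \<delta> * (16 + 4 * c0) \<le> 1" using c0 by (simp add: le_divide_eq mult_ac)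
  qed
  have \<delta>1: "\<delta> \<le> 1"
  proof -
    have "\<delta> * 1 \<le> \<delta> * (32 * (16 + 4 * c0))" using \<delta> c0 by (intro mult_left_mono) auto
    also have "\<dots> = 32 * \<delta> * (16 + 4 * c0)" by simp
    finally show ?thesis using \<delta>(3) by linarith
  qed
  define T where "T = (\<lambda>n::nat. {z \<in> open_half_plane. cmod z < 1 / real (Suc n) \<or> real (Suc n) < cmod z})"
  have nn: "\<And>z. z \<in> open_half_plane \<Longrightarrow> 0 \<le> exp (v z)" by simp
  have tail: "(\<lambda>z. exp (v z)) integrable_on T n" "(\<lambda>n. integral (T n) (\<lambda>z. exp (v z))) \<longlonglongrightarrow> 0" for n
    unfolding T_def by (rule tail_integral_tendsto_0[OF fin nn]; assumption)+
  have "\<forall>\<^sub>F n in sequentially. integral (T n) (\<lambda>z. exp (v z)) < \<delta>\<^sup>2 / 64"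
    by (rule order_tendstoD(2)[OF tail(2)]) (use \<delta> in simp)
  then obtain n where n: "integral (T n) (\<lambda>z. exp (v z)) < \<delta>\<^sup>2 / 64"
    by (auto simp: eventually_sequentially)
  show ?thesis
  proof
    \<comment> \<open>The factor 2 leaves room for the box, whose points have modulus between one
      half and three halves of \<open>cmod z\<close>.\<close>
    fix z assume z: "z \<in> closed_half_plane_punct" "cmod z < 1 / real (2 * Suc n) \<or> real (2 * Suc n) < cmod z"
    show "cmod z * exp (v z / 2) < \<eta>"
    proof (rule ccontr)
      assume "\<not> ?thesis"
      then have big: "2 * (\<eta> / 2) \<le> cmod z * exp (v z / 2)" by simp
      obtain a b c d where R: "\<And>x y. x \<in> {a..b} \<Longrightarrow> y \<in> {c..d} \<Longrightarrow> Complex x y \<in> closed_half_plane_punct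
          \<and> cmod z / 2 \<le> cmod (Complex x y) \<and> cmod (Complex x y) \<le> 3 / 2 * cmod z"
        and I: "\<delta>\<^sup>2 / 64 \<le> box_integral a b c d (\<lambda>z. exp (v z))"
        using area_lower_bound[OF C2 pde K c0 bc z(1) big \<delta>(1,2) \<delta>1 \<delta>(3)] by blast
      let ?B = "cbox (Complex a c) (Complex b d)" and ?B' = "box (Complex a c) (Complex b d)"
      have i: "((\<lambda>z. exp (v z)) has_integral box_integral a b c d (\<lambda>z. exp (v z))) ?B"
        by (rule has_integral_box_complex[of closed_half_plane_punct])
           (use R in \<open>auto intro!: continuous_intros C2_partials_continuous(1)[OF C2]\<close>)
      \<comment> \<open>The tail lies in the open half plane, so the closed box, which may touch the
        real axis, is replaced by its interior; the integral does not change.\<close>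
      have "?B' \<subseteq> T n"
      proof
        fix u assume u: "u \<in> ?B'"
        have "\<exists>y \<in> {c..d}. y < Im u"
          using u by (intro bexI[of _ c]) (auto simp: in_box_complex_iff)
        then obtain y where y: "y \<in> {c..d}" "y < Im u" by blast
        have "0 \<le> Im (Complex (Re u) y)"
          using R[of "Re u" y] y u by (auto simp: in_box_complex_iff closed_half_plane_punct_def)
        then have Im: "0 < Im u" using y by simp
        have "cmod z / 2 \<le> cmod u \<and> cmod u \<le> 3 / 2 * cmod z"
          using R[of "Re u" "Im u"] u by (auto simp: in_box_complex_iff)
        moreover have "cmod z < (1 / real (Suc n)) / 2 \<or> 2 * real (Suc n) < cmod z"
          using z(2) by (simp add: mult.commute)
        moreover have "x / 2 \<le> y \<and> y \<le> 3 / 2 * x \<Longrightarrow> x < p / 2 \<or> 2 * q < x \<Longrightarrow> 0 < p \<Longrightarrow> y < p \<or> q < y"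
          for x y p q :: real by auto
        ultimately have "cmod u < 1 / real (Suc n) \<or> real (Suc n) < cmod u"
          by (metis of_nat_0_less_iff zero_less_Suc zero_less_divide_1_iff)
        then show "u \<in> T n" using Im by (simp add: T_def open_half_plane_def)
      qed
      moreover have "(\<lambda>z. exp (v z)) integrable_on ?B'"
        using i by (auto simp: integrable_on_open_interval)
      ultimately have "integral ?B' (\<lambda>z. exp (v z)) \<le> integral (T n) (\<lambda>z. exp (v z))"
        using tail(1) by (intro integral_subset_le) auto
      moreover have "integral ?B' (\<lambda>z. exp (v z)) = box_integral a b c d (\<lambda>z. exp (v z))"
        unfolding integral_open_interval using i by (rule integral_unique)
      ultimately show False using I n by linarith
    qed
  qed simp
qed

section \<open>The equation on a strip\<close>

lemma above_tangent:
  fixes f f' f'' :: "real \<Rightarrow> real"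
  assumes "\<And>x. (f has_real_derivative f' x) (at x)" "\<And>x. (f' has_real_derivative f'' x) (at x)"
    and "\<And>x. 0 \<le> f'' x"
  shows "f 0 + f' 0 * x \<le> f x"
proof -
  have "convex_on UNIV f"
    by (rule f''_ge0_imp_convex[of UNIV f f' f'']) (use assms in auto)
  from convex_on_imp_above_tangent[OF this, of 0 x "f' 0"] show ?thesis
    using assms(1) by auto
qed

text \<open>Both \<open>f x + c * x\<^sup>2 / 2\<close> and \<open>- f x + c * x\<^sup>2 / 2\<close>
  are convex, hence above their tangents at 0.\<close>

lemma quadratic_growth:
  fixes f f' f'' :: "real \<Rightarrow> real"
  assumes f: "\<And>x. (f has_real_derivative f' x) (at x)" "\<And>x. (f' has_real_derivative f'' x) (at x)"
    and le: "\<And>x. \<bar>f'' x\<bar> \<le> c"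
  shows "\<exists>C. \<forall>x. \<bar>f x\<bar> \<le> C * (1 + x\<^sup>2)"
proof -
  have 1: "s * f 0 + (s * f' 0) * x \<le> s * f x + c * x\<^sup>2 / 2" if "s = 1 \<or> s = - 1" for s x
  proof -
    have "s * f 0 + c * 0\<^sup>2 / 2 + (s * f' 0 + c * 0) * x \<le> s * f x + c * x\<^sup>2 / 2"
    proof (rule above_tangent[where f'' = "\<lambda>x. s * f'' x + c"])
      show "0 \<le> s * f'' x + c" for x using le[of x] that by auto
    qed (auto intro!: derivative_eq_intros f)
    then show ?thesis by simp
  qed
  have "\<bar>f x\<bar> \<le> (\<bar>f 0\<bar> + \<bar>f' 0\<bar> + c) * (1 + x\<^sup>2)" for x
  proof -
    have c: "0 \<le> c" using le[of 0] by linarith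
    have "\<bar>x\<bar> \<le> 1 + x\<^sup>2"
    proof (cases "\<bar>x\<bar> \<le> 1")
      case False
      then have "\<bar>x\<bar> * 1 \<le> \<bar>x\<bar> * \<bar>x\<bar>" by (intro mult_left_mono) auto
      then show ?thesis by (simp add: power2_eq_square)
    qed (auto simp: add_increasing2)
    then have "\<bar>f' 0\<bar> * \<bar>x\<bar> \<le> \<bar>f' 0\<bar> * (1 + x\<^sup>2)" by (intro mult_left_mono) auto
    moreover have "\<bar>f x\<bar> \<le> \<bar>f 0\<bar> + \<bar>f' 0\<bar> * \<bar>x\<bar> + c * x\<^sup>2 / 2"
      using 1[of 1 x] 1[of "- 1" x] abs_mult[of "f' 0" x] by linarith
    moreover have "\<bar>f 0\<bar> * 1 \<le> \<bar>f 0\<bar> * (1 + x\<^sup>2)" "c * x\<^sup>2 / 2 \<le> c * (1 + x\<^sup>2)"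
      using c by (auto simp: algebra_simps)
    ultimately show ?thesis by (simp only: distrib_right)
  qed
  then show ?thesis by blast
qed

text \<open>\<open>E x + b * x\<^sup>2 / 2 - a / n\<^sup>2 * exp (n * x)\<close> is convex and lies
  above a line, so \<open>E\<close> dominates an exponential up to a polynomial. The degree 4 in the
  bound is that of the integral of \<open>V\<^sup>2\<close> when \<open>V\<close> grows
  quadratically.\<close>

lemma no_exponential_growth_pos:
  fixes E E' E'' :: "real \<Rightarrow> real"
  assumes E: "\<And>x. (E has_real_derivative E' x) (at x)" "\<And>x. (E' has_real_derivative E'' x) (at x)"
    and ge: "\<And>x. a * exp (n * x) - b \<le> E'' x" and a: "0 < a" and n: "0 < n"
    and le: "\<And>x. E x \<le> C * (1 + x\<^sup>2)\<^sup>2"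
  shows False
proof -
  define k where "k = a / n\<^sup>2"
  have k: "0 < k" using a n by (simp add: k_def)
  have "E 0 + b * 0\<^sup>2 / 2 - k * exp (n * 0) + (E' 0 + b * 0 - k * n * exp (n * 0)) * x \<le> E x + b * x\<^sup>2 / 2 - k * exp (n * x)" for x
  proof (rule above_tangent[where f'' = "\<lambda>x. E'' x + b - k * n * n * exp (n * x)"])
    show "0 \<le> E'' x + b - k * n * n * exp (n * x)" for x
      using ge[of x] n by (simp add: k_def power2_eq_square)
  qed (auto intro!: derivative_eq_intros E)
  then have "(E 0 - k) + (E' 0 - k * n) * x \<le> E x + b * x\<^sup>2 / 2 - k * exp (n * x)" for x
    by simp
  then have *: "k * exp (n * x) \<le> C * (1 + x\<^sup>2)\<^sup>2 + b * x\<^sup>2 / 2 - (E 0 - k) - (E' 0 - k * n) * x" for x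
    using le[of x] by (smt (verit))
  have "\<forall>\<^sub>F x in at_top. C * (1 + x\<^sup>2)\<^sup>2 + b * x\<^sup>2 / 2 - (E 0 - k) - (E' 0 - k * n) * x < k * exp (n * x)"
  proof -
    have "((\<lambda>x. (C * (1 + x\<^sup>2)\<^sup>2 + b * x\<^sup>2 / 2 - (E 0 - k) - (E' 0 - k * n) * x) / exp (n * x)) \<longlongrightarrow> 0) at_top"
    proof -
      have lim: "((\<lambda>x. x ^ j / exp (n * x)) \<longlongrightarrow> 0) at_top" for j :: nat
      proof -
        have "filterlim (\<lambda>x. n * x) at_top at_top"
          using n by (intro filterlim_tendsto_pos_mult_at_top[OF tendsto_const]) (auto simp: filterlim_ident)
        then have "((\<lambda>x. 1 / n ^ j * ((n * x) ^ j / exp (n * x))) \<longlongrightarrow> 1 / n ^ j * 0) at_top"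
          by (intro tendsto_intros filterlim_compose[OF tendsto_power_div_exp_0])
        then show ?thesis using n by (simp add: power_mult_distrib)
      qed
      have "((\<lambda>x. C * (x ^ 0 / exp (n * x) + 2 * (x\<^sup>2 / exp (n * x)) + x ^ 4 / exp (n * x)) + b / 2 * (x\<^sup>2 / exp (n * x))
          - (E 0 - k) * (x ^ 0 / exp (n * x)) - (E' 0 - k * n) * (x ^ 1 / exp (n * x)))
          \<longlongrightarrow> C * (0 + 2 * 0 + 0) + b / 2 * 0 - (E 0 - k) * 0 - (E' 0 - k * n) * 0) at_top"
        by (intro tendsto_intros lim)
      moreover have "C * (x ^ 0 / exp (n * x) + 2 * (x\<^sup>2 / exp (n * x)) + x ^ 4 / exp (n * x)) + b / 2 * (x\<^sup>2 / exp (n * x))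
          - (E 0 - k) * (x ^ 0 / exp (n * x)) - (E' 0 - k * n) * (x ^ 1 / exp (n * x))
          = (C * (1 + x\<^sup>2)\<^sup>2 + b * x\<^sup>2 / 2 - (E 0 - k) - (E' 0 - k * n) * x) / exp (n * x)" for x
        by (simp add: divide_simps) (simp add: algebra_simps eval_nat_numeral)
      ultimately show ?thesis by simp
    qed
    then have "\<forall>\<^sub>F x in at_top. (C * (1 + x\<^sup>2)\<^sup>2 + b * x\<^sup>2 / 2 - (E 0 - k) - (E' 0 - k * n) * x) / exp (n * x) < k"
      using k by (rule order_tendstoD(2))
    then show ?thesis by eventually_elim (simp add: divide_less_eq)
  qed
  then obtain x where "C * (1 + x\<^sup>2)\<^sup>2 + b * x\<^sup>2 / 2 - (E 0 - k) - (E' 0 - k * n) * x < k * exp (n * x)"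
    using eventually_happens'[OF trivial_limit_at_top_linorder] by blast
  with *[of x] show False by linarith
qed

lemma no_exponential_growth:
  fixes E E' E'' :: "real \<Rightarrow> real"
  assumes E: "\<And>x. (E has_real_derivative E' x) (at x)" "\<And>x. (E' has_real_derivative E'' x) (at x)"
    and ge: "\<And>x. a * exp (n * x) - b \<le> E'' x" and a: "0 < a" and n: "n \<noteq> 0"
    and le: "\<And>x. E x \<le> C * (1 + x\<^sup>2)\<^sup>2"
  shows False
proof (cases "0 < n")
  case True
  then show ?thesis using no_exponential_growth_pos[OF E ge a _ le] by blast
next
  case False
  have 1: "((\<lambda>x. E (- x)) has_real_derivative - E' (- x)) (at x)" for x
    using DERIV_chain2[OF E(1) DERIV_minus[OF DERIV_ident]] by simp
  have 2: "((\<lambda>x. - E' (- x)) has_real_derivative E'' (- x)) (at x)" for x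
    using DERIV_minus[OF DERIV_chain2[OF E(2) DERIV_minus[OF DERIV_ident]]] by simp
  show ?thesis
    by (rule no_exponential_growth_pos[OF 1 2, of a "- n" b C])
       (use ge[of "- x" for x] le[of "- x" for x] a n False in auto)
qed

section \<open>Integrals over vertical cross sections of the strip\<close>

definition strip :: "complex set" where
  "strip = {w. 0 \<le> Im w \<and> Im w \<le> pi}"

lemma Complex_in_strip [simp]: "Complex x y \<in> strip \<longleftrightarrow> 0 \<le> y \<and> y \<le> pi"
  by (simp add: strip_def)

lemma continuous_on_strip_slice:
  assumes "continuous_on strip F"
  shows "continuous_on (UNIV \<times> cbox 0 pi) (\<lambda>(x, y). F (Complex x y))"
    "continuous_on {0..pi} (\<lambda>y. F (Complex x y))"
proof -
  show "continuous_on (UNIV \<times> cbox 0 pi) (\<lambda>(x, y). F (Complex x y))"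
    unfolding case_prod_beta
    by (rule continuous_on_compose2[OF assms]) (auto simp: Complex_eq intro!: continuous_intros simp flip: Complex_eq)
  show "continuous_on {0..pi} (\<lambda>y. F (Complex x y))"
    by (rule continuous_on_compose2[OF assms]) (auto simp: Complex_eq intro!: continuous_intros simp flip: Complex_eq)
qed

lemma strip_integrable:
  fixes F :: "complex \<Rightarrow> real"
  assumes "continuous_on strip F"
  shows "(\<lambda>y. F (Complex x y)) integrable_on {0..pi}"
  by (rule integrable_continuous_interval, rule continuous_on_strip_slice(2)[OF assms])

lemma strip_integral_deriv:
  fixes F Fx :: "complex \<Rightarrow> real"
  assumes "continuous_on strip F" "continuous_on strip Fx"
    and "\<And>x y. y \<in> {0..pi} \<Longrightarrow> ((\<lambda>x. F (Complex x y)) has_real_derivative Fx (Complex x y)) (at x)"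
  shows "((\<lambda>x. integral {0..pi} (\<lambda>y. F (Complex x y))) has_real_derivative integral {0..pi} (\<lambda>y. Fx (Complex x y))) (at x)"
  using leibniz_rule_field_derivative[of UNIV 0 pi "\<lambda>x y. F (Complex x y)" "\<lambda>x y. Fx (Complex x y)" x]
    assms continuous_on_strip_slice(1)[OF assms(2)] strip_integrable[OF assms(1)] by simp

lemma strip_integral_abs_le:
  fixes F :: "complex \<Rightarrow> real"
  assumes F: "continuous_on strip F" and le: "\<And>y. y \<in> {0..pi} \<Longrightarrow> \<bar>F (Complex x y)\<bar> \<le> B"
  shows "\<bar>integral {0..pi} (\<lambda>y. F (Complex x y))\<bar> \<le> pi * B"
proof -
  have "norm (integral {0..pi} (\<lambda>y. F (Complex x y))) \<le> integral {0..pi} (\<lambda>y. B)"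
    by (rule integral_norm_bound_integral[OF strip_integrable[OF F]]) (use le in auto)
  then show ?thesis by simp
qed

lemma strip_ftc:
  fixes F Fy :: "complex \<Rightarrow> real"
  assumes "\<And>y. y \<in> {0..pi} \<Longrightarrow> ((\<lambda>y. F (Complex x y)) has_real_derivative Fy (Complex x y)) (at y within {0..pi})"
  shows "integral {0..pi} (\<lambda>y. Fy (Complex x y)) = F (Complex x pi) - F (Complex x 0)"
  by (rule integral_unique, rule fundamental_theorem_of_calculus)
     (use assms in \<open>auto simp flip: has_real_derivative_iff_has_vector_derivative\<close>)

lemma box_integral_subset_le:
  assumes F: "continuous_on S F" and R: "\<And>x y. x \<in> {a..b} \<Longrightarrow> y \<in> {c..d} \<Longrightarrow> Complex x y \<in> S"
    and sub: "c \<le> c'" "d' \<le> d"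
    and nonneg: "\<And>x y. x \<in> {a..b} \<Longrightarrow> y \<in> {c..d} \<Longrightarrow> 0 \<le> F (Complex x y)"
  shows "box_integral a b c' d' F \<le> box_integral a b c d F"
  unfolding box_integral_def
proof (rule integral_subset_le)
  show "cbox (a, c') (b, d') \<subseteq> cbox (a, c) (b, d)" using sub by (auto simp: cbox_Pair_eq)
  show "(\<lambda>(x, y). F (Complex x y)) integrable_on cbox (a, c') (b, d')"
    by (rule integrable_box[OF F]) (use R sub in auto)
  show "(\<lambda>(x, y). F (Complex x y)) integrable_on cbox (a, c) (b, d)"
    by (rule integrable_box[OF F]) (use R in auto)
qed (use nonneg in \<open>auto simp: cbox_Pair_eq\<close>)

text \<open>The problem in the coordinate \<open>w = Ln z\<close>; the edges are the images of the
  positive and of the negative half axis. Both edge conditions are on \<open>Vy\<close> rather than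
  on an outward derivative, so turning the strip upside down exchanges \<open>b0\<close> and
  \<open>b1\<close> with a change of sign. \<open>decay\<close> is generalized over
  \<open>M\<close>: it says that \<open>V\<close> tends to minus infinity at both ends.\<close>

locale liouville_strip =
  fixes K b0 b1 :: real and V Vx Vy Vxx Vxy Vyx Vyy :: "complex \<Rightarrow> real"
  assumes C2: "C2_partials strip V Vx Vy Vxx Vxy Vyx Vyy"
    and pde: "w \<in> strip \<Longrightarrow> Vxx w + Vyy w = - 2 * K * exp (V w)"
    and bc0: "Vy (Complex x 0) = b0 * exp (V (Complex x 0) / 2)"
    and bc1: "Vy (Complex x pi) = b1 * exp (V (Complex x pi) / 2)"
    and decay: "\<exists>X. \<forall>w\<in>strip. X \<le> \<bar>Re w\<bar> \<longrightarrow> V w \<le> M"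
begin

lemmas cont = C2_partials_continuous[OF C2]

lemma der_x:
  assumes "y \<in> {0..pi}"
  shows "((\<lambda>x. V (Complex x y)) has_real_derivative Vx (Complex x y)) (at x)"
    and "((\<lambda>x. Vx (Complex x y)) has_real_derivative Vxx (Complex x y)) (at x)"
    and "((\<lambda>x. Vy (Complex x y)) has_real_derivative Vyx (Complex x y)) (at x)"
  using assms by (auto intro!: C2_partials_deriv_x[OF C2])

lemma der_y:
  assumes "y \<in> {0..pi}"
  shows "((\<lambda>y. V (Complex x y)) has_real_derivative Vy (Complex x y)) (at y within {0..pi})"
    and "((\<lambda>y. Vx (Complex x y)) has_real_derivative Vxy (Complex x y)) (at y within {0..pi})"
    and "((\<lambda>y. Vy (Complex x y)) has_real_derivative Vyy (Complex x y)) (at y within {0..pi})"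
  using assms by (auto intro!: C2_partials_deriv_y[OF C2])

lemma Vxy_eq_Vyx: "w \<in> strip \<Longrightarrow> Vxy w = Vyx w"
  using C2_partials_symmetric[OF C2, of "Re w - 1" "Re w + 1" 0 pi "Re w" "Im w"]
  by (auto simp: strip_def)

lemma bounded_above: "\<exists>C\<ge>0. \<forall>w\<in>strip. V w \<le> C"
proof -
  obtain X where X: "\<forall>w\<in>strip. X \<le> \<bar>Re w\<bar> \<longrightarrow> V w \<le> 0" using decay by blast
  let ?B = "cbox (Complex (- X) 0) (Complex X pi)"
  have "compact (V ` ?B)"
    by (intro compact_continuous_image continuous_on_subset[OF cont(1)]) (auto simp: in_cbox_complex_iff strip_def)
  then have "bounded (V ` ?B)" by (rule compact_imp_bounded)
  then obtain C where C: "\<And>u. u \<in> V ` ?B \<Longrightarrow> \<bar>u\<bar> \<le> C"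
    unfolding bounded_iff by auto
  have "V w \<le> \<bar>C\<bar>" if w: "w \<in> strip" for w
  proof (cases "X \<le> \<bar>Re w\<bar>")
    case True
    then show ?thesis using X w by fastforce
  next
    case False
    then have "w \<in> ?B" using w by (auto simp: in_cbox_complex_iff strip_def)
    then show ?thesis using C[of "V w"] by auto
  qed
  then show ?thesis by (intro exI[of _ "\<bar>C\<bar>"]) auto
qed

text \<open>From above \<open>V\<close> is bounded, and for negative \<open>t\<close> one has
  \<open>\<bar>t\<bar> * exp (t / 2) \<le> 2\<close>. One constant for all four quantities
  simplifies the estimates that follow.\<close>

lemma exp_bounds:
  obtains B where "0 \<le> B" "\<And>w. w \<in> strip \<Longrightarrow> exp (V w) \<le> B" "\<And>w. w \<in> strip \<Longrightarrow> exp (V w / 2) \<le> B"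
    "\<And>w. w \<in> strip \<Longrightarrow> \<bar>V w\<bar> * exp (V w) \<le> B" "\<And>w. w \<in> strip \<Longrightarrow> \<bar>V w\<bar> * exp (V w / 2) \<le> B"
proof -
  obtain C where C: "0 \<le> C" "\<And>w. w \<in> strip \<Longrightarrow> V w \<le> C" using bounded_above by blast
  have e1: "exp (V w / 2) \<le> exp C" "exp (V w) \<le> exp C" if "w \<in> strip" for w
    using C(2)[OF that] C(1) by auto
  have e2: "\<bar>V w\<bar> * exp (V w / 2) \<le> (C + 2) * exp C" if w: "w \<in> strip" for w
  proof (cases "0 \<le> V w")
    case True
    then show ?thesis using C(2)[OF w] e1[OF w] by (intro mult_mono) auto
  next
    case False
    have "- V w / 2 \<le> exp (- V w / 2)" using exp_ge_add_one_self[of "- V w / 2"] by linarith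
    then have "- V w / 2 * exp (V w / 2) \<le> exp (- V w / 2) * exp (V w / 2)" by (intro mult_right_mono) auto
    then have "\<bar>V w\<bar> * exp (V w / 2) \<le> 2" using False by (simp flip: exp_add)
    also have "2 * 1 \<le> (C + 2) * exp C" using C(1) by (intro mult_mono) auto
    finally show ?thesis by simp
  qed
  have e3: "\<bar>V w\<bar> * exp (V w) \<le> (C + 2) * exp C * exp C" if w: "w \<in> strip" for w
  proof -
    have "\<bar>V w\<bar> * exp (V w / 2) * exp (V w / 2) \<le> (C + 2) * exp C * exp C"
      by (rule mult_mono[OF e2[OF w] e1(1)[OF w]]) (use C(1) in auto)
    then show ?thesis by (simp add: mult.assoc flip: exp_add)
  qed
  have 1: "1 \<le> exp C" "exp C \<le> (C + 2) * exp C" using C(1) by auto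
  have "(C + 2) * exp C * 1 \<le> (C + 2) * exp C * exp C" using C(1) by (intro mult_left_mono) auto
  then have D: "(C + 2) * exp C \<le> (C + 2) * exp C * exp C" by simp
  show ?thesis
  proof (rule that)
    show "0 \<le> (C + 2) * exp C * exp C" using C(1) by simp
    fix w assume w: "w \<in> strip"
    show "exp (V w) \<le> (C + 2) * exp C * exp C" "exp (V w / 2) \<le> (C + 2) * exp C * exp C"
      using e1[OF w] 1 D by linarith+
    show "\<bar>V w\<bar> * exp (V w) \<le> (C + 2) * exp C * exp C" "\<bar>V w\<bar> * exp (V w / 2) \<le> (C + 2) * exp C * exp C"
      using e2[OF w] e3[OF w] D by linarith+
  qed
qed

text \<open>Controls the boundary terms left by integration by parts in \<open>y\<close>. The weight
  \<open>\<phi>\<close> will be 1, \<open>V\<close> and a cosine.\<close>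

lemma boundary_bound:
  assumes "\<And>w. w \<in> strip \<Longrightarrow> \<bar>\<phi> w\<bar> * exp (V w / 2) \<le> B"
  shows "\<bar>\<phi> (Complex x pi) * Vy (Complex x pi) - \<phi> (Complex x 0) * Vy (Complex x 0)\<bar> \<le> (\<bar>b0\<bar> + \<bar>b1\<bar>) * B"
proof -
  have "\<bar>b0\<bar> * (\<bar>\<phi> (Complex x 0)\<bar> * exp (V (Complex x 0) / 2)) \<le> \<bar>b0\<bar> * B"
    "\<bar>b1\<bar> * (\<bar>\<phi> (Complex x pi)\<bar> * exp (V (Complex x pi) / 2)) \<le> \<bar>b1\<bar> * B"
    by (intro mult_left_mono assms; simp)+
  moreover have "\<bar>\<phi> (Complex x 0) * Vy (Complex x 0)\<bar> = \<bar>b0\<bar> * (\<bar>\<phi> (Complex x 0)\<bar> * exp (V (Complex x 0) / 2))"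
    "\<bar>\<phi> (Complex x pi) * Vy (Complex x pi)\<bar> = \<bar>b1\<bar> * (\<bar>\<phi> (Complex x pi)\<bar> * exp (V (Complex x pi) / 2))"
    by (simp_all add: bc0 bc1 abs_mult)
  ultimately show ?thesis unfolding distrib_right by linarith
qed

text \<open>Integrating the equation over a cross section expresses the second derivative of the
  mean through \<open>exp V\<close> and the edge values of \<open>Vy\<close>, all of them
  bounded.\<close>

lemma mean_growth: "\<exists>C. \<forall>x. \<bar>integral {0..pi} (\<lambda>y. V (Complex x y))\<bar> \<le> C * (1 + x\<^sup>2)"
proof -
  obtain B where B: "0 \<le> B" "\<And>w. w \<in> strip \<Longrightarrow> exp (V w) \<le> B" "\<And>w. w \<in> strip \<Longrightarrow> exp (V w / 2) \<le> B"
    using exp_bounds by metis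
  let ?m = "\<lambda>F x. integral {0..pi} (\<lambda>y. F (Complex x y))"
  have "\<bar>?m Vxx x\<bar> \<le> pi * (2 * \<bar>K\<bar> * B) + (\<bar>b0\<bar> + \<bar>b1\<bar>) * B" for x
  proof -
    have c: "continuous_on strip (\<lambda>w. - 2 * K * exp (V w))" by (intro continuous_intros cont)
    have "?m Vxx x = integral {0..pi} (\<lambda>y. - 2 * K * exp (V (Complex x y)) - Vyy (Complex x y))"
      by (rule integral_cong) (use pde in \<open>auto simp: algebra_simps eq_diff_eq\<close>)
    also have "\<dots> = ?m (\<lambda>w. - 2 * K * exp (V w)) x - ?m Vyy x"
      using strip_integrable[OF c, of x] strip_integrable[OF cont(7), of x]
      by (rule Henstock_Kurzweil_Integration.integral_diff)
    also have "?m Vyy x = 1 * Vy (Complex x pi) - 1 * Vy (Complex x 0)"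
      using strip_ftc[OF der_y(3)] by simp
    finally have "?m Vxx x = ?m (\<lambda>w. - 2 * K * exp (V w)) x - (1 * Vy (Complex x pi) - 1 * Vy (Complex x 0))" .
    moreover have "\<bar>?m (\<lambda>w. - 2 * K * exp (V w)) x\<bar> \<le> pi * (2 * \<bar>K\<bar> * B)"
      by (rule strip_integral_abs_le[OF c]) (use B in \<open>auto simp: abs_mult intro!: mult_left_mono\<close>)
    moreover have "\<bar>1 * Vy (Complex x pi) - 1 * Vy (Complex x 0)\<bar> \<le> (\<bar>b0\<bar> + \<bar>b1\<bar>) * B"
      by (rule boundary_bound) (use B in auto)
    ultimately show ?thesis by linarith
  qed
  with quadratic_growth[OF strip_integral_deriv[OF cont(1,2) der_x(1)] strip_integral_deriv[OF cont(2,4) der_x(2)]]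
  show ?thesis by blast
qed

text \<open>The function \<open>C0 - V\<close> is nonnegative and has one-sided bounds on its
  Laplacian and edge derivative, so the mean value inequality bounds it by its integral over a box
  of radius 1, which \<open>mean_growth\<close> controls. That inequality tolerates a single edge;
  below height \<open>pi / 2\<close> such a box stays under the upper one.\<close>

lemma lower_bound_half:
  "\<exists>C. \<forall>x y. y \<in> {0..pi / 2} \<longrightarrow> - V (Complex x y) \<le> C * (1 + x\<^sup>2)"
proof -
  obtain C0 where C0: "0 \<le> C0" "\<And>w. w \<in> strip \<Longrightarrow> V w \<le> C0" using bounded_above by blast
  obtain B where B: "0 \<le> B" "\<And>w. w \<in> strip \<Longrightarrow> exp (V w) \<le> B" "\<And>w. w \<in> strip \<Longrightarrow> exp (V w / 2) \<le> B"
    using exp_bounds by metis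
  obtain Cm where Cm: "\<And>x. \<bar>integral {0..pi} (\<lambda>y. V (Complex x y))\<bar> \<le> Cm * (1 + x\<^sup>2)" using mean_growth by blast
  have Cm0: "0 \<le> Cm" using order_trans[OF abs_ge_zero Cm[of 0]] by simp
  let ?f = "\<lambda>w. C0 - V w"
  have f: "C2_partials strip ?f (\<lambda>z. - 1 * Vx z) (\<lambda>z. - 1 * Vy z) (\<lambda>z. 0 * Vx z ^ 2 + - 1 * Vxx z)
      (\<lambda>z. 0 * Vx z * Vy z + - 1 * Vxy z) (\<lambda>z. 0 * Vx z * Vy z + - 1 * Vyx z) (\<lambda>z. 0 * Vy z ^ 2 + - 1 * Vyy z)"
    by (rule C2_partials_compose[OF C2]) (auto intro!: derivative_eq_intros)
  note cf = C2_partials_continuous(1)[OF f]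
  define C1 C2' where "C1 = 2 * \<bar>K\<bar> * B" and "C2' = \<bar>b0\<bar> * B"
  have C12: "0 \<le> C1" "0 \<le> C2'" using B by (auto simp: C1_def C2'_def)
  \<comment> \<open>\<open>64 = 16 * 2 * 2\<close> collects the factors of the mean value inequality
    and the width 2 of the box; 3 comes from \<open>1 + x'\<^sup>2 \<le> 3 * (1 + x\<^sup>2)\<close>
    for \<open>x'\<close> within distance 1 of \<open>x\<close>.\<close>
  define A where "A = 64 * (C0 * pi + 3 * Cm) + 8 * C1 + 8 * C2'"
  have "- V (Complex x y) \<le> A * (1 + x\<^sup>2)" if y: "y \<in> {0..pi / 2}" for x y
  proof -
    define c where "c = max 0 (y - 1)"
    have pi: "y + 1 \<le> pi" using y pi_gt3 by auto
    have R: "Complex x' y' \<in> strip" if "y' \<in> {c..y + 1}" for x' y'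
      using that pi by (auto simp: c_def)
    have c: "c \<le> y" using y by (auto simp: c_def)
    have "?f (Complex x y) \<le> 16 * (2 / 1\<^sup>2 * box_integral (x - 1) (x + 1) c (y + 1) ?f + C1 * 1\<^sup>2 / 2 + C2' * 1 / 2)"
    proof (rule mean_value_inequality[OF f R _ c C12])
      fix x' y' assume "y' \<in> {c..y + 1}"
      then have w: "Complex x' y' \<in> strip" by (rule R)
      show "0 \<le> ?f (Complex x' y')" using C0(2)[OF w] by simp
      have "- K * exp (V (Complex x' y')) \<le> \<bar>K\<bar> * B" using B(2)[OF w] by (intro mult_mono) auto
      then show "- C1 \<le> 0 * (Vx (Complex x' y'))\<^sup>2 + - 1 * Vxx (Complex x' y') + (0 * (Vy (Complex x' y'))\<^sup>2 + - 1 * Vyy (Complex x' y'))"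
        using pde[OF w] by (simp add: C1_def)
    next
      fix x' assume "y - 1 < c"
      then have c0: "c = 0" by (auto simp: c_def)
      have "b0 * exp (V (Complex x' 0) / 2) \<le> \<bar>b0\<bar> * B" using B by (intro mult_mono) auto
      then show "- C2' \<le> - 1 * Vy (Complex x' c)" by (simp add: c0 bc0 C2'_def)
    qed auto
    also have "box_integral (x - 1) (x + 1) c (y + 1) ?f \<le> box_integral (x - 1) (x + 1) 0 pi ?f"
      by (rule box_integral_subset_le[OF cf]) (use C0 pi in \<open>auto simp: c_def\<close>)
    also have "\<dots> = integral {x - 1..x + 1} (\<lambda>x. integral {0..pi} (\<lambda>y. ?f (Complex x y)))"
      using integral_prod_continuous[OF continuous_on_slice(1)[OF cf, of "x - 1" "x + 1" 0 pi]]
      unfolding box_integral_def by simp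
    also have "\<dots> \<le> integral {x - 1..x + 1} (\<lambda>x'. C0 * pi + Cm * (3 * (1 + x\<^sup>2)))"
    proof (rule integral_le)
      have "continuous_on UNIV (\<lambda>x. integral (cbox 0 pi) (\<lambda>y. ?f (Complex x y)))"
        by (rule integral_continuous_on_param[OF continuous_on_strip_slice(1)[OF cf]])
      then show "(\<lambda>x. integral {0..pi} (\<lambda>y. ?f (Complex x y))) integrable_on {x - 1..x + 1}"
        by (auto intro!: integrable_continuous_interval elim: continuous_on_subset)
      fix x' assume x': "x' \<in> {x - 1..x + 1}"
      have "integral {0..pi} (\<lambda>y. ?f (Complex x' y)) = integral {0..pi} (\<lambda>y. C0) - integral {0..pi} (\<lambda>y. V (Complex x' y))"
        by (rule Henstock_Kurzweil_Integration.integral_diff) (auto intro: strip_integrable cont)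
      also have "\<dots> \<le> C0 * pi + Cm * (1 + x'\<^sup>2)" using Cm[of x'] by (simp add: mult.commute)
      also have "1 + x'\<^sup>2 \<le> 3 * (1 + x\<^sup>2)"
      proof -
        have "x'\<^sup>2 \<le> 2 * x\<^sup>2 + 2 * (x' - x)\<^sup>2"
          using zero_le_power2[of "2 * x - x'"] by (simp add: power2_eq_square algebra_simps)
        moreover have "(x' - x)\<^sup>2 \<le> 1" using x' by (simp add: abs_square_le_1 abs_le_iff)
        ultimately have "x'\<^sup>2 \<le> 2 * x\<^sup>2 + 2" by linarith
        moreover have "0 \<le> x\<^sup>2" by simp
        ultimately show ?thesis unfolding distrib_left by linarith
      qed
      then have "C0 * pi + Cm * (1 + x'\<^sup>2) \<le> C0 * pi + Cm * (3 * (1 + x\<^sup>2))"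
        using Cm0 by (intro add_left_mono mult_left_mono)
      finally show "integral {0..pi} (\<lambda>y. ?f (Complex x' y)) \<le> C0 * pi + Cm * (3 * (1 + x\<^sup>2))" .
    qed auto
    also have "\<dots> = 2 * (C0 * pi + Cm * (3 * (1 + x\<^sup>2)))" by simp
    finally have "- V (Complex x y) \<le> 64 * (C0 * pi + Cm * (3 * (1 + x\<^sup>2))) + 8 * C1 + 8 * C2'" using C0 by simp
    also have "\<dots> \<le> A * (1 + x\<^sup>2)"
    proof -
      have "0 \<le> (64 * (C0 * pi) + 8 * C1 + 8 * C2') * x\<^sup>2" using C0 C12 by (intro mult_nonneg_nonneg add_nonneg_nonneg) auto
      then show ?thesis by (simp add: A_def algebra_simps)
    qed
    finally show ?thesis .
  qed
  then show ?thesis by blast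
qed

end

lemma C2_partials_flip:
  assumes C2: "C2_partials strip V Vx Vy Vxx Vxy Vyx Vyy"
  defines "\<rho> \<equiv> \<lambda>w. Complex (Re w) (pi - Im w)"
  shows "C2_partials strip (\<lambda>w. V (\<rho> w)) (\<lambda>w. Vx (\<rho> w)) (\<lambda>w. - Vy (\<rho> w)) (\<lambda>w. Vxx (\<rho> w))
    (\<lambda>w. - Vxy (\<rho> w)) (\<lambda>w. - Vyx (\<rho> w)) (\<lambda>w. Vyy (\<rho> w))"
proof -
  have \<rho>: "\<rho> w = cnj w + Complex 0 pi" for w
    by (simp add: \<rho>_def complex_eq_iff)
  have \<rho>_strip: "\<rho> w \<in> strip" if "w \<in> strip" for w using that by (simp add: \<rho>_def strip_def)
  have d\<rho>: "(\<rho> has_derivative cnj) (at w within strip)" for w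
    unfolding \<rho> by (auto intro!: derivative_eq_intros bounded_linear_imp_has_derivative bounded_linear_cnj)
  have d: "((\<lambda>w. f (\<rho> w)) has_derivative (\<lambda>h. a * Re h + - b * Im h)) (at w within strip)"
    if "\<And>z. z \<in> strip \<Longrightarrow> (f has_derivative (\<lambda>h. p z * Re h + q z * Im h)) (at z within strip)" "w \<in> strip"
      "a = p (\<rho> w)" "b = q (\<rho> w)" for f :: "complex \<Rightarrow> real" and p q a b w
  proof -
    have "(f has_derivative (\<lambda>h. p (\<rho> w) * Re h + q (\<rho> w) * Im h)) (at (\<rho> w) within \<rho> ` strip)"
      by (rule has_derivative_subset[OF that(1)[OF \<rho>_strip[OF that(2)]]]) (use \<rho>_strip in auto)
    from diff_chain_within[OF d\<rho> this] show ?thesis using that by (simp add: o_def)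
  qed
  have c: "continuous_on strip (\<lambda>w. f (\<rho> w))" if "continuous_on strip f" for f :: "complex \<Rightarrow> real"
    by (rule continuous_on_compose2[OF that]) (auto intro: \<rho>_strip has_derivative_continuous_on[OF d\<rho>])
  have D: "z \<in> strip \<Longrightarrow> (V has_derivative (\<lambda>h. Vx z * Re h + Vy z * Im h)) (at z within strip)"
    "z \<in> strip \<Longrightarrow> (Vx has_derivative (\<lambda>h. Vxx z * Re h + Vxy z * Im h)) (at z within strip)"
    "z \<in> strip \<Longrightarrow> (Vy has_derivative (\<lambda>h. Vyx z * Re h + Vyy z * Im h)) (at z within strip)" for z
    using C2 by (auto simp: C2_partials_def)
  show ?thesis
    unfolding C2_partials_def
  proof (intro conjI ballI)
    fix w assume w: "w \<in> strip"
    show "((\<lambda>w. V (\<rho> w)) has_derivative (\<lambda>h. Vx (\<rho> w) * Re h + - Vy (\<rho> w) * Im h)) (at w within strip)"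
      by (rule d[OF D(1) w refl refl])
    show "((\<lambda>w. Vx (\<rho> w)) has_derivative (\<lambda>h. Vxx (\<rho> w) * Re h + - Vxy (\<rho> w) * Im h)) (at w within strip)"
      by (rule d[OF D(2) w refl refl])
    show "((\<lambda>w. - Vy (\<rho> w)) has_derivative (\<lambda>h. - Vyx (\<rho> w) * Re h + Vyy (\<rho> w) * Im h)) (at w within strip)"
      using has_derivative_minus[OF d[OF D(3) w refl refl]] by simp
  qed (intro continuous_intros c C2_partials_continuous[OF C2])+
qed

context liouville_strip
begin

lemma flip: "liouville_strip K (- b1) (- b0) (\<lambda>w. V (Complex (Re w) (pi - Im w))) (\<lambda>w. Vx (Complex (Re w) (pi - Im w)))
   (\<lambda>w. - Vy (Complex (Re w) (pi - Im w))) (\<lambda>w. Vxx (Complex (Re w) (pi - Im w))) (\<lambda>w. - Vxy (Complex (Re w) (pi - Im w)))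
   (\<lambda>w. - Vyx (Complex (Re w) (pi - Im w))) (\<lambda>w. Vyy (Complex (Re w) (pi - Im w)))"
proof
  show "\<exists>X. \<forall>w\<in>strip. X \<le> \<bar>Re w\<bar> \<longrightarrow> V (Complex (Re w) (pi - Im w)) \<le> M" for M
  proof -
    obtain X where "\<forall>w\<in>strip. X \<le> \<bar>Re w\<bar> \<longrightarrow> V w \<le> M" using decay by blast
    then show ?thesis by (intro exI[of _ X]) (auto simp: strip_def)
  qed
qed (use C2_partials_flip[OF C2] pde bc0 bc1 in \<open>auto simp: strip_def\<close>)

lemma abs_bound: "\<exists>C. \<forall>w\<in>strip. \<bar>V w\<bar> \<le> C * (1 + (Re w)\<^sup>2)"
proof -
  obtain C1 where C1: "\<And>x y. y \<in> {0..pi / 2} \<Longrightarrow> - V (Complex x y) \<le> C1 * (1 + x\<^sup>2)"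
    using lower_bound_half by blast
  obtain C2 where C2: "\<And>x y. y \<in> {0..pi / 2} \<Longrightarrow> - V (Complex x (pi - y)) \<le> C2 * (1 + x\<^sup>2)"
    using liouville_strip.lower_bound_half[OF flip] by auto
  obtain C0 where C0: "0 \<le> C0" "\<And>w. w \<in> strip \<Longrightarrow> V w \<le> C0" using bounded_above by blast
  have "\<bar>V w\<bar> \<le> (C0 + \<bar>C1\<bar> + \<bar>C2\<bar>) * (1 + (Re w)\<^sup>2)" if w: "w \<in> strip" for w
  proof -
    have "- V w \<le> C1 * (1 + (Re w)\<^sup>2) \<or> - V w \<le> C2 * (1 + (Re w)\<^sup>2)"
      using C1[of "Im w" "Re w"] C2[of "pi - Im w" "Re w"] w by (cases "Im w \<le> pi / 2") (auto simp: strip_def)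
    moreover have "C1 * (1 + (Re w)\<^sup>2) \<le> \<bar>C1\<bar> * (1 + (Re w)\<^sup>2)" "C2 * (1 + (Re w)\<^sup>2) \<le> \<bar>C2\<bar> * (1 + (Re w)\<^sup>2)"
      "0 \<le> \<bar>C1\<bar> * (1 + (Re w)\<^sup>2)" "0 \<le> \<bar>C2\<bar> * (1 + (Re w)\<^sup>2)"
      by (intro mult_right_mono mult_nonneg_nonneg; simp)+
    moreover have "C0 * 1 \<le> C0 * (1 + (Re w)\<^sup>2)" using C0(1) by (intro mult_left_mono) auto
    ultimately show ?thesis unfolding distrib_right[of _ _ "1 + (Re w)\<^sup>2"]
      using C0(1) C0(2)[OF w] by (elim disjE; linarith)
  qed
  then show ?thesis by blast
qed

text \<open>\<open>E\<close> is the integral of \<open>V\<^sup>2\<close> over a cross section, with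
  second derivative twice the integral of \<open>Vx\<^sup>2 + V * Vxx\<close>. Replacing
  \<open>Vxx\<close> by the equation and integrating \<open>V * Vyy\<close> by parts produces the
  full gradient. In the other terms \<open>V\<close> is multiplied by \<open>exp V\<close> or, on
  the edges, by \<open>exp (V / 2)\<close>, so they are bounded.\<close>

lemma energy:
  obtains E E' E'' b C where "\<And>x. (E has_real_derivative E' x) (at x)" "\<And>x. (E' has_real_derivative E'' x) (at x)"
    "\<And>x. 2 * integral {0..pi} (\<lambda>y. (Vx (Complex x y))\<^sup>2 + (Vy (Complex x y))\<^sup>2) - b \<le> E'' x"
    "\<And>x. E x \<le> C * (1 + x\<^sup>2)\<^sup>2"
proof -
  let ?m = "\<lambda>F x. integral {0..pi} (\<lambda>y. F (Complex x y))"
  define F0 F1 F2 where "F0 = (\<lambda>w. (V w)\<^sup>2)" and "F1 = (\<lambda>w. 2 * V w * Vx w)"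
    and "F2 = (\<lambda>w. 2 * ((Vx w)\<^sup>2 + V w * Vxx w))"
  have c: "continuous_on strip F0" "continuous_on strip F1" "continuous_on strip F2"
    unfolding F0_def F1_def F2_def by (intro continuous_intros cont)+
  obtain B where B: "0 \<le> B" "\<And>w. w \<in> strip \<Longrightarrow> \<bar>V w\<bar> * exp (V w) \<le> B" "\<And>w. w \<in> strip \<Longrightarrow> \<bar>V w\<bar> * exp (V w / 2) \<le> B"
    using exp_bounds by metis
  obtain C where C: "\<And>w. w \<in> strip \<Longrightarrow> \<bar>V w\<bar> \<le> C * (1 + (Re w)\<^sup>2)" using abs_bound by blast
  show ?thesis
  proof (rule that)
    show "(?m F0 has_real_derivative ?m F1 x) (at x)" for x
      by (rule strip_integral_deriv[OF c(1,2)]) (auto simp: F0_def F1_def intro!: derivative_eq_intros der_x)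
    show "(?m F1 has_real_derivative ?m F2 x) (at x)" for x
      by (rule strip_integral_deriv[OF c(2,3)])
        (auto simp: F1_def F2_def power2_eq_square algebra_simps intro!: derivative_eq_intros der_x)
    show "?m F0 x \<le> pi * C\<^sup>2 * (1 + x\<^sup>2)\<^sup>2" for x
    proof -
      have "\<bar>?m F0 x\<bar> \<le> pi * (C * (1 + x\<^sup>2))\<^sup>2"
      proof (rule strip_integral_abs_le[OF c(1)])
        fix y assume "y \<in> {0..pi}"
        then have "\<bar>V (Complex x y)\<bar> \<le> C * (1 + x\<^sup>2)" using C[of "Complex x y"] by simp
        then have "\<bar>V (Complex x y)\<bar>\<^sup>2 \<le> (C * (1 + x\<^sup>2))\<^sup>2" by (rule power_mono) simp
        then show "\<bar>F0 (Complex x y)\<bar> \<le> (C * (1 + x\<^sup>2))\<^sup>2" by (simp add: F0_def)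
      qed
      then show ?thesis by (simp add: power_mult_distrib)
    qed
    show "2 * ?m (\<lambda>w. (Vx w)\<^sup>2 + (Vy w)\<^sup>2) x - 2 * (pi * (2 * \<bar>K\<bar> * B) + (\<bar>b0\<bar> + \<bar>b1\<bar>) * B) \<le> ?m F2 x" for x
    proof -
      define D H L where "D = (\<lambda>w. (Vx w)\<^sup>2 + (Vy w)\<^sup>2)" and "H = (\<lambda>w. - 2 * K * (V w * exp (V w)))"
        and "L = (\<lambda>w. Vy w * Vy w + V w * Vyy w)"
      have c: "continuous_on strip D" "continuous_on strip H" "continuous_on strip L"
        unfolding D_def H_def L_def by (intro continuous_intros cont)+
      have i: "((\<lambda>y. D (Complex x y)) has_integral ?m D x) {0..pi}" "((\<lambda>y. H (Complex x y)) has_integral ?m H x) {0..pi}"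
        "((\<lambda>y. L (Complex x y)) has_integral ?m L x) {0..pi}"
        by (rule integrable_integral, rule strip_integrable, rule c)+
      have "?m F2 x = integral {0..pi} (\<lambda>y. 2 * (D (Complex x y) + H (Complex x y) - L (Complex x y)))"
      proof (rule integral_cong)
        fix y assume "y \<in> {0..pi}"
        then have e: "Vxx (Complex x y) = - 2 * K * exp (V (Complex x y)) - Vyy (Complex x y)"
          using pde[of "Complex x y"] by simp
        show "F2 (Complex x y) = 2 * (D (Complex x y) + H (Complex x y) - L (Complex x y))"
          unfolding F2_def D_def H_def L_def e by (simp add: algebra_simps power2_eq_square)
      qed
      also have "\<dots> = 2 * (?m D x + ?m H x - ?m L x)"
        by (rule integral_unique) (intro has_integral_mult_right has_integral_add has_integral_diff i)
      finally have 1: "?m F2 x = 2 * (?m D x + ?m H x - ?m L x)" .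
      have "?m L x = V (Complex x pi) * Vy (Complex x pi) - V (Complex x 0) * Vy (Complex x 0)"
        by (rule strip_ftc[where F = "\<lambda>w. V w * Vy w"])
           (auto simp: L_def algebra_simps intro!: derivative_eq_intros der_y)
      then have "\<bar>?m L x\<bar> \<le> (\<bar>b0\<bar> + \<bar>b1\<bar>) * B"
        using boundary_bound[of V B x] B by simp
      moreover have "\<bar>?m H x\<bar> \<le> pi * (2 * \<bar>K\<bar> * B)"
        by (rule strip_integral_abs_le[OF c(2)]) (use B in \<open>auto simp: H_def abs_mult mult.assoc intro!: mult_left_mono\<close>)
      moreover have "\<bar>?m L x\<bar> \<le> (\<bar>b0\<bar> + \<bar>b1\<bar>) * B \<Longrightarrow> \<bar>?m H x\<bar> \<le> pi * (2 * \<bar>K\<bar> * B) \<Longrightarrow>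
          2 * ?m D x - 2 * (pi * (2 * \<bar>K\<bar> * B) + (\<bar>b0\<bar> + \<bar>b1\<bar>) * B) \<le> ?m F2 x"
      proof -
        have "\<bar>l\<bar> \<le> p \<Longrightarrow> \<bar>h\<bar> \<le> q \<Longrightarrow> 2 * d - 2 * (q + p) \<le> 2 * (d + h - l)" for d h l p q :: real
          unfolding abs_le_iff by simp
        then show "\<bar>?m L x\<bar> \<le> (\<bar>b0\<bar> + \<bar>b1\<bar>) * B \<Longrightarrow> \<bar>?m H x\<bar> \<le> pi * (2 * \<bar>K\<bar> * B) \<Longrightarrow>
          2 * ?m D x - 2 * (pi * (2 * \<bar>K\<bar> * B) + (\<bar>b0\<bar> + \<bar>b1\<bar>) * B) \<le> ?m F2 x"
          unfolding 1 by blast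
      qed
      ultimately show ?thesis by (simp add: D_def)
    qed
  qed
qed

end

section \<open>Completeness of cosines and sines\<close>

text \<open>The product formula turns cosine moments into moments against powers of
  \<open>cos y\<close>. Since \<open>cos\<close> is injective on \<open>{0..pi}\<close>, Weierstrass
  approximation of \<open>g (arccos t)\<close> makes polynomials in \<open>cos y\<close> uniformly
  close to \<open>g\<close>, and the integral of \<open>g\<^sup>2\<close> must vanish.\<close>

lemma cos_moments_zero:
  fixes g :: "real \<Rightarrow> real"
  assumes g: "continuous_on {0..pi} g"
    and 0: "\<And>n::nat. integral {0..pi} (\<lambda>y. g y * cos (real n * y)) = 0"
    and y: "y \<in> {0..pi}"
  shows "g y = 0"
proof -
  have int: "(\<lambda>y. g y * h y) integrable_on {0..pi}" if "continuous_on UNIV h" for h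
    by (intro integrable_continuous_interval continuous_intros g continuous_on_subset[OF that]) auto
  have pow: "integral {0..pi} (\<lambda>y. g y * (cos y ^ m * cos (real n * y))) = 0" for m n
  proof (induction m arbitrary: n)
    case 0
    then show ?case using assms(2) by simp
  next
    case (Suc m)
    \<comment> \<open>For \<open>n = 0\<close> the lower frequency is \<open>- 1\<close>; cosine is
      even, so 1 takes its place, whereas subtraction on \<open>nat\<close> would give 0.\<close>
    have prod: "cos y * cos (real n * y) = (cos (real (Suc n) * y) + cos (real (if n = 0 then 1 else n - 1) * y)) / 2" for y
      by (cases n) (auto simp: cos_times_cos algebra_simps)
    have "(\<lambda>y. g y * (cos y ^ Suc m * cos (real n * y))) =
        (\<lambda>y. (1 / 2) * (g y * (cos y ^ m * cos (real (Suc n) * y)))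
          + (1 / 2) * (g y * (cos y ^ m * cos (real (if n = 0 then 1 else n - 1) * y))))"
      (is "?l = (\<lambda>y. (1 / 2) * ?p y + (1 / 2) * ?q y)")
    proof
      fix y
      have "?l y = g y * cos y ^ m * (cos y * cos (real n * y))" by simp
      then show "?l y = (1 / 2) * ?p y + (1 / 2) * ?q y" unfolding prod by (simp add: algebra_simps)
    qed
    moreover have "((\<lambda>y. g y * (cos y ^ m * cos (real j * y))) has_integral 0) {0..pi}" for j :: nat
    proof -
      have "(\<lambda>y. g y * (cos y ^ m * cos (real j * y))) integrable_on {0..pi}"
        by (rule int) (intro continuous_intros)
      then show ?thesis unfolding has_integral_iff using Suc.IH by simp
    qed
    then have pq: "(?p has_integral 0) {0..pi}" "(?q has_integral 0) {0..pi}" by blast+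
    from has_integral_add[OF has_integral_mult_right[OF pq(1), of "1 / 2"] has_integral_mult_right[OF pq(2), of "1 / 2"]]
    have "((\<lambda>y. (1 / 2) * ?p y + (1 / 2) * ?q y) has_integral 0) {0..pi}" by simp
    ultimately show ?case using integral_unique by metis
  qed
  have poly: "((\<lambda>y. g y * p (cos y)) has_integral 0) {0..pi}" if "real_polynomial_function p" for p
  proof -
    obtain a and n :: nat where p: "p = (\<lambda>x. \<Sum>i\<le>n. a i * x ^ i)"
      using \<open>real_polynomial_function p\<close> unfolding real_polynomial_function_iff_sum by blast
    have "((\<lambda>y. g y * cos y ^ i) has_integral 0) {0..pi}" for i
      using pow[of i 0] by (auto simp: has_integral_iff intro!: int continuous_intros)
    then have "((\<lambda>y. \<Sum>i\<le>n. a i * (g y * cos y ^ i)) has_integral (\<Sum>i\<le>n. a i * 0)) {0..pi}"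
      by (intro has_integral_sum has_integral_mult_right) auto
    then show ?thesis by (simp add: p sum_distrib_left mult_ac)
  qed
  have "bounded (g ` {0..pi})"
    by (intro compact_imp_bounded compact_continuous_image g) auto
  then obtain M where "\<forall>u \<in> g ` {0..pi}. norm u \<le> M"
    unfolding bounded_iff by blast
  then have M: "\<bar>g y\<bar> \<le> M" if "y \<in> {0..pi}" for y
    using that by auto
  have M0: "0 \<le> M" using M[of 0] by simp
  have sq: "(\<lambda>y. g y * g y) integrable_on {0..pi}"
    by (intro integrable_continuous_interval continuous_intros g)
  have "integral {0..pi} (\<lambda>y. g y * g y) \<le> e" if e: "0 < e" for e
  proof -
    \<comment> \<open>Makes \<open>pi * (M + 1) * d = e\<close>; the summand 1 avoids division by
      zero.\<close>
    define d where "d = e / (pi * (M + 1))"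
    have d: "0 < d" using e M0 by (simp add: d_def)
    have "continuous_on {-1..1} (\<lambda>t. g (arccos t))"
      by (rule continuous_on_compose2[OF g continuous_on_arccos']) (auto simp: arccos_lbound arccos_ubound)
    then obtain p where p: "real_polynomial_function p" "\<And>t. t \<in> {-1..1} \<Longrightarrow> \<bar>g (arccos t) - p t\<bar> < d"
      using Stone_Weierstrass_real_polynomial_function[of "{-1..1}" _ d] d by auto
    have "((\<lambda>y. g y * g y - g y * p (cos y)) has_integral integral {0..pi} (\<lambda>y. g y * g y) - 0) {0..pi}"
      by (intro has_integral_diff integrable_integral sq poly p)
    then have "integral {0..pi} (\<lambda>y. g y * g y) \<le> integral {0..pi} (\<lambda>y. M * d)"
    unfolding diff_0_right
    proof (rule has_integral_le)
      show "((\<lambda>y. M * d) has_integral integral {0..pi} (\<lambda>y. M * d)) {0..pi}"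
        by (intro integrable_integral) auto
      fix y :: real assume y: "y \<in> {0..pi}"
      have "\<bar>g y - p (cos y)\<bar> \<le> d" using p(2)[of "cos y"] y by (simp add: arccos_cos)
      then have "\<bar>g y\<bar> * \<bar>g y - p (cos y)\<bar> \<le> M * d" using M[OF y] by (intro mult_mono) auto
      then show "g y * g y - g y * p (cos y) \<le> M * d"
        unfolding abs_mult[symmetric] right_diff_distrib by linarith
    qed
    also have "\<dots> = pi * (M * d)" by simp
    also have "\<dots> \<le> pi * ((M + 1) * d)" using d by (intro mult_left_mono mult_right_mono) auto
    also have "\<dots> = e" using M0 by (simp add: d_def)
    finally show ?thesis .
  qed
  then have "integral {0..pi} (\<lambda>y. g y * g y) \<le> 0"
    by (intro field_le_epsilon[of "integral {0..pi} (\<lambda>y. g y * g y)" 0]) simp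
  moreover have "0 \<le> integral {0..pi} (\<lambda>y. g y * g y)"
    by (rule integral_nonneg[OF sq]) simp
  ultimately have "integral {0..pi} (\<lambda>y. g y * g y) = 0" by simp
  moreover have "continuous_on {0..pi} (\<lambda>y. g y * g y)" by (intro continuous_intros g)
  ultimately have "\<forall>y\<in>{0..pi}. g y * g y = 0"
    using integral_eq_0_iff[of 0 pi "\<lambda>y. g y * g y"] by (metis pi_gt_zero zero_le_square)
  then show ?thesis using y by auto
qed

text \<open>Subtracting the mean kills the zeroth moment and leaves the others unchanged, because
  cosines of positive integer frequency integrate to zero.\<close>

lemma cos_moments_const:
  fixes g :: "real \<Rightarrow> real"
  assumes g: "continuous_on {0..pi} g"
    and 0: "\<And>n::nat. 0 < n \<Longrightarrow> integral {0..pi} (\<lambda>y. g y * cos (real n * y)) = 0"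
    and y: "y \<in> {0..pi}"
  shows "g y = integral {0..pi} g / pi"
proof -
  define c where "c = integral {0..pi} g / pi"
  have "g y - c = 0"
  proof (rule cos_moments_zero[OF _ _ y])
    show "continuous_on {0..pi} (\<lambda>y. g y - c)" by (intro continuous_intros g)
    show "integral {0..pi} (\<lambda>y. (g y - c) * cos (real n * y)) = 0" for n :: nat
    proof (cases "n = 0")
      case True
      have "integral {0..pi} (\<lambda>y. g y - c) = integral {0..pi} g - integral {0..pi} (\<lambda>y. c)"
        by (intro Henstock_Kurzweil_Integration.integral_diff integrable_continuous_interval g) auto
      then show ?thesis using True by (simp add: c_def)
    next
      case False
      have "((\<lambda>y. cos (real n * y)) has_integral sin (real n * pi) / real n - sin (real n * 0) / real n) {0..pi}"
        by (rule fundamental_theorem_of_calculus)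
           (use False in \<open>auto intro!: derivative_eq_intros simp flip: has_real_derivative_iff_has_vector_derivative\<close>)
      then have 1: "((\<lambda>y. cos (real n * y)) has_integral 0) {0..pi}"
        by (simp add: sin_npi)
      have "((\<lambda>y. g y * cos (real n * y)) has_integral 0) {0..pi}"
        using 0[of n] False by (auto simp: has_integral_iff intro!: integrable_continuous_interval continuous_intros g)
      from has_integral_diff[OF this has_integral_mult_right[OF 1, of c]]
      show ?thesis by (auto simp: left_diff_distrib intro: integral_unique)
    qed
  qed
  then show ?thesis by (simp add: c_def)
qed

text \<open>\<open>2 * sin y * cos (n * y)\<close> is a difference of two sines, so
  \<open>g y * sin y\<close> has vanishing cosine moments. Cancelling \<open>sin y\<close>
  afterwards costs the end points.\<close>

lemma sin_moments_zero:
  fixes g :: "real \<Rightarrow> real"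
  assumes g: "continuous_on {0..pi} g"
    and 0: "\<And>n::nat. 0 < n \<Longrightarrow> integral {0..pi} (\<lambda>y. g y * sin (real n * y)) = 0"
    and y: "0 < y" "y < pi"
  shows "g y = 0"
proof -
  have h: "((\<lambda>y. g y * sin (real n * y)) has_integral 0) {0..pi}" for n :: nat
    using 0[of n] by (cases "n = 0") (auto simp: has_integral_iff intro!: integrable_continuous_interval continuous_intros g)
  have "g y * sin y = 0"
  proof (rule cos_moments_zero[where g = "\<lambda>y. g y * sin y"])
    show "continuous_on {0..pi} (\<lambda>y. g y * sin y)" by (intro continuous_intros g)
    fix n :: nat
    show "integral {0..pi} (\<lambda>y. g y * sin y * cos (real n * y)) = 0"
    proof (cases n)
      case 0
      then show ?thesis using h[of 1] by (auto intro: integral_unique)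
    next
      case (Suc k)
      have "(\<lambda>y. g y * sin y * cos (real n * y)) = (\<lambda>y. 1 / 2 * (g y * sin (real (Suc n) * y)) - 1 / 2 * (g y * sin (real k * y)))"
      proof
        fix y
        have e: "real (Suc n) * y = real n * y + y" "real k * y = real n * y - y"
          by (simp_all add: Suc algebra_simps)
        show "g y * sin y * cos (real n * y) = 1 / 2 * (g y * sin (real (Suc n) * y)) - 1 / 2 * (g y * sin (real k * y))"
          unfolding e sin_add sin_diff by (simp add: field_simps)
      qed
      with has_integral_diff[OF has_integral_mult_right[OF h[of "Suc n"], of "1 / 2"] has_integral_mult_right[OF h[of k], of "1 / 2"]]
      show ?thesis by (auto intro: integral_unique)
    qed
  qed (use y in auto)
  then show ?thesis using y sin_gt_zero[of y] by simp
qed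

section \<open>The Schwarzian is constant\<close>

lemma DERIV_sin_mult: "((\<lambda>y. sin (\<nu> * y)) has_real_derivative \<nu> * cos (\<nu> * y)) (at y within Y)"
  and DERIV_cos_mult: "((\<lambda>y. cos (\<nu> * y)) has_real_derivative - \<nu> * sin (\<nu> * y)) (at y within Y)"
  by (auto intro!: derivative_eq_intros)

lemma abs_mult_le: "\<bar>v\<bar> \<le> 1 \<Longrightarrow> \<bar>u * v\<bar> \<le> \<bar>u :: real\<bar>"
  using mult_left_le[of "\<bar>v\<bar>" "\<bar>u\<bar>"] by (simp add: abs_mult)

lemma abs_half_le: "\<bar>t\<bar> \<le> c \<Longrightarrow> \<bar>t / 2\<bar> \<le> (c :: real)"
  by linarith

lemma abs_diff_le: "\<bar>u\<bar> \<le> s \<Longrightarrow> \<bar>v\<bar> \<le> c \<Longrightarrow> c \<le> t \<Longrightarrow> \<bar>u - v\<bar> \<le> s + (t :: real)"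
  by linarith

text \<open>With \<open>p = Vx\<close>, \<open>r = Vy\<close> and \<open>S\<close>, \<open>C\<close>
  the sine and cosine, these are the gradient terms of \<open>moment_density\<close>, estimated by
  the energy density.\<close>

lemma trig_bounds:
  fixes p r S C :: real
  assumes "\<bar>S\<bar> \<le> 1" "\<bar>C\<bar> \<le> 1"
  shows "\<bar>p * C - r * S\<bar> \<le> 2 * (1 + (p\<^sup>2 + r\<^sup>2))"
    and "\<bar>((p\<^sup>2 - r\<^sup>2) * C - 2 * p * r * S) / 8\<bar> \<le> p\<^sup>2 + r\<^sup>2"
proof -
  have t: "\<bar>t\<bar> \<le> 1 + t\<^sup>2" for t :: real
    using sum_squares_bound[of 1 "\<bar>t\<bar>"] zero_le_power2[of t] by simp
  have pr: "2 * \<bar>p * r\<bar> \<le> p\<^sup>2 + r\<^sup>2"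
    using sum_squares_bound[of "\<bar>p\<bar>" "\<bar>r\<bar>"] by (simp add: abs_mult)
  have "\<bar>p * C - r * S\<bar> \<le> \<bar>p * C\<bar> + \<bar>r * S\<bar>" by (rule abs_triangle_ineq4)
  also have "\<dots> \<le> \<bar>p\<bar> + \<bar>r\<bar>" by (intro add_mono abs_mult_le assms)
  also have "\<dots> \<le> (1 + p\<^sup>2) + (1 + r\<^sup>2)" by (intro add_mono t)
  also have "\<dots> \<le> 2 * (1 + (p\<^sup>2 + r\<^sup>2))" by simp
  finally show "\<bar>p * C - r * S\<bar> \<le> 2 * (1 + (p\<^sup>2 + r\<^sup>2))" .
  have "\<bar>(p\<^sup>2 - r\<^sup>2) * C - (2 * p * r) * S\<bar> \<le> \<bar>(p\<^sup>2 - r\<^sup>2) * C\<bar> + \<bar>(2 * p * r) * S\<bar>" by (rule abs_triangle_ineq4)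
  also have "\<dots> \<le> \<bar>p\<^sup>2 - r\<^sup>2\<bar> + \<bar>2 * p * r\<bar>" by (intro add_mono abs_mult_le assms)
  also have "\<dots> \<le> (p\<^sup>2 + r\<^sup>2) + (p\<^sup>2 + r\<^sup>2)"
    using pr by (intro add_mono) (auto simp: abs_mult abs_le_iff)
  finally have "\<bar>(p\<^sup>2 - r\<^sup>2) * C - 2 * p * r * S\<bar> \<le> 2 * (p\<^sup>2 + r\<^sup>2)" by simp
  moreover have "0 \<le> p\<^sup>2 + r\<^sup>2" by simp
  ultimately show "\<bar>((p\<^sup>2 - r\<^sup>2) * C - 2 * p * r * S) / 8\<bar> \<le> p\<^sup>2 + r\<^sup>2"
    by (simp add: abs_divide)
qed
context liouville_strip
begin

text \<open>By the equation this is a quarter of the Laplacian of \<open>V\<close>, that is, the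
  mixed derivative of \<open>V\<close> in \<open>w\<close> and its conjugate.\<close>

definition G :: "complex \<Rightarrow> real" where "G w = - K / 2 * exp (V w)"

text \<open>Real and imaginary part of the Schwarzian \<open>V\<^sub>w\<^sub>w - V\<^sub>w\<^sup>2 / 2\<close>, with \<open>V\<^sub>y\<^sub>y\<close> eliminated by the equation.\<close>

definition Q1 :: "complex \<Rightarrow> real" where "Q1 w = Vxx w / 2 - G w - ((Vx w)\<^sup>2 - (Vy w)\<^sup>2) / 8"
definition Q2 :: "complex \<Rightarrow> real" where "Q2 w = - Vyx w / 2 + Vx w * Vy w / 4"

text \<open>\<open>exp (- \<nu> * x) * moment \<nu> x\<close> is the real part of the integral of the Schwarzian times
  \<open>exp (- \<nu> * w)\<close> over a vertical cross section.\<close>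

definition moment :: "real \<Rightarrow> real \<Rightarrow> real" where
  "moment \<nu> x = integral {0..pi} (\<lambda>y. Q1 (Complex x y) * cos (\<nu> * y) + Q2 (Complex x y) * sin (\<nu> * y))"

text \<open>The integrand of \<open>moment\<close> after its second derivatives have been absorbed
  into a \<open>y\<close>-derivative. Only first derivatives of \<open>V\<close> remain, so one more
  \<open>x\<close>-derivative is possible.\<close>

definition moment_density :: "real \<Rightarrow> complex \<Rightarrow> real" where
  "moment_density \<nu> w = G w * cos (\<nu> * Im w) + \<nu> / 2 * (Vx w * cos (\<nu> * Im w) - Vy w * sin (\<nu> * Im w))
     - (((Vx w)\<^sup>2 - (Vy w)\<^sup>2) * cos (\<nu> * Im w) - 2 * Vx w * Vy w * sin (\<nu> * Im w)) / 8"

lemma cont_Q: "continuous_on strip G" "continuous_on strip Q1" "continuous_on strip Q2"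
  "continuous_on strip (moment_density \<nu>)"
  unfolding G_def Q1_def Q2_def moment_density_def by (intro continuous_intros cont; simp)+

lemma Vyy_eq: "w \<in> strip \<Longrightarrow> Vyy w = 4 * G w - Vxx w"
  using pde[of w] by (simp add: G_def)

text \<open>Differentiating the boundary condition along the edge shows that the imaginary part
  \<open>Q2\<close> vanishes there.\<close>

lemma Q2_boundary: "Vyx (Complex x 0) = Vx (Complex x 0) * Vy (Complex x 0) / 2"
  "Vyx (Complex x pi) = Vx (Complex x pi) * Vy (Complex x pi) / 2"
proof -
  have *: "Vyx (Complex x y) = Vx (Complex x y) * Vy (Complex x y) / 2"
    if y: "y \<in> {0..pi}" and b: "\<And>x. Vy (Complex x y) = b * exp (V (Complex x y) / 2)" for y b
  proof -
    have "((\<lambda>x. b * exp (V (Complex x y) / 2)) has_real_derivative b * (exp (V (Complex x y) / 2) * (Vx (Complex x y) / 2))) (at x)"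
      by (auto intro!: derivative_eq_intros der_x y)
    moreover have "((\<lambda>x. b * exp (V (Complex x y) / 2)) has_real_derivative Vyx (Complex x y)) (at x)"
      using der_x(3)[OF y, of x] unfolding b .
    ultimately show ?thesis using DERIV_unique b by fastforce
  qed
  show "Vyx (Complex x 0) = Vx (Complex x 0) * Vy (Complex x 0) / 2" by (rule *[OF _ bc0]) simp
  show "Vyx (Complex x pi) = Vx (Complex x pi) * Vy (Complex x pi) / 2" by (rule *[OF _ bc1]) simp
qed

text \<open>Once \<open>Vyy\<close> is expressed by \<open>Vxx\<close>, the two integrands differ by
  the \<open>y\<close>-derivative of \<open>- (Vx * sin + Vy * cos) / 2\<close>. The condition on
  \<open>\<nu>\<close>, which says that \<open>\<nu>\<close> is an integer, removes the sine part at
  \<open>y = pi\<close>.\<close>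

lemma moment_eq:
  assumes \<nu>: "sin (\<nu> * pi) = 0"
  shows "moment \<nu> x = integral {0..pi} (\<lambda>y. moment_density \<nu> (Complex x y))
    - (Vy (Complex x pi) * cos (\<nu> * pi) - Vy (Complex x 0)) / 2"
proof -
  define F where "F = (\<lambda>w. - (Vx w * sin (\<nu> * Im w) + Vy w * cos (\<nu> * Im w)) / 2)"
  define M where "M = (\<lambda>w. Q1 w * cos (\<nu> * Im w) + Q2 w * sin (\<nu> * Im w))"
  have cM: "continuous_on strip M" unfolding M_def by (intro continuous_intros cont_Q)
  have "integral {0..pi} (\<lambda>y. (\<lambda>w. M w - moment_density \<nu> w) (Complex x y)) = F (Complex x pi) - F (Complex x 0)"
  proof (rule strip_ftc)
    fix y assume y: "y \<in> {0..pi}"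
    have w: "Complex x y \<in> strip" using y by simp
    have "((\<lambda>y. F (Complex x y)) has_real_derivative - ((Vxy (Complex x y) * sin (\<nu> * y) + Vx (Complex x y) * (\<nu> * cos (\<nu> * y)))
        + (Vyy (Complex x y) * cos (\<nu> * y) - Vy (Complex x y) * (\<nu> * sin (\<nu> * y)))) / 2) (at y within {0..pi})"
      unfolding F_def complex.sel
      by (rule DERIV_cong[OF DERIV_cdivide[OF DERIV_minus[OF DERIV_add[OF DERIV_mult[OF der_y(2)[OF y] DERIV_sin_mult]
          DERIV_mult[OF der_y(3)[OF y] DERIV_cos_mult]]]]]) (simp add: algebra_simps)
    also have "- ((Vxy (Complex x y) * sin (\<nu> * y) + Vx (Complex x y) * (\<nu> * cos (\<nu> * y)))
        + (Vyy (Complex x y) * cos (\<nu> * y) - Vy (Complex x y) * (\<nu> * sin (\<nu> * y)))) / 2 = M (Complex x y) - moment_density \<nu> (Complex x y)"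
      unfolding M_def Q1_def Q2_def moment_density_def Vyy_eq[OF w] Vxy_eq_Vyx[OF w] complex.sel
      by (simp add: field_simps)
    finally show "((\<lambda>y. F (Complex x y)) has_real_derivative M (Complex x y) - moment_density \<nu> (Complex x y)) (at y within {0..pi})" .
  qed
  moreover have "integral {0..pi} (\<lambda>y. (\<lambda>w. M w - moment_density \<nu> w) (Complex x y))
    = integral {0..pi} (\<lambda>y. M (Complex x y)) - integral {0..pi} (\<lambda>y. moment_density \<nu> (Complex x y))"
    by (rule Henstock_Kurzweil_Integration.integral_diff) (intro strip_integrable cM cont_Q)+
  moreover have "moment \<nu> x = integral {0..pi} (\<lambda>y. M (Complex x y))"
    by (simp add: moment_def M_def)
  moreover have "F (Complex x pi) - F (Complex x 0) = - (Vy (Complex x pi) * cos (\<nu> * pi) - Vy (Complex x 0)) / 2"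
    using \<nu> by (simp add: F_def field_simps)
  ultimately show ?thesis by linarith
qed

text \<open>The Cauchy-Riemann equations in integrated form. With \<open>k\<close> the
  \<open>x\<close>-derivative of the density, \<open>k - \<nu> * moment_density\<close> is the
  \<open>y\<close>-derivative of \<open>B\<close>. The edge values of \<open>B\<close> and of the
  correction in \<open>moment_eq\<close> combine correctly because the Schwarzian is real on the
  edges.\<close>

lemma moment_deriv:
  assumes \<nu>: "sin (\<nu> * pi) = 0"
  shows "(moment \<nu> has_real_derivative \<nu> * moment \<nu> x) (at x)"
proof -
  define k where "k = (\<lambda>w. G w * Vx w * cos (\<nu> * Im w) + \<nu> / 2 * (Vxx w * cos (\<nu> * Im w) - Vyx w * sin (\<nu> * Im w))
     - ((2 * Vx w * Vxx w - 2 * Vy w * Vyx w) * cos (\<nu> * Im w) - 2 * (Vxx w * Vy w + Vx w * Vyx w) * sin (\<nu> * Im w)) / 8)"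
  define B where "B = (\<lambda>w. G w * sin (\<nu> * Im w) + (((Vx w)\<^sup>2 - (Vy w)\<^sup>2) * sin (\<nu> * Im w) + 2 * Vx w * Vy w * cos (\<nu> * Im w)) / 8
     - \<nu> / 2 * (Vx w * sin (\<nu> * Im w) + Vy w * cos (\<nu> * Im w)))"
  have ck: "continuous_on strip k" unfolding k_def by (intro continuous_intros cont cont_Q; simp)
  let ?md = "\<lambda>x. integral {0..pi} (\<lambda>y. moment_density \<nu> (Complex x y))"
  let ?k = "integral {0..pi} (\<lambda>y. k (Complex x y))"
  have dG: "((\<lambda>x. G (Complex x y)) has_real_derivative G (Complex x y) * Vx (Complex x y)) (at x)"
    if "y \<in> {0..pi}" for x y
    unfolding G_def by (auto intro!: derivative_eq_intros der_x that)
  have dGy: "((\<lambda>y. G (Complex x y)) has_real_derivative G (Complex x y) * Vy (Complex x y)) (at y within {0..pi})"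
    if "y \<in> {0..pi}" for x y
    unfolding G_def by (auto intro!: derivative_eq_intros der_y that)
  have 1: "(?md has_real_derivative ?k) (at x)"
  proof (rule strip_integral_deriv[OF cont_Q(4) ck])
    fix x y assume y: "y \<in> {0..pi}"
    show "((\<lambda>x. moment_density \<nu> (Complex x y)) has_real_derivative k (Complex x y)) (at x)"
      unfolding moment_density_def k_def complex.sel power2_eq_square
      by (rule DERIV_cong[OF DERIV_diff[OF DERIV_add[OF DERIV_cmult_right[OF dG[OF y]]
            DERIV_cmult[OF DERIV_diff[OF DERIV_cmult_right[OF der_x(2)[OF y]] DERIV_cmult_right[OF der_x(3)[OF y]]]]]
          DERIV_cdivide[OF DERIV_diff[OF DERIV_cmult_right[OF DERIV_diff[OF DERIV_mult[OF der_x(2)[OF y] der_x(2)[OF y]]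
              DERIV_mult[OF der_x(3)[OF y] der_x(3)[OF y]]]]
            DERIV_cmult_right[OF DERIV_mult[OF DERIV_cmult[OF der_x(2)[OF y]] der_x(3)[OF y]]]]]]])
         (simp add: algebra_simps)
  qed
  have 2: "integral {0..pi} (\<lambda>y. (\<lambda>w. k w - \<nu> * moment_density \<nu> w) (Complex x y)) = B (Complex x pi) - B (Complex x 0)"
  proof (rule strip_ftc)
    fix y assume y: "y \<in> {0..pi}"
    have w: "Complex x y \<in> strip" using y by simp
    \<comment> \<open>From here the claim is a polynomial identity; \<open>4 * g - a\<close> stands
      for \<open>Vyy\<close> and \<open>b\<close> for both mixed derivatives.\<close>
    define z p r a b g S C where "z = Complex x y" and "p = Vx z" and "r = Vy z" and "a = Vxx z" and "b = Vyx z" and "g = G z"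
      and "S = sin (\<nu> * y)" and "C = cos (\<nu> * y)"
    note defs = z_def p_def r_def a_def b_def g_def S_def C_def
    have "((\<lambda>y. B (Complex x y)) has_real_derivative (g * r * S + g * (\<nu> * C))
        + ((2 * p * b - 2 * r * (4 * g - a)) * S + (p\<^sup>2 - r\<^sup>2) * (\<nu> * C) + 2 * (b * r + p * (4 * g - a)) * C - 2 * p * r * (\<nu> * S)) / 8
        - \<nu> / 2 * (b * S + p * (\<nu> * C) + (4 * g - a) * C - r * (\<nu> * S))) (at y within {0..pi})"
      unfolding B_def complex.sel defs Vyy_eq[OF w, symmetric] Vxy_eq_Vyx[OF w, symmetric]
      unfolding power2_eq_square
      by (rule DERIV_cong[OF DERIV_diff[OF DERIV_add[OF DERIV_mult[OF dGy[OF y] DERIV_sin_mult]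
            DERIV_cdivide[OF DERIV_add[OF
              DERIV_mult[OF DERIV_diff[OF DERIV_mult[OF der_y(2)[OF y] der_y(2)[OF y]] DERIV_mult[OF der_y(3)[OF y] der_y(3)[OF y]]] DERIV_sin_mult]
              DERIV_mult[OF DERIV_mult[OF DERIV_cmult[OF der_y(2)[OF y]] der_y(3)[OF y]] DERIV_cos_mult]]]]
          DERIV_cmult[OF DERIV_add[OF DERIV_mult[OF der_y(2)[OF y] DERIV_sin_mult] DERIV_mult[OF der_y(3)[OF y] DERIV_cos_mult]]]]])
         (simp add: algebra_simps)
    also have "(g * r * S + g * (\<nu> * C))
        + ((2 * p * b - 2 * r * (4 * g - a)) * S + (p\<^sup>2 - r\<^sup>2) * (\<nu> * C) + 2 * (b * r + p * (4 * g - a)) * C - 2 * p * r * (\<nu> * S)) / 8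
        - \<nu> / 2 * (b * S + p * (\<nu> * C) + (4 * g - a) * C - r * (\<nu> * S))
      = g * p * C + \<nu> / 2 * (a * C - b * S) - ((2 * p * a - 2 * r * b) * C - 2 * (a * r + p * b) * S) / 8
        - \<nu> * (g * C + \<nu> / 2 * (p * C - r * S) - ((p\<^sup>2 - r\<^sup>2) * C - 2 * p * r * S) / 8)"
      by (simp add: field_simps)
    also have "\<dots> = k (Complex x y) - \<nu> * moment_density \<nu> (Complex x y)"
      unfolding k_def moment_density_def defs complex.sel ..
    finally show "((\<lambda>y. B (Complex x y)) has_real_derivative k (Complex x y) - \<nu> * moment_density \<nu> (Complex x y)) (at y within {0..pi})" .
  qed
  have "integral {0..pi} (\<lambda>y. (\<lambda>w. k w - \<nu> * moment_density \<nu> w) (Complex x y)) = ?k - \<nu> * ?md x"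
    by (rule integral_unique)
       (intro has_integral_diff has_integral_mult_right integrable_integral strip_integrable ck cont_Q)
  with 2 have 3: "?k = \<nu> * ?md x + (B (Complex x pi) - B (Complex x 0))" by simp
  have "((\<lambda>x. ?md x - (Vy (Complex x pi) * cos (\<nu> * pi) - Vy (Complex x 0)) / 2) has_real_derivative
      ?k - (Vyx (Complex x pi) * cos (\<nu> * pi) - Vyx (Complex x 0)) / 2) (at x)"
    by (intro DERIV_diff 1 DERIV_cdivide DERIV_cmult_right der_x; simp)
  moreover have "(\<lambda>x. ?md x - (Vy (Complex x pi) * cos (\<nu> * pi) - Vy (Complex x 0)) / 2) = moment \<nu>"
    using moment_eq[OF \<nu>] by (auto simp: fun_eq_iff)
  moreover have "?k - (Vyx (Complex x pi) * cos (\<nu> * pi) - Vyx (Complex x 0)) / 2 = \<nu> * moment \<nu> x"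
    unfolding 3 moment_eq[OF \<nu>] Q2_boundary B_def complex.sel \<nu> by (simp add: field_simps)
  ultimately show ?thesis by metis
qed

lemma moment_exp:
  assumes \<nu>: "sin (\<nu> * pi) = 0"
  shows "moment \<nu> x = moment \<nu> 0 * exp (\<nu> * x)"
proof -
  have "((\<lambda>x. moment \<nu> x * exp (- \<nu> * x)) has_real_derivative 0) (at x)" for x
    by (auto intro!: derivative_eq_intros moment_deriv[OF \<nu>])
  then have "moment \<nu> x * exp (- \<nu> * x) = moment \<nu> 0 * exp (- \<nu> * 0)"
    by (intro DERIV_isconst_all) auto
  then have "moment \<nu> x * exp (- \<nu> * x) * exp (\<nu> * x) = moment \<nu> 0 * exp (\<nu> * x)" by simp
  then show ?thesis by (simp add: mult.assoc flip: exp_add)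
qed

text \<open>In the form given by \<open>moment_eq\<close> a moment contains first derivatives at
  most quadratically, so the energy of the cross section dominates it; the edge terms are
  bounded.\<close>

lemma moment_bound:
  assumes \<nu>: "sin (\<nu> * pi) = 0"
  shows "\<exists>c>0. \<forall>x. \<bar>moment \<nu> x\<bar> \<le> c * (1 + integral {0..pi} (\<lambda>y. (Vx (Complex x y))\<^sup>2 + (Vy (Complex x y))\<^sup>2))"
proof -
  obtain B where B: "0 \<le> B" "\<And>w. w \<in> strip \<Longrightarrow> exp (V w) \<le> B" "\<And>w. w \<in> strip \<Longrightarrow> exp (V w / 2) \<le> B"
    using exp_bounds by metis
  define D where "D = (\<lambda>w. (Vx w)\<^sup>2 + (Vy w)\<^sup>2)"
  have cD: "continuous_on strip D" unfolding D_def by (intro continuous_intros cont)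
  let ?D = "\<lambda>x. integral {0..pi} (\<lambda>y. D (Complex x y))"
  define c1 c2 where "c1 = \<bar>K\<bar> * B + \<bar>\<nu>\<bar> + 1" and "c2 = (\<bar>b0\<bar> + \<bar>b1\<bar>) * B"
  have c0: "0 < c1" "0 \<le> c2" using B by (auto simp: c1_def c2_def add_nonneg_pos)
  have md: "\<bar>moment_density \<nu> w\<bar> \<le> c1 * (1 + D w)" if w: "w \<in> strip" for w
  proof -
    define p r S C where "p = Vx w" and "r = Vy w" and "S = sin (\<nu> * Im w)" and "C = cos (\<nu> * Im w)"
    have Dw: "D w = p\<^sup>2 + r\<^sup>2" by (simp add: D_def p_def r_def)
    have D0: "0 \<le> D w" by (simp add: D_def)
    have SC: "\<bar>S\<bar> \<le> 1" "\<bar>C\<bar> \<le> 1" by (auto simp: S_def C_def)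
    have "\<bar>G w\<bar> = \<bar>K\<bar> * exp (V w) / 2" by (simp add: G_def abs_mult)
    also have "\<dots> \<le> \<bar>K\<bar> * exp (V w)" by simp
    also have "\<dots> \<le> \<bar>K\<bar> * B" by (intro mult_left_mono B w) auto
    finally have g: "\<bar>G w * C\<bar> \<le> \<bar>K\<bar> * B" using abs_mult_le[OF SC(2), of "G w"] by linarith
    have "\<bar>p * C - r * S\<bar> \<le> 2 * (1 + D w)" unfolding Dw by (rule trig_bounds(1)[OF SC])
    from mult_left_mono[OF this abs_ge_zero[of "\<nu> / 2"]]
    have "\<bar>\<nu> / 2 * (p * C - r * S)\<bar> \<le> \<bar>\<nu> / 2\<bar> * (2 * (1 + D w))"
      unfolding abs_mult .
    also have "\<dots> = \<bar>\<nu>\<bar> * (1 + D w)" unfolding abs_divide by simp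
    finally have h: "\<bar>\<nu> / 2 * (p * C - r * S)\<bar> \<le> \<bar>\<nu>\<bar> * (1 + D w)" .
    have j: "\<bar>((p\<^sup>2 - r\<^sup>2) * C - 2 * p * r * S) / 8\<bar> \<le> D w" unfolding Dw by (rule trig_bounds(2)[OF SC])
    from order_trans[OF abs_triangle_ineq4 add_mono[OF order_trans[OF abs_triangle_ineq add_mono[OF g h]] j]]
    have "\<bar>moment_density \<nu> w\<bar> \<le> \<bar>K\<bar> * B + \<bar>\<nu>\<bar> * (1 + D w) + D w"
      unfolding moment_density_def p_def r_def S_def C_def .
    also have "\<dots> \<le> (\<bar>K\<bar> * B) * (1 + D w) + \<bar>\<nu>\<bar> * (1 + D w) + (1 + D w)"
      using D0 B(1) by (intro add_mono) (auto simp: distrib_left)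
    also have "\<dots> = c1 * (1 + D w)" by (simp add: c1_def algebra_simps)
    finally show ?thesis .
  qed
  have "\<bar>moment \<nu> x\<bar> \<le> (4 * c1 + c2) * (1 + ?D x)" for x
  proof -
    have D0: "0 \<le> ?D x" by (rule integral_nonneg[OF strip_integrable[OF cD]]) (auto simp: D_def)
    have i: "((\<lambda>y. c1 * (1 + D (Complex x y))) has_integral c1 * (pi + ?D x)) {0..pi}"
      by (intro has_integral_mult_right has_integral_add integrable_integral strip_integrable cD)
         (use has_integral_const_real[of "1::real" 0 pi] in simp)
    have "norm (integral {0..pi} (\<lambda>y. moment_density \<nu> (Complex x y))) \<le> integral {0..pi} (\<lambda>y. c1 * (1 + D (Complex x y)))"
      by (rule integral_norm_bound_integral[OF strip_integrable[OF cont_Q(4)] has_integral_integrable[OF i]]) (use md in auto)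
    also have "\<dots> = c1 * (pi + ?D x)" using i by (rule integral_unique)
    also have "\<dots> \<le> c1 * (4 * (1 + ?D x))" using c0 D0 pi_less_4 by (intro mult_left_mono) auto
    finally have 1: "\<bar>integral {0..pi} (\<lambda>y. moment_density \<nu> (Complex x y))\<bar> \<le> 4 * c1 * (1 + ?D x)"
      by (simp only: real_norm_def mult_ac)
    have "\<bar>cos (\<nu> * Im (Complex x pi)) * Vy (Complex x pi) - cos (\<nu> * Im (Complex x 0)) * Vy (Complex x 0)\<bar> \<le> c2"
      unfolding c2_def
    proof (rule boundary_bound[where \<phi> = "\<lambda>w. cos (\<nu> * Im w)"])
      fix w assume w: "w \<in> strip"
      have "\<bar>cos (\<nu> * Im w)\<bar> * exp (V w / 2) \<le> 1 * exp (V w / 2)" by (intro mult_right_mono) auto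
      from order_trans[OF this[unfolded mult_1] B(3)[OF w]]
      show "\<bar>cos (\<nu> * Im w)\<bar> * exp (V w / 2) \<le> B" .
    qed
    then have "\<bar>Vy (Complex x pi) * cos (\<nu> * pi) - Vy (Complex x 0)\<bar> \<le> c2"
      unfolding complex.sel mult_zero_right cos_zero mult_1 by (simp only: mult.commute)
    then have 2: "\<bar>(Vy (Complex x pi) * cos (\<nu> * pi) - Vy (Complex x 0)) / 2\<bar> \<le> c2"
      by (rule abs_half_le)
    have "c2 * 1 \<le> c2 * (1 + ?D x)" using c0 D0 by (intro mult_left_mono) auto
    then have 3: "c2 \<le> c2 * (1 + ?D x)" unfolding mult_1_right .
    from abs_diff_le[OF 1 2 3] show ?thesis unfolding moment_eq[OF \<nu>] distrib_right[of "4 * c1" c2] .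
  qed
  moreover have "0 < 4 * c1 + c2" using c0 by linarith
  ultimately show ?thesis unfolding D_def by blast
qed

text \<open>A nonzero moment grows like \<open>exp (\<nu> * x)\<close> at one end, and the energy
  with it; by \<open>energy\<close> the integral of \<open>V\<^sup>2\<close> would then outgrow
  every polynomial.\<close>

lemma moment_zero:
  assumes \<nu>: "sin (\<nu> * pi) = 0" "\<nu> \<noteq> 0"
  shows "moment \<nu> x = 0"
proof -
  have "moment \<nu> 0 = 0"
  proof (rule ccontr)
    assume ne: "moment \<nu> 0 \<noteq> 0"
    let ?D = "\<lambda>x. integral {0..pi} (\<lambda>y. (Vx (Complex x y))\<^sup>2 + (Vy (Complex x y))\<^sup>2)"
    obtain c where c: "0 < c" "\<And>x. \<bar>moment \<nu> x\<bar> \<le> c * (1 + ?D x)" using moment_bound[OF \<nu>(1)] by blast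
    obtain E E' E'' b C where E: "\<And>x. (E has_real_derivative E' x) (at x)" "\<And>x. (E' has_real_derivative E'' x) (at x)"
      "\<And>x. 2 * ?D x - b \<le> E'' x" "\<And>x. E x \<le> C * (1 + x\<^sup>2)\<^sup>2"
      by (rule energy) (rule that; assumption)
    have ge: "2 * \<bar>moment \<nu> 0\<bar> / c * exp (\<nu> * x) - (2 + b) \<le> E'' x" for x
    proof -
      have "\<bar>moment \<nu> 0\<bar> * exp (\<nu> * x) \<le> c * (1 + ?D x)"
        using c(2)[of x] unfolding moment_exp[OF \<nu>(1), of x] by (simp add: abs_mult)
      then have "\<bar>moment \<nu> 0\<bar> / c * exp (\<nu> * x) \<le> 1 + ?D x" using c(1)
        unfolding times_divide_eq_left by (subst pos_divide_le_eq) (simp_all only: mult.commute)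
      then show ?thesis using E(3)[of x] unfolding times_divide_eq_right[symmetric] mult.assoc by linarith
    qed
    have "0 < 2 * \<bar>moment \<nu> 0\<bar> / c" using ne c(1) by simp
    from no_exponential_growth[OF E(1,2) ge this \<nu>(2) E(4)] show False .
  qed
  then show ?thesis using moment_exp[OF \<nu>(1), of x] by simp
qed

text \<open>Sum and difference of the moments for \<open>n\<close> and \<open>- n\<close> isolate
  the cosine moments of \<open>Q1\<close> and the sine moments of \<open>Q2\<close>. The integral of
  \<open>Q1\<close> over a cross section is the moment for 0, which does not depend on
  \<open>x\<close>.\<close>

lemma schwarzian_constant: "\<exists>\<kappa>. \<forall>w\<in>strip. Q1 w = \<kappa> \<and> (0 < Im w \<and> Im w < pi \<longrightarrow> Q2 w = 0)"
proof -
  have m: "((\<lambda>y. Q1 (Complex x y) * cos (real n * y)) has_integral 0) {0..pi}"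
    "((\<lambda>y. Q2 (Complex x y) * sin (real n * y)) has_integral 0) {0..pi}" if n: "0 < n" for n :: nat and x
  proof -
    have i: "((\<lambda>y. Q1 (Complex x y) * cos (\<nu> * y) + Q2 (Complex x y) * sin (\<nu> * y)) has_integral moment \<nu> x) {0..pi}" for \<nu>
      unfolding moment_def
      by (intro integrable_integral integrable_continuous_interval continuous_intros continuous_on_strip_slice(2) cont_Q)
    have "moment (real n) x = 0" "moment (- real n) x = 0"
      using n by (auto intro!: moment_zero)
    with i[of "real n"] i[of "- real n"]
    have a: "((\<lambda>y. Q1 (Complex x y) * cos (real n * y) + Q2 (Complex x y) * sin (real n * y)) has_integral 0) {0..pi}"
      "((\<lambda>y. Q1 (Complex x y) * cos (real n * y) - Q2 (Complex x y) * sin (real n * y)) has_integral 0) {0..pi}" by auto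
    show "((\<lambda>y. Q1 (Complex x y) * cos (real n * y)) has_integral 0) {0..pi}"
      using has_integral_mult_right[OF has_integral_add[OF a], of "1 / 2"] by (simp add: algebra_simps)
    show "((\<lambda>y. Q2 (Complex x y) * sin (real n * y)) has_integral 0) {0..pi}"
      using has_integral_mult_right[OF has_integral_diff[OF a], of "1 / 2"] by (simp add: algebra_simps)
  qed
  have "Q1 (Complex x y) = moment 0 0 / pi" if y: "y \<in> {0..pi}" for x y
  proof -
    have "Q1 (Complex x y) = integral {0..pi} (\<lambda>y. Q1 (Complex x y)) / pi"
      by (rule cos_moments_const[OF continuous_on_strip_slice(2)[OF cont_Q(2)] _ y]) (use m(1) integral_unique in blast)
    also have "integral {0..pi} (\<lambda>y. Q1 (Complex x y)) = moment 0 x" by (simp add: moment_def)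
    also have "moment 0 x = moment 0 0" using moment_exp[of 0 x] by simp
    finally show ?thesis .
  qed
  moreover have "Q2 (Complex x y) = 0" if "0 < y" "y < pi" for x y
    by (rule sin_moments_zero[OF continuous_on_strip_slice(2)[OF cont_Q(3)] _ that]) (use m(2) integral_unique in blast)
  ultimately have "Q1 w = moment 0 0 / pi \<and> (0 < Im w \<and> Im w < pi \<longrightarrow> Q2 w = 0)" if "w \<in> strip" for w
    using that by (cases w) (auto simp: strip_def)
  then show ?thesis by blast
qed

end

section \<open>Classification on the strip\<close>

lemma DERIV_within_unique:
  fixes a b :: real
  assumes "(f has_real_derivative D) (at x within {a..b})" "(f has_real_derivative D') (at x within {a..b})"
    and "a < b" "x \<in> {a..b}"
  shows "D = D'"
  using vector_derivative_unique_within[of x "{a..b}"] assms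
  by (auto simp: has_real_derivative_iff_has_vector_derivative trivial_limit_within islimpt_Icc)

lemma DERIV_within_const:
  fixes f :: "real \<Rightarrow> real"
  assumes "\<And>x. x \<in> {a..b} \<Longrightarrow> (f has_real_derivative 0) (at x within {a..b})" and "x \<in> {a..b}"
  shows "f x = f a"
proof -
  obtain c where "\<And>x. x \<in> {a..b} \<Longrightarrow> f x = c"
    using has_field_derivative_zero_constant[of "{a..b}" f] assms(1) by auto
  then show ?thesis using assms(2) by auto
qed

text \<open>\<open>A' + \<gamma> * A\<close> and \<open>A' - \<gamma> * A\<close> solve first order
  equations and are pure exponentials.\<close>

lemma ode_exp:
  fixes A A' :: "real \<Rightarrow> real"
  assumes A: "\<And>x. (A has_real_derivative A' x) (at x)" "\<And>x. (A' has_real_derivative \<gamma>\<^sup>2 * A x) (at x)"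
    and \<gamma>: "0 < \<gamma>"
  shows "A x = (A 0 + A' 0 / \<gamma>) / 2 * exp (\<gamma> * x) + (A 0 - A' 0 / \<gamma>) / 2 * exp (- (\<gamma> * x))"
proof -
  have "((\<lambda>x. (A' x + \<gamma> * A x) * exp (- \<gamma> * x)) has_real_derivative 0) (at x)" for x
    by (auto intro!: derivative_eq_intros A simp: algebra_simps power2_eq_square)
  then have 1: "(A' x + \<gamma> * A x) * exp (- \<gamma> * x) = (A' 0 + \<gamma> * A 0) * exp (- \<gamma> * 0)"
    by (intro DERIV_isconst_all) auto
  have "((\<lambda>x. (A' x - \<gamma> * A x) * exp (\<gamma> * x)) has_real_derivative 0) (at x)" for x
    by (auto intro!: derivative_eq_intros A simp: algebra_simps power2_eq_square)
  then have 2: "(A' x - \<gamma> * A x) * exp (\<gamma> * x) = (A' 0 - \<gamma> * A 0) * exp (\<gamma> * 0)"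
    by (intro DERIV_isconst_all) auto
  have e: "exp (- \<gamma> * x) * exp (\<gamma> * x) = 1" "exp (\<gamma> * x) * exp (- (\<gamma> * x)) = 1" by (simp_all flip: exp_add)
  have "(A' x + \<gamma> * A x) * (exp (- \<gamma> * x) * exp (\<gamma> * x)) = (A' 0 + \<gamma> * A 0) * exp (\<gamma> * x)"
    using 1 by (simp add: mult.assoc[symmetric])
  moreover have "(A' x - \<gamma> * A x) * (exp (\<gamma> * x) * exp (- (\<gamma> * x))) = (A' 0 - \<gamma> * A 0) * exp (- (\<gamma> * x))"
    using 2 by (simp add: mult.assoc[symmetric])
  ultimately have "2 * \<gamma> * A x = (A' 0 + \<gamma> * A 0) * exp (\<gamma> * x) - (A' 0 - \<gamma> * A 0) * exp (- (\<gamma> * x))"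
    unfolding e by simp
  then have "A x = ((A' 0 + \<gamma> * A 0) * exp (\<gamma> * x) - (A' 0 - \<gamma> * A 0) * exp (- (\<gamma> * x))) / (2 * \<gamma>)"
    using \<gamma> by (simp add: eq_divide_eq mult.commute)
  also have "\<dots> = (A 0 + A' 0 / \<gamma>) / 2 * exp (\<gamma> * x) + (A 0 - A' 0 / \<gamma>) / 2 * exp (- (\<gamma> * x))"
    using \<gamma> by (simp add: field_simps)
  finally show ?thesis .
qed

lemma rotation_identity:
  fixes p q c s :: real
  shows "(p * c - q * s) * c + (p * s + q * c) * s = p * (c\<^sup>2 + s\<^sup>2)"
  by algebra

lemma double_abs_less: "\<not> 2 * (\<bar>u\<bar> + 1) \<le> (u :: real)"
  using abs_ge_self[of u] abs_ge_zero[of u] by argo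

text \<open>The vector with components \<open>B\<close> and \<open>B' / \<gamma>\<close> rotates
  with angular speed \<open>\<gamma>\<close>; rotating it back gives two constants, and
  \<open>rotation_identity\<close> recovers \<open>B\<close>.\<close>

lemma ode_trig:
  fixes B B' :: "real \<Rightarrow> real"
  assumes B: "\<And>y. y \<in> {0..b} \<Longrightarrow> (B has_real_derivative B' y) (at y within {0..b})"
    "\<And>y. y \<in> {0..b} \<Longrightarrow> (B' has_real_derivative - (\<gamma>\<^sup>2) * B y) (at y within {0..b})"
    and \<gamma>: "0 < \<gamma>" and y: "y \<in> {0..b}"
  shows "B y = B 0 * cos (\<gamma> * y) + B' 0 / \<gamma> * sin (\<gamma> * y)"
proof -
  have "B y * cos (\<gamma> * y) - B' y / \<gamma> * sin (\<gamma> * y) = B 0 * cos (\<gamma> * 0) - B' 0 / \<gamma> * sin (\<gamma> * 0)"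
    by (rule DERIV_within_const[OF _ y])
       (use \<gamma> in \<open>auto intro!: derivative_eq_intros B simp: field_simps power2_eq_square\<close>)
  moreover have "B y * sin (\<gamma> * y) + B' y / \<gamma> * cos (\<gamma> * y) = B 0 * sin (\<gamma> * 0) + B' 0 / \<gamma> * cos (\<gamma> * 0)"
    by (rule DERIV_within_const[OF _ y],
        rule DERIV_cong[OF DERIV_add[OF DERIV_mult[OF B(1) DERIV_sin_mult] DERIV_mult[OF DERIV_cdivide[OF B(2)] DERIV_cos_mult]]])
       (use \<gamma> in \<open>simp_all add: field_simps power2_eq_square\<close>)
  ultimately have "B 0 * cos (\<gamma> * y) + B' 0 / \<gamma> * sin (\<gamma> * y) =
      (B y * cos (\<gamma> * y) - B' y / \<gamma> * sin (\<gamma> * y)) * cos (\<gamma> * y) + (B y * sin (\<gamma> * y) + B' y / \<gamma> * cos (\<gamma> * y)) * sin (\<gamma> * y)"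
    by simp
  also have "\<dots> = B y * ((cos (\<gamma> * y))\<^sup>2 + (sin (\<gamma> * y))\<^sup>2)"
    by (rule rotation_identity)
  finally show ?thesis by simp
qed

context liouville_strip
begin

definition U :: "complex \<Rightarrow> real" where "U w = exp (- V w / 2)"
definition Ux :: "complex \<Rightarrow> real" where "Ux w = - 1 / 2 * U w * Vx w"
definition Uy :: "complex \<Rightarrow> real" where "Uy w = - 1 / 2 * U w * Vy w"
definition Uxx :: "complex \<Rightarrow> real" where "Uxx w = U w * ((Vx w)\<^sup>2 / 4 - Vxx w / 2)"
definition Uyy :: "complex \<Rightarrow> real" where "Uyy w = U w * ((Vy w)\<^sup>2 / 4 - Vyy w / 2)"

text \<open>The sine moments say nothing at the end points; there the boundary condition takes
  over.\<close>

lemma schwarzian_constant_real: "\<exists>\<kappa>. \<forall>w\<in>strip. Q1 w = \<kappa> \<and> Q2 w = 0"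
proof -
  obtain \<kappa> where \<kappa>: "\<forall>w\<in>strip. Q1 w = \<kappa> \<and> (0 < Im w \<and> Im w < pi \<longrightarrow> Q2 w = 0)"
    using schwarzian_constant by blast
  have "Q2 w = 0" if w: "w \<in> strip" for w
  proof -
    consider "Im w = 0" | "Im w = pi" | "0 < Im w \<and> Im w < pi"
      using w by (cases "Im w = 0"; cases "Im w = pi") (auto simp: strip_def)
    then show ?thesis
    proof cases
      case 1
      then have "w = Complex (Re w) 0" by (simp add: complex_eq_iff)
      then show ?thesis using Q2_boundary(1)[of "Re w"] by (simp add: Q2_def)
    next
      case 2
      then have "w = Complex (Re w) pi" by (simp add: complex_eq_iff)
      then show ?thesis using Q2_boundary(2)[of "Re w"] by (simp add: Q2_def)
    qed (use \<kappa> w in blast)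
  qed
  with \<kappa> show ?thesis by blast
qed

text \<open>The last clause is the one that matters: the mixed derivative of \<open>U\<close> is
  \<open>U * Q2\<close>, so it vanishes once the Schwarzian is real.\<close>

lemma U_deriv:
  assumes y: "y \<in> {0..pi}"
  shows "((\<lambda>x. U (Complex x y)) has_real_derivative Ux (Complex x y)) (at x)"
    and "((\<lambda>x. Ux (Complex x y)) has_real_derivative Uxx (Complex x y)) (at x)"
    and "((\<lambda>y. U (Complex x y)) has_real_derivative Uy (Complex x y)) (at y within {0..pi})"
    and "((\<lambda>y. Uy (Complex x y)) has_real_derivative Uyy (Complex x y)) (at y within {0..pi})"
    and "((\<lambda>y. Ux (Complex x y)) has_real_derivative U (Complex x y) * Q2 (Complex x y)) (at y within {0..pi})"
proof -
  show a: "((\<lambda>x. U (Complex x y)) has_real_derivative Ux (Complex x y)) (at x)"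
    unfolding U_def Ux_def by (auto intro!: derivative_eq_intros der_x y)
  show b: "((\<lambda>y. U (Complex x y)) has_real_derivative Uy (Complex x y)) (at y within {0..pi})"
    unfolding U_def Uy_def by (auto intro!: derivative_eq_intros der_y y)
  show "((\<lambda>x. Ux (Complex x y)) has_real_derivative Uxx (Complex x y)) (at x)"
    unfolding Ux_def Uxx_def
    by (rule DERIV_cong[OF DERIV_mult[OF DERIV_cmult[OF a] der_x(2)[OF y]]]) (simp add: Ux_def field_simps power2_eq_square)
  show "((\<lambda>y. Uy (Complex x y)) has_real_derivative Uyy (Complex x y)) (at y within {0..pi})"
    unfolding Uy_def Uyy_def
    by (rule DERIV_cong[OF DERIV_mult[OF DERIV_cmult[OF b] der_y(3)[OF y]]]) (simp add: Uy_def field_simps power2_eq_square)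
  have w: "Complex x y \<in> strip" using y by simp
  show "((\<lambda>y. Ux (Complex x y)) has_real_derivative U (Complex x y) * Q2 (Complex x y)) (at y within {0..pi})"
    unfolding Ux_def Q2_def Vxy_eq_Vyx[OF w, symmetric]
    by (rule DERIV_cong[OF DERIV_mult[OF DERIV_cmult[OF b] der_y(2)[OF y]]]) (simp add: Uy_def field_simps power2_eq_square)
qed

lemma U_pos: "0 < U w"
  by (simp add: U_def)

text \<open>Four times the real part of the linear equation for \<open>U\<close>.\<close>

lemma U_box: "w \<in> strip \<Longrightarrow> Uxx w - Uyy w = - 2 * Q1 w * U w"
  by (simp add: Uxx_def Uyy_def Q1_def Vyy_eq field_simps)

text \<open>Liouville's equation rewritten for \<open>U\<close>. The separated equations are linear
  and do not contain \<open>K\<close>; this nonlinear identity, evaluated at one point, brings it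
  back as a relation between the integration constants.\<close>

lemma U_laplacian:
  assumes w: "w \<in> strip"
  shows "U w * (Uxx w + Uyy w) - ((Ux w)\<^sup>2 + (Uy w)\<^sup>2) = K"
proof -
  have "U w * (Uxx w + Uyy w) - ((Ux w)\<^sup>2 + (Uy w)\<^sup>2) = (U w)\<^sup>2 * (- 2 * G w)"
    by (simp add: Uxx_def Uyy_def Ux_def Uy_def Vyy_eq[OF w] field_simps power2_eq_square)
  also have "\<dots> = K * ((U w)\<^sup>2 * exp (V w))" by (simp add: G_def)
  also have "(U w)\<^sup>2 * exp (V w) = 1" by (simp add: U_def flip: exp_double exp_add)
  finally show ?thesis by simp
qed

lemma U_unbounded: "\<exists>X. \<forall>x. X \<le> \<bar>x\<bar> \<longrightarrow> M \<le> U (Complex x 0)"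
proof -
  obtain N where N: "0 < N" "M \<le> N" by (meson gt_ex less_imp_le max.strict_boundedE)
  obtain X where X: "\<forall>w\<in>strip. X \<le> \<bar>Re w\<bar> \<longrightarrow> V w \<le> - 2 * ln N" using decay by blast
  have "M \<le> U (Complex x 0)" if "X \<le> \<bar>x\<bar>" for x
  proof -
    have "V (Complex x 0) \<le> - 2 * ln N"
      by (rule X[rule_format]) (use that in simp_all)
    then have "ln N \<le> - V (Complex x 0) / 2" by simp
    then have "exp (ln N) \<le> U (Complex x 0)" unfolding U_def by simp
    then show ?thesis using N by simp
  qed
  then show ?thesis by blast
qed

text \<open>A vanishing mixed derivative makes \<open>Ux\<close> independent of \<open>y\<close>,
  hence \<open>U (Complex x y) - U (Complex x 0)\<close> independent of \<open>x\<close>.\<close>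

lemma U_separates:
  assumes y: "y \<in> {0..pi}"
  shows "Ux (Complex x y) = Ux (Complex x 0)"
    and "U (Complex x y) = U (Complex x 0) + U (Complex 0 y) - U (Complex 0 0)"
    and "Uxx (Complex x y) = Uxx (Complex x 0)"
    and "Uy (Complex x y) = Uy (Complex 0 y)"
    and "Uyy (Complex x y) = Uyy (Complex 0 y)"
proof -
  have Q2: "Q2 w = 0" if "w \<in> strip" for w using schwarzian_constant_real that by blast
  have Ux: "Ux (Complex x y) = Ux (Complex x 0)" if y: "y \<in> {0..pi}" for x y
    by (rule DERIV_within_const[OF _ y]) (use U_deriv(5)[of _ x] Q2 in fastforce)
  then show "Ux (Complex x y) = Ux (Complex x 0)" using y by blast
  have U: "U (Complex x y) = U (Complex x 0) + U (Complex 0 y) - U (Complex 0 0)" if y: "y \<in> {0..pi}" for x y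
  proof -
    have "((\<lambda>x. U (Complex x y) - U (Complex x 0)) has_real_derivative Ux (Complex x y) - Ux (Complex x 0)) (at x)" for x
      by (intro DERIV_diff U_deriv y) simp
    then have "((\<lambda>x. U (Complex x y) - U (Complex x 0)) has_real_derivative 0) (at x)" for x
      using Ux[OF y] by simp
    then have "U (Complex x y) - U (Complex x 0) = U (Complex 0 y) - U (Complex 0 0)"
      by (intro DERIV_isconst_all) auto
    then show ?thesis by simp
  qed
  then show "U (Complex x y) = U (Complex x 0) + U (Complex 0 y) - U (Complex 0 0)" using y by blast
  have "((\<lambda>x. Ux (Complex x y)) has_real_derivative Uxx (Complex x 0)) (at x)"
    unfolding Ux[OF y] by (rule U_deriv) simp
  then show "Uxx (Complex x y) = Uxx (Complex x 0)" using U_deriv(2)[OF y] DERIV_unique by blast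
  have Uy: "Uy (Complex x y) = Uy (Complex 0 y)" if y: "y \<in> {0..pi}" for x y
  proof -
    have "((\<lambda>y. U (Complex x 0) + U (Complex 0 y) - U (Complex 0 0)) has_real_derivative Uy (Complex 0 y)) (at y within {0..pi})"
      using DERIV_add[OF DERIV_const U_deriv(3)[OF y]] by (auto intro!: derivative_eq_intros U_deriv y)
    then have "((\<lambda>y. U (Complex x y)) has_real_derivative Uy (Complex 0 y)) (at y within {0..pi})"
      by (rule has_field_derivative_transform_within[OF _ zero_less_one y]) (rule U[symmetric])
    from DERIV_within_unique[OF U_deriv(3)[OF y] this pi_gt_zero y] show ?thesis .
  qed
  then show "Uy (Complex x y) = Uy (Complex 0 y)" using y by blast
  have "((\<lambda>y. Uy (Complex x y)) has_real_derivative Uyy (Complex 0 y)) (at y within {0..pi})"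
    by (rule has_field_derivative_transform_within[OF U_deriv(4)[OF y] zero_less_one y]) (rule Uy[symmetric])
  from DERIV_within_unique[OF U_deriv(4)[OF y] this pi_gt_zero y] show "Uyy (Complex x y) = Uyy (Complex 0 y)" .
qed

text \<open>The sign of \<open>\<kappa>\<close> decides. Separation gives
  \<open>a'' = c0 - 2 * \<kappa> * a\<close> and
  \<open>\<beta>'' = d0 + 2 * \<kappa> * \<beta>\<close>: bounded solutions \<open>a\<close> for
  positive \<open>\<kappa>\<close>, quadratics and the logarithmic family for zero, exponentials and
  the power family for negative \<open>\<kappa>\<close>. The inequality on \<open>z0\<close> is
  recorded for the point \<open>z = 0\<close>, which no point of the strip represents.\<close>

theorem classification:
  "(\<exists>\<gamma> l z0. 0 < \<gamma> \<and> 0 < l \<and> K * l\<^sup>2 + (cmod z0)\<^sup>2 \<noteq> 0 \<and>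
     (\<forall>w\<in>strip. U w = (K * l\<^sup>2 + (cmod (exp (complex_of_real \<gamma> * w) - z0))\<^sup>2) / (2 * l * \<gamma> * exp (\<gamma> * Re w))))
   \<or> (\<exists>l z0. 0 < l \<and> (\<forall>w\<in>strip. U w = (K * l\<^sup>2 + (cmod (w - z0))\<^sup>2) / (2 * l)))"
proof -
  obtain \<kappa> where \<kappa>: "\<And>w. w \<in> strip \<Longrightarrow> Q1 w = \<kappa>" using schwarzian_constant_real by blast
  define a a' where "a = (\<lambda>x. U (Complex x 0))" and "a' = (\<lambda>x. Ux (Complex x 0))"
  define \<beta> \<beta>' where "\<beta> = (\<lambda>y. U (Complex 0 y))" and "\<beta>' = (\<lambda>y. Uy (Complex 0 y))"
  define c0 where "c0 = Uyy (Complex 0 0)"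
  define d0 where "d0 = c0 - 2 * \<kappa> * a 0"
  have a: "(a has_real_derivative a' x) (at x)" for x
    unfolding a_def a'_def by (rule U_deriv) simp
  have a2: "Uxx (Complex x 0) = c0 - 2 * \<kappa> * a x" for x
    using U_box[of "Complex x 0"] \<kappa>[of "Complex x 0"] U_separates(5)[of 0 x] by (simp add: c0_def a_def)
  have a': "(a' has_real_derivative c0 - 2 * \<kappa> * a x) (at x)" for x
    unfolding a'_def a2[symmetric] by (rule U_deriv) simp
  have b: "(\<beta> has_real_derivative \<beta>' y) (at y within {0..pi})" if "y \<in> {0..pi}" for y
    unfolding \<beta>_def \<beta>'_def by (rule U_deriv[OF that])
  have b2: "Uyy (Complex 0 y) = d0 + 2 * \<kappa> * \<beta> y" if y: "y \<in> {0..pi}" for y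
    using U_box[of "Complex 0 y"] \<kappa>[of "Complex 0 y"] U_separates(3)[OF y, of 0] a2[of 0] y by (simp add: \<beta>_def d0_def)
  have b': "(\<beta>' has_real_derivative d0 + 2 * \<kappa> * \<beta> y) (at y within {0..pi})" if y: "y \<in> {0..pi}" for y
    unfolding \<beta>'_def b2[OF y, symmetric] by (rule U_deriv[OF y])
  have U_eq: "U w = a (Re w) + \<beta> (Im w) - a 0" if "w \<in> strip" for w
    using U_separates(2)[of "Im w" "Re w"] that by (simp add: a_def \<beta>_def strip_def)
  have ab0: "\<beta> 0 = a 0" by (simp add: a_def \<beta>_def)
  have K: "a 0 * ((c0 - 2 * \<kappa> * a 0) + c0) - ((a' 0)\<^sup>2 + (\<beta>' 0)\<^sup>2) = K"
    using U_laplacian[of "Complex 0 0"] a2[of 0] by (simp add: a_def a'_def \<beta>'_def c0_def)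
  have inf: "\<exists>X. \<forall>x. X \<le> \<bar>x\<bar> \<longrightarrow> M \<le> a x" for M unfolding a_def by (rule U_unbounded)
  consider "0 < \<kappa>" | "\<kappa> = 0" | "\<kappa> < 0" by linarith
  then show ?thesis
  proof cases
    case 1
    \<comment> \<open>A first integral of the equation for \<open>a\<close>: constant along the
      solution, yet forced to be large where \<open>a\<close> is large.\<close>
    define e where "e = (\<lambda>x. (a' x)\<^sup>2 + 2 * \<kappa> * (a x)\<^sup>2 - 2 * c0 * a x)"
    have "(e has_real_derivative 0) (at x)" for x
      unfolding e_def power2_eq_square
      by (rule DERIV_cong[OF DERIV_diff[OF DERIV_add[OF DERIV_mult[OF a' a'] DERIV_cmult[OF DERIV_mult[OF a a]]] DERIV_cmult[OF a]]])
         (simp add: algebra_simps)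
    then have e: "e x = e 0" for x by (intro DERIV_isconst_all) auto
    define M where "M = max 1 ((c0 + \<bar>e 0\<bar> + 1) / \<kappa>)"
    obtain x where "M \<le> a x" using inf[of M] by (metis abs_ge_self)
    then have x: "1 \<le> a x" "(c0 + \<bar>e 0\<bar> + 1) / \<kappa> \<le> a x" unfolding M_def by simp_all
    then have "c0 + \<bar>e 0\<bar> + 1 \<le> \<kappa> * a x" using 1 by (simp add: pos_divide_le_eq mult.commute)
    then have p: "\<bar>e 0\<bar> + 1 \<le> \<kappa> * a x - c0" by linarith
    have "1 * (\<bar>e 0\<bar> + 1) \<le> a x * (\<kappa> * a x - c0)" by (rule mult_mono[OF x(1) p]) (use x(1) in auto)
    moreover have "e 0 = (a' x)\<^sup>2 + 2 * (a x * (\<kappa> * a x - c0))"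
      unfolding e[of x, symmetric] by (simp add: e_def algebra_simps power2_eq_square)
    moreover have "0 \<le> (a' x)\<^sup>2" by simp
    ultimately have "2 * (\<bar>e 0\<bar> + 1) \<le> e 0" by linarith
    then show ?thesis using double_abs_less by blast
  next
    case 2
    have d0: "d0 = c0" by (simp add: d0_def 2)
    have a1: "a' x = a' 0 + c0 * x" for x
    proof -
      have "((\<lambda>x. a' x - c0 * x) has_real_derivative 0) (at x)" for x
        using a' by (auto intro!: derivative_eq_intros simp: 2)
      then have "a' x - c0 * x = a' 0 - c0 * 0" by (intro DERIV_isconst_all) auto
      then show ?thesis by simp
    qed
    have a0: "a x = a 0 + a' 0 * x + c0 / 2 * x\<^sup>2" for x
    proof -
      have "((\<lambda>x. a x - a' 0 * x - c0 / 2 * x\<^sup>2) has_real_derivative 0) (at x)" for x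
        by (auto intro!: derivative_eq_intros a simp: a1[of x])
      then have "a x - a' 0 * x - c0 / 2 * x\<^sup>2 = a 0 - a' 0 * 0 - c0 / 2 * 0\<^sup>2" by (intro DERIV_isconst_all) auto
      then show ?thesis by simp
    qed
    have b1: "\<beta>' y = \<beta>' 0 + c0 * y" if y: "y \<in> {0..pi}" for y
    proof -
      have "\<beta>' y - c0 * y = \<beta>' 0 - c0 * 0"
        by (rule DERIV_within_const[OF _ y]) (use b' in \<open>auto intro!: derivative_eq_intros simp: 2 d0\<close>)
      then show ?thesis by simp
    qed
    have b0: "\<beta> y = a 0 + \<beta>' 0 * y + c0 / 2 * y\<^sup>2" if y: "y \<in> {0..pi}" for y
    proof -
      have "\<beta> y - \<beta>' 0 * y - c0 / 2 * y\<^sup>2 = \<beta> 0 - \<beta>' 0 * 0 - c0 / 2 * 0\<^sup>2"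
      proof (rule DERIV_within_const[OF _ y])
        fix t assume t: "t \<in> {0..pi}"
        have "((\<lambda>y. \<beta> y - \<beta>' 0 * y - c0 / 2 * y\<^sup>2) has_real_derivative \<beta>' t - \<beta>' 0 - c0 * t) (at t within {0..pi})"
          by (auto intro!: derivative_eq_intros b t)
        then show "((\<lambda>y. \<beta> y - \<beta>' 0 * y - c0 / 2 * y\<^sup>2) has_real_derivative 0) (at t within {0..pi})"
          by (rule DERIV_cong) (use b1[OF t] in linarith)
      qed
      then show ?thesis by (simp add: ab0)
    qed
    \<comment> \<open>Adding the values at \<open>Y\<close> and \<open>- Y\<close> cancels the
      linear term, so growth at both ends forces a positive leading coefficient.\<close>
    have c0: "0 < c0"
    proof (rule ccontr)
      assume "\<not> 0 < c0"
      obtain X where X: "\<forall>x. X \<le> \<bar>x\<bar> \<longrightarrow> a 0 + 1 \<le> a x" using inf by blast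
      obtain Y where Y: "a 0 + 1 \<le> a Y" "a 0 + 1 \<le> a (- Y)"
      proof
        show "a 0 + 1 \<le> a \<bar>X\<bar>" "a 0 + 1 \<le> a (- \<bar>X\<bar>)" by (rule X[rule_format]; simp)+
      qed
      have "2 \<le> c0 * Y\<^sup>2" using Y a0[of Y] a0[of "- Y"] by simp
      moreover have "c0 * Y\<^sup>2 \<le> 0" using \<open>\<not> 0 < c0\<close> by (intro mult_nonpos_nonneg) auto
      ultimately show False by linarith
    qed
    \<comment> \<open>Completing the square: the leading coefficient \<open>c0 / 2\<close> must
      equal \<open>1 / (2 * l)\<close>, and \<open>z0\<close> is the vertex.\<close>
    define l z0 where "l = 1 / c0" and "z0 = Complex (- a' 0 / c0) (- \<beta>' 0 / c0)"
    have "U w = (K * l\<^sup>2 + (cmod (w - z0))\<^sup>2) / (2 * l)" if w: "w \<in> strip" for w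
    proof -
      obtain x y where xy: "w = Complex x y" by (cases w)
      have y: "y \<in> {0..pi}" using w by (simp add: xy)
      have K': "K = 2 * c0 * a 0 - (a' 0)\<^sup>2 - (\<beta>' 0)\<^sup>2" using K by (simp add: 2 algebra_simps)
      have "U w = a 0 + a' 0 * x + c0 / 2 * x\<^sup>2 + \<beta>' 0 * y + c0 / 2 * y\<^sup>2"
        using U_eq[OF w] a0[of x] b0[OF y] by (simp add: xy)
      also have "\<dots> = (K * l\<^sup>2 + ((x - - a' 0 / c0)\<^sup>2 + (y - - \<beta>' 0 / c0)\<^sup>2)) / (2 * l)"
        unfolding K' l_def using c0 by (simp add: field_simps power2_eq_square)
      finally show ?thesis by (simp add: cmod_power2 xy z0_def)
    qed
    moreover have "0 < l" using c0 by (simp add: l_def)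
    ultimately show ?thesis by blast
  next
    case 3
    define \<gamma> where "\<gamma> = sqrt (- 2 * \<kappa>)"
    have \<gamma>: "0 < \<gamma>" and \<gamma>2: "\<gamma>\<^sup>2 = - 2 * \<kappa>" using 3 by (auto simp: \<gamma>_def)
    have \<kappa>0: "\<kappa> \<noteq> 0" using 3 by simp
    \<comment> \<open>Shifting by constant particular solutions makes both equations
      homogeneous.\<close>
    define A where "A = (\<lambda>x. a x + c0 / \<gamma>\<^sup>2)"
    define B where "B = (\<lambda>y. \<beta> y - d0 / \<gamma>\<^sup>2)"
    have A: "(A has_real_derivative a' x) (at x)" "(a' has_real_derivative \<gamma>\<^sup>2 * A x) (at x)" for x
      using a a' \<gamma> 3 by (auto simp: A_def \<gamma>2 algebra_simps intro!: derivative_eq_intros)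
    have B: "(B has_real_derivative \<beta>' y) (at y within {0..pi})"
      "(\<beta>' has_real_derivative - (\<gamma>\<^sup>2) * B y) (at y within {0..pi})" if "y \<in> {0..pi}" for y
      using b[OF that] b'[OF that] \<gamma> 3 by (auto simp: B_def \<gamma>2 algebra_simps intro!: derivative_eq_intros)
    define \<alpha> \<beta>1 P R where "\<alpha> = (A 0 + a' 0 / \<gamma>) / 2" and "\<beta>1 = (A 0 - a' 0 / \<gamma>) / 2" and "P = B 0" and "R = \<beta>' 0 / \<gamma>"
    have Aeq: "A x = \<alpha> * exp (\<gamma> * x) + \<beta>1 * exp (- (\<gamma> * x))" for x
      unfolding \<alpha>_def \<beta>1_def by (rule ode_exp[OF A \<gamma>])
    have Beq: "B y = P * cos (\<gamma> * y) + R * sin (\<gamma> * y)" if "y \<in> {0..pi}" for y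
      unfolding P_def R_def by (rule ode_trig[OF B \<gamma> that])
    have const: "a x + \<beta> y - a 0 = A x + B y" for x y
      using \<gamma> 3 by (simp add: A_def B_def d0_def \<gamma>2 field_simps)
    \<comment> \<open>The sign \<open>s\<close> selects one end of the strip; \<open>p\<close> is
      the coefficient of the exponential growing there, and \<open>a\<close> could not tend to
      infinity if \<open>p\<close> were not positive.\<close>
    have pos: "0 < p" if p: "\<And>x. 0 \<le> x \<Longrightarrow> A (s * x) = p * exp (\<gamma> * x) + q * exp (- (\<gamma> * x))" and s: "\<bar>s\<bar> = 1" for p q s
    proof (rule ccontr)
      assume np: "\<not> 0 < p"
      obtain X where X: "\<forall>x. X \<le> \<bar>x\<bar> \<longrightarrow> \<bar>q\<bar> + 1 - c0 / \<gamma>\<^sup>2 \<le> a x" using inf by blast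
      obtain Y where Y: "0 \<le> Y" "X \<le> \<bar>s * Y\<bar>"
      proof
        show "X \<le> \<bar>s * \<bar>X\<bar>\<bar>" unfolding abs_mult s by simp
      qed simp
      have "\<bar>q\<bar> + 1 - c0 / \<gamma>\<^sup>2 \<le> a (s * Y)" by (rule X[rule_format, OF Y(2)])
      then have "\<bar>q\<bar> + 1 \<le> A (s * Y)" unfolding A_def by linarith
      moreover have "A (s * Y) = p * exp (\<gamma> * Y) + q * exp (- (\<gamma> * Y))" by (rule p[OF Y(1)])
      moreover have "p * exp (\<gamma> * Y) \<le> 0" using np by (intro mult_nonpos_nonneg) auto
      moreover have "q * exp (- (\<gamma> * Y)) \<le> \<bar>q\<bar> * 1" using \<gamma> Y(1) by (intro mult_mono) auto
      ultimately show False by linarith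
    qed
    have \<alpha>: "0 < \<alpha>" by (rule pos[of 1 \<alpha> \<beta>1]) (use Aeq in auto)
    have \<beta>1: "0 < \<beta>1" by (rule pos[of "-1" \<beta>1 \<alpha>]) (use Aeq in auto)
    have K': "K = \<gamma>\<^sup>2 * (4 * \<alpha> * \<beta>1 - P\<^sup>2 - R\<^sup>2)"
    proof -
      have 1: "a' 0 = \<gamma> * (\<alpha> - \<beta>1)" "\<beta>' 0 = \<gamma> * R" using \<gamma> by (simp_all add: \<alpha>_def \<beta>1_def R_def field_simps)
      have 2: "A 0 = \<alpha> + \<beta>1" by (simp add: \<alpha>_def \<beta>1_def field_simps)
      have 3: "a 0 = \<alpha> + \<beta>1 + P" using const[of 0 0] ab0 2 by (simp add: P_def)
      have 4: "c0 - 2 * \<kappa> * a 0 = \<gamma>\<^sup>2 * (\<alpha> + \<beta>1)" using 2 \<kappa>0 unfolding A_def \<gamma>2 by (simp add: field_simps)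
      have 5: "c0 = - (\<gamma>\<^sup>2) * P" using 4 unfolding 3 by (simp add: \<gamma>2 algebra_simps)
      show ?thesis using K unfolding 4 unfolding 1 5 unfolding 3 by (simp add: algebra_simps power2_eq_square)
    qed
    \<comment> \<open>Read off by comparing the coefficients of \<open>exp (\<gamma> * x)\<close>,
      of the cosine and of the sine. The coefficient of \<open>exp (- (\<gamma> * x))\<close> then
      agrees because of \<open>K'\<close>.\<close>
    define l z0 where "l = 1 / (2 * \<alpha> * \<gamma>)" and "z0 = Complex (- P / (2 * \<alpha>)) (- R / (2 * \<alpha>))"
    have l: "0 < l" using \<alpha> \<gamma> by (simp add: l_def)
    have z0: "K * l\<^sup>2 + (cmod z0)\<^sup>2 = \<beta>1 / \<alpha>"
      unfolding K' l_def z0_def cmod_power2 complex.sel using \<alpha> \<gamma> by (simp add: field_simps power2_eq_square)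
    have "U w = (K * l\<^sup>2 + (cmod (exp (complex_of_real \<gamma> * w) - z0))\<^sup>2) / (2 * l * \<gamma> * exp (\<gamma> * Re w))"
      if w: "w \<in> strip" for w
    proof -
      obtain x y where xy: "w = Complex x y" by (cases w)
      have y: "y \<in> {0..pi}" using w by (simp add: xy)
      define E C S where "E = exp (\<gamma> * x)" and "C = cos (\<gamma> * y)" and "S = sin (\<gamma> * y)"
      have E: "0 < E" "exp (- (\<gamma> * x)) = 1 / E" by (simp_all add: E_def exp_minus field_simps)
      have CS: "C\<^sup>2 + S\<^sup>2 = 1" by (simp add: C_def S_def)
      have "(cmod (exp (complex_of_real \<gamma> * w) - z0))\<^sup>2 = (E * C - Re z0)\<^sup>2 + (E * S - Im z0)\<^sup>2"
        by (simp add: cmod_power2 Re_exp Im_exp xy E_def C_def S_def)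
      also have "\<dots> = E\<^sup>2 * (C\<^sup>2 + S\<^sup>2) - 2 * E * (C * Re z0 + S * Im z0) + (cmod z0)\<^sup>2"
        unfolding cmod_power2 by (simp add: algebra_simps power2_eq_square)
      finally have "K * l\<^sup>2 + (cmod (exp (complex_of_real \<gamma> * w) - z0))\<^sup>2 = E\<^sup>2 - 2 * E * (C * Re z0 + S * Im z0) + \<beta>1 / \<alpha>"
        using z0 CS by simp
      also have "\<dots> = (\<alpha> * E\<^sup>2 + E * (P * C + R * S) + \<beta>1) / \<alpha>"
        unfolding z0_def complex.sel using \<alpha> by (simp add: field_simps)
      finally have "(K * l\<^sup>2 + (cmod (exp (complex_of_real \<gamma> * w) - z0))\<^sup>2) / (2 * l * \<gamma> * E)
          = \<alpha> * E + \<beta>1 * (1 / E) + (P * C + R * S)"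
        unfolding l_def using \<alpha> \<gamma> E(1) by (simp add: field_simps power2_eq_square)
      also have "\<dots> = U w"
        using U_eq[OF w] const[of x y] Aeq[of x] Beq[OF y] by (simp add: xy E(2) E_def[symmetric] C_def[symmetric] S_def[symmetric])
      finally show ?thesis by (simp add: xy E_def)
    qed
    moreover have "K * l\<^sup>2 + (cmod z0)\<^sup>2 \<noteq> 0" using z0 \<alpha> \<beta>1 by simp
    ultimately show ?thesis using \<gamma> l by blast
  qed
qed

end

section \<open>Transfer to the half plane\<close>

lemma exp_strip:
  assumes "w \<in> strip"
  shows "exp w \<in> closed_half_plane_punct"
  using assms by (auto simp: strip_def closed_half_plane_punct_def Im_exp sin_ge_zero)

lemma has_derivative_exp_coord:
  assumes f: "\<And>z. z \<in> closed_half_plane_punct \<Longrightarrow>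
      (f has_derivative (\<lambda>h. p z * Re h + q z * Im h)) (at z within closed_half_plane_punct)"
    and w: "w \<in> strip"
  shows "((\<lambda>w. f (exp w)) has_derivative (\<lambda>h. (p (exp w) * Re (exp w) + q (exp w) * Im (exp w)) * Re h
     + (q (exp w) * Re (exp w) - p (exp w) * Im (exp w)) * Im h)) (at w within strip)"
proof -
  have e: "(exp has_derivative (\<lambda>h. exp w * h)) (at w within strip)"
    using DERIV_exp[of w] unfolding has_field_derivative_def by (rule has_derivative_at_withinI)
  have "(f has_derivative (\<lambda>h. p (exp w) * Re h + q (exp w) * Im h)) (at (exp w) within exp ` strip)"
    by (rule has_derivative_subset[OF f[OF exp_strip[OF w]]]) (use exp_strip in auto)
  from diff_chain_within[OF e this] have
    "((\<lambda>w. f (exp w)) has_derivative (\<lambda>h. p (exp w) * Re (exp w * h) + q (exp w) * Im (exp w * h))) (at w within strip)"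
    by (simp add: o_def)
  then show ?thesis
    by (rule has_derivative_eq_rhs) (simp only: times_complex.sel fun_eq_iff, simp add: algebra_simps)
qed

lemma C2_partials_exp_coord:
  fixes v vs vt vss vst vts vtt :: "complex \<Rightarrow> real"
  assumes C2: "C2_partials closed_half_plane_punct v vs vt vss vst vts vtt"
  defines "a \<equiv> \<lambda>w. Re (exp w)" and "b \<equiv> \<lambda>w. Im (exp w)"
  shows "C2_partials strip (\<lambda>w. v (exp w) + 2 * Re w)
    (\<lambda>w. vs (exp w) * a w + vt (exp w) * b w + 2)
    (\<lambda>w. vt (exp w) * a w - vs (exp w) * b w)
    (\<lambda>w. (vss (exp w) * a w + vst (exp w) * b w) * a w + vs (exp w) * a w + (vts (exp w) * a w + vtt (exp w) * b w) * b w + vt (exp w) * b w)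
    (\<lambda>w. (vst (exp w) * a w - vss (exp w) * b w) * a w - vs (exp w) * b w + (vtt (exp w) * a w - vts (exp w) * b w) * b w + vt (exp w) * a w)
    (\<lambda>w. (vts (exp w) * a w + vtt (exp w) * b w) * a w + vt (exp w) * a w - (vss (exp w) * a w + vst (exp w) * b w) * b w - vs (exp w) * b w)
    (\<lambda>w. (vtt (exp w) * a w - vts (exp w) * b w) * a w - vt (exp w) * b w - (vst (exp w) * a w - vss (exp w) * b w) * b w - vs (exp w) * a w)"
proof -
  let ?S = closed_half_plane_punct
  have D: "z \<in> ?S \<Longrightarrow> (v has_derivative (\<lambda>h. vs z * Re h + vt z * Im h)) (at z within ?S)"
    "z \<in> ?S \<Longrightarrow> (vs has_derivative (\<lambda>h. vss z * Re h + vst z * Im h)) (at z within ?S)"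
    "z \<in> ?S \<Longrightarrow> (vt has_derivative (\<lambda>h. vts z * Re h + vtt z * Im h)) (at z within ?S)" for z
    using C2 by (auto simp: C2_partials_def)
  note d = has_derivative_exp_coord[OF D(1)] has_derivative_exp_coord[OF D(2)] has_derivative_exp_coord[OF D(3)]
  have e: "(exp has_derivative (\<lambda>h. exp w * h)) (at w within strip)" for w :: complex
    using DERIV_exp[of w] unfolding has_field_derivative_def by (rule has_derivative_at_withinI)
  have da: "(a has_derivative (\<lambda>h. a w * Re h - b w * Im h)) (at w within strip)" for w
    unfolding a_def b_def by (rule has_derivative_eq_rhs[OF has_derivative_Re[OF e]]) simp
  have db: "(b has_derivative (\<lambda>h. b w * Re h + a w * Im h)) (at w within strip)" for w
    unfolding a_def b_def by (rule has_derivative_eq_rhs[OF has_derivative_Im[OF e]]) (simp add: fun_eq_iff)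
  have c: "continuous_on strip (\<lambda>w. f (exp w))" if "continuous_on ?S f" for f :: "complex \<Rightarrow> real"
    by (rule continuous_on_compose2[OF that]) (auto intro!: continuous_intros exp_strip)
  have cab: "continuous_on strip a" "continuous_on strip b"
    unfolding a_def b_def by (intro continuous_intros)+
  show ?thesis
    unfolding C2_partials_def
  proof (intro conjI ballI)
    fix w assume w: "w \<in> strip"
    have r: "((\<lambda>w. 2 * Re w) has_derivative (\<lambda>h. 2 * Re h)) (at w within strip)"
      by (rule has_derivative_mult_right[OF has_derivative_Re[OF has_derivative_ident]])
    show "((\<lambda>w. v (exp w) + 2 * Re w) has_derivative (\<lambda>h. (vs (exp w) * a w + vt (exp w) * b w + 2) * Re h
        + (vt (exp w) * a w - vs (exp w) * b w) * Im h)) (at w within strip)"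
      by (rule has_derivative_eq_rhs[OF has_derivative_add[OF d(1)[OF _ w] r]]) (auto simp: a_def b_def algebra_simps)
    show "((\<lambda>w. vs (exp w) * a w + vt (exp w) * b w + 2) has_derivative (\<lambda>h.
        ((vss (exp w) * a w + vst (exp w) * b w) * a w + vs (exp w) * a w + (vts (exp w) * a w + vtt (exp w) * b w) * b w + vt (exp w) * b w) * Re h
      + ((vst (exp w) * a w - vss (exp w) * b w) * a w - vs (exp w) * b w + (vtt (exp w) * a w - vts (exp w) * b w) * b w + vt (exp w) * a w) * Im h)) (at w within strip)"
      by (rule has_derivative_eq_rhs[OF has_derivative_add[OF has_derivative_add[OF
              has_derivative_mult[OF d(2)[OF _ w] da] has_derivative_mult[OF d(3)[OF _ w] db]]
            has_derivative_const[of 2]]])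
         (auto simp: a_def b_def algebra_simps)
    show "((\<lambda>w. vt (exp w) * a w - vs (exp w) * b w) has_derivative (\<lambda>h.
        ((vts (exp w) * a w + vtt (exp w) * b w) * a w + vt (exp w) * a w - (vss (exp w) * a w + vst (exp w) * b w) * b w - vs (exp w) * b w) * Re h
      + ((vtt (exp w) * a w - vts (exp w) * b w) * a w - vt (exp w) * b w - (vst (exp w) * a w - vss (exp w) * b w) * b w - vs (exp w) * a w) * Im h)) (at w within strip)"
      by (rule has_derivative_eq_rhs[OF has_derivative_diff[OF
              has_derivative_mult[OF d(3)[OF _ w] da] has_derivative_mult[OF d(2)[OF _ w] db]]])
         (auto simp: a_def b_def algebra_simps)
  qed (intro continuous_intros c cab C2_partials_continuous[OF C2])+
qed

theorem theorem6p1: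
  fixes K c1 c2 :: real
    and v vs vt vss vst vts vtt :: "complex \<Rightarrow> real"
  assumes K: "K \<in> {-1, 0, 1}"
    and C2: "C2_partials closed_half_plane_punct v vs vt vss vst vts vtt"
    and pde: "\<forall>z\<in>open_half_plane. vss z + vtt z + 2 * K * exp (v z) = 0"
    and bc1: "\<forall>s::real. s > 0 \<longrightarrow> vt (complex_of_real s) = c1 * exp (v (complex_of_real s) / 2)"
    and bc2: "\<forall>s::real. s < 0 \<longrightarrow> vt (complex_of_real s) = c2 * exp (v (complex_of_real s) / 2)"
    and fin: "(\<lambda>z. exp (v z)) integrable_on open_half_plane"
  shows "canonical_solution K v"
proof -
  let ?S = closed_half_plane_punct
  note cv = C2_partials_continuous[OF C2]
  have "continuous_on ?S (\<lambda>z. vss z + vtt z + 2 * K * exp (v z))" by (intro continuous_intros cv)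
  then have pde': "vss z + vtt z + 2 * K * exp (v z) = 0" if "z \<in> ?S" for z
    by (rule closed_half_plane_extension) (use pde that in auto)
  define c0 where "c0 = \<bar>c1\<bar> + \<bar>c2\<bar>"
  have c0: "0 \<le> c0" "- c0 \<le> c1" "- c0 \<le> c2" by (auto simp: c0_def)
  have bc: "- c0 * exp (v (complex_of_real s) / 2) \<le> vt (complex_of_real s)" if "s \<noteq> 0" for s
  proof (cases "0 < s")
    case True
    then show ?thesis unfolding bc1[rule_format, OF True] by (intro mult_right_mono c0) auto
  next
    case False
    then have s: "s < 0" using that by simp
    show ?thesis unfolding bc2[rule_format, OF s] by (intro mult_right_mono c0) auto
  qed
  have K1: "K \<le> 1" using K by auto
  let ?a = "\<lambda>w. Re (exp w)" and ?b = "\<lambda>w. Im (exp w)"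
  \<comment> \<open>The summand \<open>2 * Re w\<close> absorbs the factor
    \<open>exp (2 * Re w)\<close> that the Laplacian acquires under \<open>exp\<close>, and half of
    it absorbs the factor \<open>exp (Re w)\<close> of the edge derivative.\<close>
  define V where "V = (\<lambda>w. v (exp w) + 2 * Re w)"
  have ab: "(Re (exp w))\<^sup>2 + (Im (exp w))\<^sup>2 = exp (2 * Re w)" for w
    by (simp add: exp_double flip: cmod_power2)
  define Vx where "Vx = (\<lambda>w. vs (exp w) * ?a w + vt (exp w) * ?b w + 2)"
  define Vy where "Vy = (\<lambda>w. vt (exp w) * ?a w - vs (exp w) * ?b w)"
  define Vxx where "Vxx = (\<lambda>w. (vss (exp w) * ?a w + vst (exp w) * ?b w) * ?a w + vs (exp w) * ?a w + (vts (exp w) * ?a w + vtt (exp w) * ?b w) * ?b w + vt (exp w) * ?b w)"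
  define Vxy where "Vxy = (\<lambda>w. (vst (exp w) * ?a w - vss (exp w) * ?b w) * ?a w - vs (exp w) * ?b w + (vtt (exp w) * ?a w - vts (exp w) * ?b w) * ?b w + vt (exp w) * ?a w)"
  define Vyx where "Vyx = (\<lambda>w. (vts (exp w) * ?a w + vtt (exp w) * ?b w) * ?a w + vt (exp w) * ?a w - (vss (exp w) * ?a w + vst (exp w) * ?b w) * ?b w - vs (exp w) * ?b w)"
  define Vyy where "Vyy = (\<lambda>w. (vtt (exp w) * ?a w - vts (exp w) * ?b w) * ?a w - vt (exp w) * ?b w - (vst (exp w) * ?a w - vss (exp w) * ?b w) * ?b w - vs (exp w) * ?a w)"
  \<comment> \<open>The sign at \<open>c2\<close>: near the edge \<open>Im w = pi\<close> the map
    \<open>exp\<close> is close to a negative multiple of the identity, so increasing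
    \<open>Im w\<close> lowers \<open>Im z\<close>.\<close>
  interpret liouville_strip K c1 "- c2" V Vx Vy Vxx Vxy Vyx Vyy
  proof
    show "C2_partials strip V Vx Vy Vxx Vxy Vyx Vyy"
      unfolding V_def Vx_def Vy_def Vxx_def Vxy_def Vyx_def Vyy_def by (rule C2_partials_exp_coord[OF C2])
  next
    fix w assume w: "w \<in> strip"
    have "Vxx w + Vyy w = (vss (exp w) + vtt (exp w)) * ((?a w)\<^sup>2 + (?b w)\<^sup>2)"
      unfolding Vxx_def Vyy_def by algebra
    also have "vss (exp w) + vtt (exp w) = - 2 * K * exp (v (exp w))"
      using pde'[OF exp_strip[OF w]] by linarith
    finally show "Vxx w + Vyy w = - 2 * K * exp (V w)"
      unfolding ab V_def by (simp only: exp_add mult.assoc)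
  next
    fix x :: real
    have e: "exp (Complex x 0) = complex_of_real (exp x)" by (simp add: complex_eq_iff Re_exp Im_exp)
    show "Vy (Complex x 0) = c1 * exp (V (Complex x 0) / 2)"
      using bc1[rule_format, of "exp x"] unfolding V_def Vy_def e by (simp add: add_divide_distrib exp_add)
    have e': "exp (Complex x pi) = complex_of_real (- exp x)" by (simp add: complex_eq_iff Re_exp Im_exp)
    show "Vy (Complex x pi) = - c2 * exp (V (Complex x pi) / 2)"
      using bc2[rule_format, of "- exp x"] unfolding V_def Vy_def e' by (simp add: add_divide_distrib exp_add)
  next
    fix M :: real
    obtain N :: nat where N: "0 < N" "\<And>z. z \<in> ?S \<Longrightarrow> cmod z < 1 / real N \<or> real N < cmod z \<Longrightarrow> cmod z * exp (v z / 2) < exp (M / 2)"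
      using finite_area_decay[OF C2 pde' K1 c0(1) bc fin, of "exp (M / 2)"] by (metis exp_gt_zero)
    \<comment> \<open>The summand 1 yields the strict inequalities required by
      \<open>finite_area_decay\<close>.\<close>
    have "V w \<le> M" if w: "w \<in> strip" "ln (real N) + 1 \<le> \<bar>Re w\<bar>" for w
    proof -
      have "Re w < - ln (real N) \<or> ln (real N) < Re w" using w(2) by (cases "0 \<le> Re w") simp_all
      then have "exp (Re w) < exp (- ln (real N)) \<or> exp (ln (real N)) < exp (Re w)" by simp
      then have "cmod (exp w) < 1 / real N \<or> real N < cmod (exp w)"
        using N(1) by (simp add: exp_minus inverse_eq_divide)
      from N(2)[OF exp_strip[OF w(1)] this] have "exp (Re w) * exp (v (exp w) / 2) < exp (M / 2)" by simp
      then have "exp (Re w + v (exp w) / 2) < exp (M / 2)" unfolding exp_add .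
      then show ?thesis by (simp add: V_def)
    qed
    then show "\<exists>X. \<forall>w\<in>strip. X \<le> \<bar>Re w\<bar> \<longrightarrow> V w \<le> M" by blast
  qed
  have log: "Ln z \<in> strip" "exp (- v z) = (cmod z * U (Ln z))\<^sup>2" "0 < U (Ln z)" "0 < cmod z" if z: "z \<in> ?S" for z
  proof -
    have nz: "z \<noteq> 0" "0 \<le> Im z" using z by (auto simp: closed_half_plane_punct_def)
    show "Ln z \<in> strip" using Im_Ln_le_pi[OF nz(1)] Im_Ln_pos_le[OF nz(1)] nz(2) by (simp add: strip_def)
    show "0 < cmod z" using nz by simp
    show "0 < U (Ln z)" by (rule U_pos)
    have "U (Ln z) = exp (- v z / 2 - ln (cmod z))"
      unfolding U_def unfolding V_def using nz by (simp add: add_divide_distrib)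
    also have "\<dots> = exp (- v z / 2) / cmod z" using nz by (simp add: exp_diff)
    finally have "cmod z * U (Ln z) = exp (- v z / 2)" using nz by simp
    then show "exp (- v z) = (cmod z * U (Ln z))\<^sup>2" by (simp flip: exp_double)
  qed
  from classification show ?thesis
  proof (elim disjE exE conjE)
    fix \<gamma> l :: real and z0 :: complex
    assume \<gamma>: "0 < \<gamma>" and l: "0 < l" and ne: "K * l\<^sup>2 + (cmod z0)\<^sup>2 \<noteq> 0"
      and U: "\<forall>w\<in>strip. U w = (K * l\<^sup>2 + (cmod (exp (complex_of_real \<gamma> * w) - z0))\<^sup>2) / (2 * l * \<gamma> * exp (\<gamma> * Re w))"
    have main: "K * l\<^sup>2 + (cmod (z powr complex_of_real \<gamma> - z0))\<^sup>2 \<noteq> 0 \<and> v z = canonical_v1 K \<gamma> l z0 z" if z: "z \<in> ?S" for z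
    proof -
      define N where "N = K * l\<^sup>2 + (cmod (z powr complex_of_real \<gamma> - z0))\<^sup>2"
      define r where "r = cmod z"
      have r: "0 < r" using log(4)[OF z] by (simp add: r_def)
      have UN: "U (Ln z) = N / (2 * l * \<gamma> * r powr \<gamma>)"
        using U[rule_format, OF log(1)[OF z]] r by (auto simp: N_def powr_def r_def)
      \<comment> \<open>Positivity of \<open>U\<close> is what guarantees the nonvanishing
        denominator demanded of a canonical solution.\<close>
      have N: "N \<noteq> 0" using log(3)[OF z] unfolding UN by auto
      have p: "r powr (2 * (\<gamma> - 1)) = (r powr \<gamma>)\<^sup>2 / r\<^sup>2"
      proof -
        have "2 * (\<gamma> - 1) = \<gamma> + \<gamma> - 2" by simp
        then show ?thesis using r by (simp only: powr_diff powr_add) (simp add: power2_eq_square)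
      qed
      have "exp (v z) = 1 / exp (- v z)" by (simp add: exp_minus inverse_eq_divide)
      also have "\<dots> = 1 / (r * U (Ln z))\<^sup>2" by (simp only: log(2)[OF z] r_def)
      also have "\<dots> = 4 * l\<^sup>2 * \<gamma>\<^sup>2 * r powr (2 * (\<gamma> - 1)) / N\<^sup>2"
        unfolding UN p using r l \<gamma> N by (simp add: field_simps power2_eq_square)
      finally have "v z = ln (4 * l\<^sup>2 * \<gamma>\<^sup>2 * r powr (2 * (\<gamma> - 1)) / N\<^sup>2)" by (metis ln_exp)
      then show ?thesis using N by (simp add: canonical_v1_def N_def r_def)
    qed
    \<comment> \<open>At \<open>z = 0\<close> the power
      \<open>z powr complex_of_real \<gamma>\<close> is 0, and the claim is the inequality on
      \<open>z0\<close> supplied by \<open>classification\<close>.\<close>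
    have "K * l\<^sup>2 + (cmod (z powr complex_of_real \<gamma> - z0))\<^sup>2 \<noteq> 0" if "0 \<le> Im z" for z
      using main[of z] ne that by (cases "z = 0") (auto simp: closed_half_plane_punct_def)
    then show ?thesis
      unfolding canonical_solution_def using \<gamma> l main by blast
  next
    fix l :: real and z0 :: complex
    assume l: "0 < l" and U: "\<forall>w\<in>strip. U w = (K * l\<^sup>2 + (cmod (w - z0))\<^sup>2) / (2 * l)"
    have "K * l\<^sup>2 + (cmod (Ln z - z0))\<^sup>2 \<noteq> 0 \<and> v z = canonical_v2 K l z0 z" if z: "z \<in> ?S" for z
    proof -
      define N where "N = K * l\<^sup>2 + (cmod (Ln z - z0))\<^sup>2"
      define r where "r = cmod z"
      have r: "0 < r" using log(4)[OF z] by (simp add: r_def)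
      have UN: "U (Ln z) = N / (2 * l)"
        using U[rule_format, OF log(1)[OF z]] by (simp add: N_def)
      have N: "N \<noteq> 0" using log(3)[OF z] unfolding UN by auto
      have "exp (v z) = 1 / exp (- v z)" by (simp add: exp_minus inverse_eq_divide)
      also have "\<dots> = 1 / (r * U (Ln z))\<^sup>2" by (simp only: log(2)[OF z] r_def)
      also have "\<dots> = 4 * l\<^sup>2 / (r\<^sup>2 * N\<^sup>2)"
        unfolding UN using r l N by (simp add: field_simps power2_eq_square)
      finally have "v z = ln (4 * l\<^sup>2 / (r\<^sup>2 * N\<^sup>2))" by (metis ln_exp)
      then show ?thesis using N by (simp add: canonical_v2_def N_def r_def)
    qed
    then show ?thesis
      unfolding canonical_solution_def using l by blast
  qed
qed

end
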